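(* Let $X\subset\mathbb{P}^4_{\mathbb{Q}}$ be the projective closure of the affine surface in $(x,y,u,v)$-space over $\mathbb{Q}$ given by $$x^2+y=u^2,\qquad x+y^2=v^2.$$ Then $X$ is a smooth intersection of two quadrics in $\mathbb{P}^4$, hence a del Pezzo surface of degree $4$ over $\mathbb{Q}$, and the rational map $\phi\colon\mathbb{P}^2\dashrightarrow X$ over $\mathbb{Q}$ given in affine coordinates $(\lambda,\mu)$ on $\mathbb{P}^2$ by $$x=\frac{\mu^2-\lambda^4}{4\lambda^3-4\lambda\mu+1},\quad y=2\lambda x+\lambda^2,\quad u=x+\lambda,\quad v=2\lambda x+\mu$$ is birational, with inverse given by $\lambda=u-x$, $\mu=v-2\lambda x$.
   Context: In homogeneous coordinates $(x:y:u:v:z)$ on $\mathbb{P}^4$, the surface $X$ is given by $x^2+yz=u^2$, $xz+y^2=v^2$. A rational map is birational if it has a rational inverse defined over the same ground field. *)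

theory Defs
  imports
    Complex_Main
    "HOL-Library.Poly_Mapping"
    "HOL-Computational_Algebra.Fraction_Field"
    "HOL-Computational_Algebra.Polynomial"
    "HOL-Algebra.Ideal"
begin

section \<open>Polynomials in the variables X_0, ..., X_n\<close>

text \<open>
  A monomial is a finitely supported exponent vector; a polynomial is a finitely supported
  function from monomials to coefficients, with the convolution product.
\<close>

type_synonym mon = "nat \<Rightarrow>\<^sub>0 nat"
type_synonym 'k mpoly = "mon \<Rightarrow>\<^sub>0 'k"

definition Var :: "nat \<Rightarrow> 'k::comm_ring_1 mpoly" where
  "Var i = Poly_Mapping.single (Poly_Mapping.single i 1) 1"

definition Const :: "'k::comm_ring_1 \<Rightarrow> 'k mpoly" where
  "Const c = Poly_Mapping.single 0 c"

definition mon_degree :: "mon \<Rightarrow> nat" where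
  "mon_degree m = (\<Sum>i\<in>Poly_Mapping.keys m. Poly_Mapping.lookup m i)"

definition polys :: "nat \<Rightarrow> 'k::comm_ring_1 mpoly set" where
  "polys n = {p. \<forall>m\<in>Poly_Mapping.keys p. Poly_Mapping.keys m \<subseteq> {..n}}"

definition forms :: "nat \<Rightarrow> nat \<Rightarrow> 'k::comm_ring_1 mpoly set" where
  "forms n d = {p \<in> polys n. \<forall>m\<in>Poly_Mapping.keys p. mon_degree m = d}"

definition poly_ring :: "nat \<Rightarrow> 'k::comm_ring_1 mpoly ring" where
  "poly_ring n = \<lparr>carrier = polys n, monoid.mult = (*), one = 1, zero = 0, add = (+)\<rparr>"

text \<open>Evaluation at the point \<open>x\<close>, with the coefficients mapped by \<open>c\<close>.\<close>

definition eval_poly :: "('k::comm_ring_1 \<Rightarrow> 'a::comm_ring_1) \<Rightarrow> (nat \<Rightarrow> 'a) \<Rightarrow> 'k mpoly \<Rightarrow> 'a" where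
  "eval_poly c x p =
     (\<Sum>m\<in>Poly_Mapping.keys p. c (Poly_Mapping.lookup p m) *
        (\<Prod>i\<in>Poly_Mapping.keys m. x i ^ Poly_Mapping.lookup m i))"

definition partial_deriv :: "nat \<Rightarrow> 'k::comm_ring_1 mpoly \<Rightarrow> 'k mpoly" where
  "partial_deriv i p =
     (\<Sum>m\<in>Poly_Mapping.keys p.
        Poly_Mapping.single (m - Poly_Mapping.single i 1)
          (of_nat (Poly_Mapping.lookup m i) * Poly_Mapping.lookup p m))"

definition hom_part :: "nat \<Rightarrow> 'k::comm_ring_1 mpoly \<Rightarrow> 'k mpoly" where
  "hom_part d p =
     (\<Sum>m\<in>{m \<in> Poly_Mapping.keys p. mon_degree m = d}.
        Poly_Mapping.single m (Poly_Mapping.lookup p m))"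

definition total_degree :: "'k::comm_ring_1 mpoly \<Rightarrow> nat" where
  "total_degree p = (if p = 0 then 0 else Max (mon_degree ` Poly_Mapping.keys p))"

text \<open>Homogenization with respect to the additional variable X_k.\<close>

definition homogenize :: "nat \<Rightarrow> 'k::comm_ring_1 mpoly \<Rightarrow> 'k mpoly" where
  "homogenize k p =
     (\<Sum>m\<in>Poly_Mapping.keys p.
        Poly_Mapping.single (m + Poly_Mapping.single k (total_degree p - mon_degree m))
          (Poly_Mapping.lookup p m))"


section \<open>Projective varieties over the rational numbers\<close>

text \<open>
  A closed subvariety of the projective space of dimension \<open>n\<close> over the rationals is given by
  its homogeneous prime ideal in \<open>poly_ring n\<close>; projective space itself is the ideal \<open>{0}\<close>.
\<close>

definition homogeneous_ideal :: "nat \<Rightarrow> rat mpoly set \<Rightarrow> bool" where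
  "homogeneous_ideal n I \<longleftrightarrow> ideal I (poly_ring n) \<and> (\<forall>p\<in>I. \<forall>d. hom_part d p \<in> I)"

definition projective_variety :: "nat \<Rightarrow> rat mpoly set \<Rightarrow> bool" where
  "projective_variety n I \<longleftrightarrow>
     homogeneous_ideal n I \<and> primeideal I (poly_ring n) \<and> \<not> Var ` {..n} \<subseteq> I"

text \<open>
  Integrality after extension of the ground field to the complex numbers, which is equivalent to
  integrality over an algebraic closure of the rationals.
\<close>

definition geometrically_integral :: "nat \<Rightarrow> rat mpoly set \<Rightarrow> bool" where
  "geometrically_integral n I \<longleftrightarrow>
     primeideal (genideal (poly_ring n) (Poly_Mapping.map of_rat ` I))
       (poly_ring n :: complex mpoly ring)"

text \<open>
  The projective closure of the closed subscheme with ideal \<open>J\<close> of the affine space with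
  coordinates X_0, ..., X_n; the hyperplane at infinity is X_(n+1) = 0.
\<close>

definition projective_closure :: "nat \<Rightarrow> rat mpoly set \<Rightarrow> rat mpoly set" where
  "projective_closure n J = genideal (poly_ring (Suc n)) (homogenize (Suc n) ` J)"

text \<open>Homogeneous coordinate vectors of complex points; entries beyond index \<open>n\<close> are irrelevant.\<close>

definition points :: "nat \<Rightarrow> rat mpoly set \<Rightarrow> (nat \<Rightarrow> complex) set" where
  "points n I = {p. (\<exists>i\<le>n. p i \<noteq> 0) \<and> (\<forall>F\<in>I. eval_poly of_rat p F = 0)}"

definition hilbert_function :: "nat \<Rightarrow> rat mpoly set \<Rightarrow> nat \<Rightarrow> nat" where
  "hilbert_function n I d =
     vector_space.dim (\<lambda>c p. Const c * p) (forms n d :: rat mpoly set)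
     - vector_space.dim (\<lambda>c p. Const c * p) (I \<inter> forms n d)"

text \<open>Dimension and degree are read off from the Hilbert polynomial.\<close>

definition has_dim_degree :: "nat \<Rightarrow> rat mpoly set \<Rightarrow> nat \<Rightarrow> nat \<Rightarrow> bool" where
  "has_dim_degree n I r \<delta> \<longleftrightarrow>
     (\<exists>P :: rat poly. degree P = r \<and> lead_coeff P = of_nat \<delta> / fact r \<and>
        (\<forall>\<^sub>F d in sequentially. of_nat (hilbert_function n I d) = poly P (of_nat d)))"

definition gradient :: "nat \<Rightarrow> rat mpoly \<Rightarrow> (nat \<Rightarrow> complex) \<Rightarrow> nat \<Rightarrow>\<^sub>0 complex" where
  "gradient n F p = (\<Sum>i\<le>n. Poly_Mapping.single i (eval_poly of_rat p (partial_deriv i F)))"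

text \<open>Smoothness by the Jacobian criterion at all geometric points.\<close>

definition smooth_variety :: "nat \<Rightarrow> rat mpoly set \<Rightarrow> nat \<Rightarrow> bool" where
  "smooth_variety n I r \<longleftrightarrow>
     projective_variety n I \<and> geometrically_integral n I \<and> (\<exists>\<delta>. has_dim_degree n I r \<delta>) \<and>
     (\<forall>p\<in>points n I.
        vector_space.dim (\<lambda>c. Poly_Mapping.map ((*) c)) {gradient n F p | F. F \<in> I} + r = n)"


section \<open>Rational functions\<close>

definition to_fract :: "rat mpoly \<Rightarrow> rat mpoly fract" where
  "to_fract F = Fraction_Field.Fract F 1"

text \<open>
  The function field of the variety with ideal \<open>I\<close> is the residue field of the local ring of
  projective space along it: its elements are represented by the elements of \<open>rat_fun n I\<close>, and
  two of them are identified when their difference lies in \<open>null_fun n I\<close>.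
\<close>

definition rat_fun :: "nat \<Rightarrow> rat mpoly set \<Rightarrow> rat mpoly fract set" where
  "rat_fun n I = {Fraction_Field.Fract F G | F G d. F \<in> forms n d \<and> G \<in> forms n d \<and> G \<notin> I}"

definition null_fun :: "nat \<Rightarrow> rat mpoly set \<Rightarrow> rat mpoly fract set" where
  "null_fun n I = {Fraction_Field.Fract F G | F G. F \<in> I \<and> G \<in> polys n \<and> G \<notin> I}"

text \<open>
  Representatives of the elements, respectively units, of the local ring at the image of a complex
  point \<open>p\<close>. Every scheme point of a variety over the rationals is the image of a complex point.
\<close>

definition local_ring :: "nat \<Rightarrow> (nat \<Rightarrow> complex) \<Rightarrow> rat mpoly fract set" where
  "local_ring n p =
     {Fraction_Field.Fract F G | F G d. F \<in> forms n d \<and> G \<in> forms n d \<and> eval_poly of_rat p G \<noteq> 0}"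

definition local_units :: "nat \<Rightarrow> (nat \<Rightarrow> complex) \<Rightarrow> rat mpoly fract set" where
  "local_units n p =
     {Fraction_Field.Fract F G | F G d. F \<in> forms n d \<and> G \<in> forms n d \<and>
        eval_poly of_rat p F \<noteq> 0 \<and> eval_poly of_rat p G \<noteq> 0}"

text \<open>The affine coordinate X_i / X_k.\<close>

definition affine_coord :: "nat \<Rightarrow> nat \<Rightarrow> rat mpoly fract" where
  "affine_coord k i = Fraction_Field.Fract (Var i) (Var k)"


section \<open>Rational maps over the rational numbers\<close>

definition subst_poly :: "(nat \<Rightarrow> rat mpoly fract) \<Rightarrow> rat mpoly \<Rightarrow> rat mpoly fract" where
  "subst_poly r G = eval_poly (\<lambda>c. to_fract (Const c)) r G"

text \<open>
  A rational map from the variety \<open>I\<close> in projective \<open>n\<close>-space to the variety \<open>J\<close> in projective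
  \<open>m\<close>-space is a point (r_0 : ... : r_m) of \<open>J\<close> over the function field of \<open>I\<close>.
\<close>

definition rational_map ::
  "nat \<Rightarrow> rat mpoly set \<Rightarrow> nat \<Rightarrow> rat mpoly set \<Rightarrow> (nat \<Rightarrow> rat mpoly fract) \<Rightarrow> bool" where
  "rational_map n I m J r \<longleftrightarrow>
     projective_variety n I \<and> projective_variety m J \<and>
     (\<forall>i\<le>m. r i \<in> rat_fun n I) \<and> (\<exists>i\<le>m. r i \<notin> null_fun n I) \<and>
     (\<forall>G\<in>J. subst_poly r G \<in> null_fun n I)"

definition proj_eq ::
  "nat \<Rightarrow> rat mpoly set \<Rightarrow> nat \<Rightarrow> (nat \<Rightarrow> rat mpoly fract) \<Rightarrow> (nat \<Rightarrow> rat mpoly fract) \<Rightarrow> bool" where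
  "proj_eq n I m r s \<longleftrightarrow> (\<forall>i\<le>m. \<forall>j\<le>m. r i * s j - r j * s i \<in> null_fun n I)"

text \<open>
  \<open>is_composite n I m J k r s t\<close>: for \<open>r\<close> from \<open>I\<close> to \<open>J\<close> and \<open>s\<close> from \<open>J\<close> to projective
  \<open>k\<close>-space, the composite of \<open>s\<close> after \<open>r\<close> is defined as a rational map and equals \<open>t\<close>. The
  map \<open>s\<close> is represented by forms (G_0 : ... : G_k) that do not all vanish on the image of \<open>r\<close>.
\<close>

definition is_composite ::
  "nat \<Rightarrow> rat mpoly set \<Rightarrow> nat \<Rightarrow> rat mpoly set \<Rightarrow> nat \<Rightarrow> (nat \<Rightarrow> rat mpoly fract) \<Rightarrow>
   (nat \<Rightarrow> rat mpoly fract) \<Rightarrow> (nat \<Rightarrow> rat mpoly fract) \<Rightarrow> bool" where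
  "is_composite n I m J k r s t \<longleftrightarrow>
     (\<exists>G d. (\<forall>j\<le>k. G j \<in> forms m d) \<and> proj_eq m J k s (\<lambda>j. to_fract (G j)) \<and>
        (\<exists>j\<le>k. subst_poly r (G j) \<notin> null_fun n I) \<and>
        proj_eq n I k (\<lambda>j. subst_poly r (G j)) t)"

definition mutually_inverse ::
  "nat \<Rightarrow> rat mpoly set \<Rightarrow> nat \<Rightarrow> rat mpoly set \<Rightarrow> (nat \<Rightarrow> rat mpoly fract) \<Rightarrow>
   (nat \<Rightarrow> rat mpoly fract) \<Rightarrow> bool" where
  "mutually_inverse n I m J r s \<longleftrightarrow>
     rational_map n I m J r \<and> rational_map m J n I s \<and>
     is_composite n I m J n r s (\<lambda>i. to_fract (Var i)) \<and>
     is_composite m J n I m s r (\<lambda>i. to_fract (Var i))"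

definition birational_map ::
  "nat \<Rightarrow> rat mpoly set \<Rightarrow> nat \<Rightarrow> rat mpoly set \<Rightarrow> (nat \<Rightarrow> rat mpoly fract) \<Rightarrow> bool" where
  "birational_map n I m J r \<longleftrightarrow> (\<exists>s. mutually_inverse n I m J r s)"

definition regular_at ::
  "nat \<Rightarrow> rat mpoly set \<Rightarrow> nat \<Rightarrow> (nat \<Rightarrow> rat mpoly fract) \<Rightarrow> (nat \<Rightarrow> complex) \<Rightarrow> bool" where
  "regular_at n I m r p \<longleftrightarrow>
     (\<exists>s. (\<forall>i\<le>m. s i \<in> local_ring n p) \<and> (\<exists>i\<le>m. s i \<in> local_units n p) \<and> proj_eq n I m r s)"

definition isomorphic_varieties ::
  "nat \<Rightarrow> rat mpoly set \<Rightarrow> nat \<Rightarrow> rat mpoly set \<Rightarrow> bool" where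
  "isomorphic_varieties n I m J \<longleftrightarrow>
     (\<exists>r s. mutually_inverse n I m J r s \<and>
        (\<forall>p\<in>points n I. regular_at n I m r p) \<and> (\<forall>p\<in>points m J. regular_at m J n s p))"


section \<open>The canonical sheaf of a smooth surface\<close>

text \<open>Derivations of the function field; they are automatically linear over the rationals.\<close>

definition derivation :: "nat \<Rightarrow> rat mpoly set \<Rightarrow> (rat mpoly fract \<Rightarrow> rat mpoly fract) \<Rightarrow> bool" where
  "derivation n I D \<longleftrightarrow>
     (\<forall>f\<in>rat_fun n I. D f \<in> rat_fun n I) \<and>
     (\<forall>f\<in>rat_fun n I \<inter> null_fun n I. D f \<in> null_fun n I) \<and>
     (\<forall>f\<in>rat_fun n I. \<forall>g\<in>rat_fun n I. D (f + g) - (D f + D g) \<in> null_fun n I) \<and>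
     (\<forall>f\<in>rat_fun n I. \<forall>g\<in>rat_fun n I. D (f * g) - (f * D g + g * D f) \<in> null_fun n I)"

text \<open>
  A rational 2-form is represented by the alternating map it induces on pairs of derivations;
  this loses no information, since the function field is finitely generated.
\<close>

type_synonym two_form =
  "(rat mpoly fract \<Rightarrow> rat mpoly fract) \<Rightarrow> (rat mpoly fract \<Rightarrow> rat mpoly fract) \<Rightarrow> rat mpoly fract"

definition form_eq :: "nat \<Rightarrow> rat mpoly set \<Rightarrow> two_form \<Rightarrow> two_form \<Rightarrow> bool" where
  "form_eq n I \<omega> \<eta> \<longleftrightarrow>
     (\<forall>D E. derivation n I D \<longrightarrow> derivation n I E \<longrightarrow> \<omega> D E - \<eta> D E \<in> null_fun n I)"

text \<open>\<open>d_wedge a b\<close> is the wedge product of the differentials of \<open>a\<close> and \<open>b\<close>.\<close>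

definition d_wedge :: "rat mpoly fract \<Rightarrow> rat mpoly fract \<Rightarrow> two_form" where
  "d_wedge a b = (\<lambda>D E. D a * E b - D b * E a)"

text \<open>
  The stalk at \<open>p\<close> of the canonical sheaf of a smooth surface: the module of rational 2-forms
  generated over the local ring at \<open>p\<close> by the \<open>d_wedge a b\<close> with \<open>a\<close>, \<open>b\<close> in the local ring.
\<close>

definition canonical_stalk :: "nat \<Rightarrow> rat mpoly set \<Rightarrow> (nat \<Rightarrow> complex) \<Rightarrow> two_form set" where
  "canonical_stalk n I p =
     {\<omega>. \<exists>(N::nat) h a b.
        (\<forall>k<N. h k \<in> local_ring n p \<and> a k \<in> local_ring n p \<and> b k \<in> local_ring n p) \<and>
        form_eq n I \<omega> (\<lambda>D E. \<Sum>k<N. h k * d_wedge (a k) (b k) D E)}"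

definition generates_canonical_stalk ::
  "nat \<Rightarrow> rat mpoly set \<Rightarrow> (nat \<Rightarrow> complex) \<Rightarrow> two_form \<Rightarrow> bool" where
  "generates_canonical_stalk n I p \<tau> \<longleftrightarrow>
     \<tau> \<in> canonical_stalk n I p \<and>
     (\<forall>\<omega>\<in>canonical_stalk n I p. \<exists>h\<in>local_ring n p. form_eq n I \<omega> (\<lambda>D E. h * \<tau> D E))"

text \<open>
  \<open>anticanonical_power_is_O1 n I e\<close>: on the smooth surface \<open>I\<close>, the \<open>e\<close>-th power of the
  anticanonical sheaf is isomorphic to O(1). Equivalently, the tensor product of the \<open>e\<close>-th power
  of the canonical sheaf with O(1) has a rational section, the \<open>e\<close>-th power of \<open>\<eta>\<close> times the
  rational section A/B of O(1), that generates the stalk at every point. At \<open>p\<close>, local generators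
  are \<open>\<tau>\<close> and a coordinate X_i with \<open>p i \<noteq> 0\<close>.
\<close>

definition anticanonical_power_is_O1 :: "nat \<Rightarrow> rat mpoly set \<Rightarrow> nat \<Rightarrow> bool" where
  "anticanonical_power_is_O1 n I e \<longleftrightarrow>
     (\<exists>\<eta> A B d. A \<in> forms n (Suc d) \<and> A \<notin> I \<and> B \<in> forms n d \<and> B \<notin> I \<and>
        (\<forall>p\<in>points n I. \<exists>\<tau> h i. generates_canonical_stalk n I p \<tau> \<and>
           h \<in> rat_fun n I \<and> form_eq n I \<eta> (\<lambda>D E. h * \<tau> D E) \<and> i \<le> n \<and> p i \<noteq> 0 \<and>
           (\<exists>c\<in>local_units n p. h ^ e * Fraction_Field.Fract A (B * Var i) - c \<in> null_fun n I)))"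

text \<open>
  A del Pezzo surface is a smooth, projective, geometrically integral surface whose anticanonical
  sheaf is ample, and its degree is the self-intersection of a canonical divisor K. Ampleness:
  for some \<open>e > 0\<close> there is an embedding into a projective space, with image \<open>J\<close>, such that O(1)
  is the \<open>e\<close>-th power of the anticanonical sheaf. The degree of \<open>J\<close> is then the
  self-intersection of \<open>-e K\<close>, that is, \<open>e\<^sup>2\<close> times the degree of the del Pezzo surface.
\<close>

definition del_Pezzo_surface :: "nat \<Rightarrow> rat mpoly set \<Rightarrow> nat \<Rightarrow> bool" where
  "del_Pezzo_surface n I d \<longleftrightarrow>
     smooth_variety n I 2 \<and>
     (\<exists>m J e. e > 0 \<and> smooth_variety m J 2 \<and> isomorphic_varieties n I m J \<and>
        anticanonical_power_is_O1 m J e \<and> has_dim_degree m J 2 (e\<^sup>2 * d))"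

end

theory Submission
  imports "HOL-Algebra.Algebraic_Closure_Type" Defs
begin

text \<open>
  Write x, y, u, v, z for the variables X_0, ..., X_4, so that the two quadrics are
  x^2 + yz - u^2 and xz + y^2 - v^2. Everything rests on the generic point
  (x, y, sqrt(x^2 + yz), sqrt(xz + y^2), z) of the surface, with coordinates in an algebraic closure
  of the field k(x, y, z). Modulo the quadrics, every polynomial is congruent to some
  a + bu + cv + duv with a, b, c, d in k[x, y, z]. The polynomials x^2 + yz, xz + y^2 and their
  product each have odd degree in one of the variables, so they are not squares in k(x, y, z); therefore
  1, u, v, uv are independent at the generic point, and the ideal of the two quadrics is exactly the
  set of polynomials that vanish there (\<open>quadrics_ideal_kernel\<close>). This holds over the rational and over the
  complex numbers. It shows that the ideal is prime, also after extension of the ground field, that the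
  homogenizations of all elements of the affine ideal lie in it (\<open>projective_closure_quadrics\<close>), and that
  the monomials divisible by neither u^2 nor v^2 are a basis of the coordinate ring, so that the Hilbert
  polynomial is 2d^2 + 2d + 1 (\<open>quadrics_dim_degree\<close>). Smoothness is a computation with the Jacobian
  matrix (\<open>quadrics_smooth\<close>).

  Evaluation at the generic point also turns statements about the function field, whose elements
  are only given up to null functions, into identities in a field. For the del Pezzo property, the
  anticanonical sheaf itself is O(1), which is adjunction made explicit: on the affine surface, the residue
  form dx dy / (4uv) has neither zeros nor poles, and it has a simple pole along z = 0. To check this at a
  point, one takes a chart in which the differentiated equations express the differentials of all
  coordinates by two of them; the wedge product of these two generates the canonical sheaf
  (\<open>canonical_generator\<close>), and five charts suffice (\<open>anticanonical_at_all\<close>).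

  Birationality is elementary. If \<lambda> = u - x and \<mu> = v - 2 \<lambda> x with z = 1, then the first equation
  gives y = 2 \<lambda> x + \<lambda>^2, after which the second one is linear in x, namely
  x (4 \<lambda>^3 - 4 \<lambda> \<mu> + 1) = \<mu>^2 - \<lambda>^4 (\<open>inv_x_relation\<close>).
\<close>

alias lookup = Poly_Mapping.lookup
alias keys = Poly_Mapping.keys
alias single = Poly_Mapping.single

section \<open>Polynomials as finitely supported functions\<close>

lemma sum_single_keys:
  "(\<Sum>m\<in>keys p. single m (lookup p m)) = p"
  by (rule poly_mapping_eqI)
     (auto simp: lookup_sum lookup_single when_def in_keys_iff sum.delta)

lemma poly_mapping_additive_induct:
  assumes zero: "P 0"
    and single: "\<And>m. m \<in> keys p \<Longrightarrow>
                   P (single m (lookup p m))"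
    and add: "\<And>p q. P p \<Longrightarrow> P q \<Longrightarrow> P (p + q)"
  shows "P (p :: 'm \<Rightarrow>\<^sub>0 'k::comm_monoid_add)"
proof -
  have "P (\<Sum>m\<in>S. single m (lookup p m))"
    if "finite S" "S \<subseteq> keys p" for S
    using that by (induction S rule: finite_induct) (auto intro: zero single add)
  from this[OF finite_keys subset_refl] show ?thesis by (simp add: sum_single_keys)
qed

lemma sum_keys_superset:
  assumes "finite S" "keys p \<subseteq> S" "\<And>m. f m 0 = 0"
  shows "(\<Sum>m\<in>keys p. f m (lookup p m))
           = (\<Sum>m\<in>S. f m (lookup p m))"
  using assms by (intro sum.mono_neutral_left) (auto simp: in_keys_iff)

lemma sum_keys_add:
  fixes f :: "'m \<Rightarrow> 'k::comm_monoid_add \<Rightarrow> 'a::comm_monoid_add"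
  assumes "\<And>m. f m 0 = 0" "\<And>m a b. f m (a + b) = f m a + f m b"
  shows "(\<Sum>m\<in>keys (p + q). f m (lookup (p + q) m))
           = (\<Sum>m\<in>keys p. f m (lookup p m))
             + (\<Sum>m\<in>keys q. f m (lookup q m))"
proof -
  let ?S = "keys p \<union> keys q"
  have S: "finite ?S" by simp
  have "(\<Sum>m\<in>keys (p + q). f m (lookup (p + q) m))
          = (\<Sum>m\<in>?S. f m (lookup (p + q) m))"
    by (rule sum_keys_superset[where f = f]) (use S keys_add[of p q] assms(1) in auto)
  also have "\<dots> = (\<Sum>m\<in>?S. f m (lookup p m)) + (\<Sum>m\<in>?S. f m (lookup q m))"
    by (simp add: lookup_add assms(2) sum.distrib)
  also have "\<dots> = (\<Sum>m\<in>keys p. f m (lookup p m))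
             + (\<Sum>m\<in>keys q. f m (lookup q m))"
    by (simp add: sum_keys_superset[where f = f, OF S _ assms(1), of p]
        sum_keys_superset[where f = f, OF S _ assms(1), of q])
  finally show ?thesis .
qed

text \<open>An additive property of polynomials only has to be checked on monomials.\<close>

lemma additive_induct:
  assumes "P 0"
    and "\<And>p q. P p \<Longrightarrow> P q \<Longrightarrow> P (p + q)"
    and "\<And>m c. P (single m c)"
  shows "P (p :: 'm \<Rightarrow>\<^sub>0 'k::comm_monoid_add)"
  by (rule poly_mapping_additive_induct[where P = P]) (auto intro: assms)

subsection \<open>Degrees\<close>

lemma keys_add_mon:
  "keys (m + n :: mon) = keys m \<union> keys n"
  by (auto simp: in_keys_iff lookup_add)

lemma mon_degree_superset:
  "finite S \<Longrightarrow> keys m \<subseteq> S \<Longrightarrow> mon_degree m = (\<Sum>i\<in>S. lookup m i)"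
  unfolding mon_degree_def by (rule sum_keys_superset) auto

lemma mon_degree_add [simp]: "mon_degree (m + n) = mon_degree m + mon_degree n"
  unfolding mon_degree_def by (rule sum_keys_add[where f = "\<lambda>_ a. a"]) auto

lemma mon_degree_0 [simp]: "mon_degree 0 = 0"
  by (simp add: mon_degree_def)

lemma mon_degree_single [simp]: "mon_degree (single i k) = k"
  by (simp add: mon_degree_def)

lemma polys_0 [simp]: "0 \<in> polys n" by (simp add: polys_def)

lemma forms_0 [simp]: "0 \<in> forms n d" by (simp add: forms_def)

lemma forms_polys: "p \<in> forms n d \<Longrightarrow> p \<in> polys n" by (simp add: forms_def)

lemma polys_single: "keys m \<subseteq> {..n} \<Longrightarrow> single m c \<in> polys n"
  by (simp add: polys_def)

lemma polys_Const [simp]: "Const c \<in> polys n" by (simp add: polys_def Const_def)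

lemma forms_Const [simp]: "Const c \<in> forms n 0" by (simp add: forms_def polys_def Const_def)

lemma Const_1: "Const 1 = (1 :: 'k::comm_ring_1 mpoly)" by (simp add: Const_def)

lemma Const_0 [simp]: "Const 0 = (0 :: 'k::comm_ring_1 mpoly)" by (simp add: Const_def)

lemma Const_add: "Const (a + b) = Const a + Const b"
  by (simp add: Const_def single_add)

lemma Const_mult: "Const (a * b) = Const a * Const b"
  by (simp add: Const_def mult_single)

lemma Const_numeral: "Const (numeral k) = numeral k"
  by (simp add: Const_def)

lemma polys_1 [simp]: "1 \<in> polys n" using polys_Const[of 1] by (simp add: Const_1)

lemma forms_1 [simp]: "1 \<in> forms n 0" using forms_Const[of 1] by (simp add: Const_1)

lemma forms_numeral [simp]: "numeral k \<in> forms n 0"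
  using forms_Const[of "numeral k"] by (simp add: Const_numeral)

lemma polys_Var [simp]: "i \<le> n \<Longrightarrow> Var i \<in> polys n"
  by (simp add: polys_def Var_def)

lemma forms_Var: "i \<le> n \<Longrightarrow> Var i \<in> forms n 1"
  by (simp add: forms_def polys_def Var_def)

lemma polys_add: "p \<in> polys n \<Longrightarrow> q \<in> polys n \<Longrightarrow> p + q \<in> polys n"
  using keys_add[of p q] by (auto simp: polys_def)

lemma forms_add: "p \<in> forms n d \<Longrightarrow> q \<in> forms n d \<Longrightarrow> p + q \<in> forms n d"
  using keys_add[of p q] polys_add[of p n q] by (auto simp: forms_def)

lemma keys_uminus: "keys (- p :: 'm \<Rightarrow>\<^sub>0 'k::ab_group_add) = keys p"
  by (auto simp: in_keys_iff)

lemma polys_uminus: "p \<in> polys n \<Longrightarrow> - p \<in> polys n"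
  by (simp add: polys_def keys_uminus)

lemma forms_uminus: "p \<in> forms n d \<Longrightarrow> - p \<in> forms n d"
  by (simp add: forms_def polys_uminus keys_uminus)

lemma polys_diff: "p \<in> polys n \<Longrightarrow> q \<in> polys n \<Longrightarrow> p - q \<in> polys n"
  using polys_add[OF _ polys_uminus] by fastforce

lemma forms_diff: "p \<in> forms n d \<Longrightarrow> q \<in> forms n d \<Longrightarrow> p - q \<in> forms n d"
  using forms_add[OF _ forms_uminus] by fastforce

lemma polys_mult: "p \<in> polys n \<Longrightarrow> q \<in> polys n \<Longrightarrow> p * q \<in> polys n"
  using keys_mult[of p q] by (fastforce simp: polys_def keys_add_mon)

lemma forms_mult: "p \<in> forms n d \<Longrightarrow> q \<in> forms n e \<Longrightarrow> p * q \<in> forms n (d + e)"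
  using keys_mult[of p q] polys_mult[of p n q] by (fastforce simp: forms_def)

lemma forms_mult': "p \<in> forms n d \<Longrightarrow> q \<in> forms n e \<Longrightarrow> f = d + e \<Longrightarrow> p * q \<in> forms n f"
  by (simp add: forms_mult)

lemma polys_power: "p \<in> polys n \<Longrightarrow> p ^ k \<in> polys n"
  by (induction k) (auto intro: polys_mult)

lemma forms_power: "p \<in> forms n d \<Longrightarrow> p ^ k \<in> forms n (k * d)"
  by (induction k) (auto intro: forms_mult)

lemma polys_sum: "(\<And>i. i \<in> S \<Longrightarrow> f i \<in> polys n) \<Longrightarrow> sum f S \<in> polys n"
  by (induction S rule: infinite_finite_induct) (auto intro: polys_add)

lemma forms_sum: "(\<And>i. i \<in> S \<Longrightarrow> f i \<in> forms n d) \<Longrightarrow> sum f S \<in> forms n d"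
  by (induction S rule: infinite_finite_induct) (auto intro: forms_add)

lemmas polys_intros = polys_add polys_uminus polys_diff polys_mult polys_power

subsection \<open>Evaluation\<close>

text \<open>The value of a monomial at the point \<open>x\<close>.\<close>

definition mon_val :: "(nat \<Rightarrow> 'a::comm_ring_1) \<Rightarrow> mon \<Rightarrow> 'a" where
  "mon_val x m = (\<Prod>i\<in>keys m. x i ^ lookup m i)"

lemma mon_val_superset:
  assumes "finite S" "keys m \<subseteq> S"
  shows "mon_val x m = (\<Prod>i\<in>S. x i ^ lookup m i)"
  unfolding mon_val_def using assms by (intro prod.mono_neutral_left) (auto simp: in_keys_iff)

lemma mon_val_add: "mon_val x (m + n) = mon_val x m * mon_val x n"
proof -
  let ?S = "keys m \<union> keys n"
  have S: "finite ?S" by simp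
  have "mon_val x (m + n) = (\<Prod>i\<in>?S. x i ^ lookup (m + n) i)"
    by (rule mon_val_superset) (auto simp: keys_add_mon)
  also have "\<dots> = mon_val x m * mon_val x n"
    by (simp add: mon_val_superset[OF S, of m] mon_val_superset[OF S, of n] lookup_add power_add
        prod.distrib)
  finally show ?thesis .
qed

lemma mon_val_0 [simp]: "mon_val x 0 = 1" by (simp add: mon_val_def)

lemma mon_val_single: "mon_val x (single i k) = x i ^ k"
  by (cases "k = 0") (auto simp: mon_val_def)

lemma mon_val_scale: "mon_val (\<lambda>i. t * x i) m = t ^ mon_degree m * mon_val x m"
  by (simp add: mon_val_def mon_degree_def power_mult_distrib prod.distrib power_sum)

lemma mon_val_cong: "(\<And>i. i \<in> keys m \<Longrightarrow> x i = y i) \<Longrightarrow> mon_val x m = mon_val y m"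
  by (simp add: mon_val_def)

lemma eval_poly_mon_val:
  "eval_poly c x p = (\<Sum>m\<in>keys p. c (lookup p m) * mon_val x m)"
  by (simp add: eval_poly_def mon_val_def)

lemma eval_poly_cong_keys:
  assumes "\<And>m i. m \<in> keys p \<Longrightarrow> i \<in> keys m \<Longrightarrow> x i = y i"
  shows "eval_poly c x p = eval_poly c y p"
  unfolding eval_poly_mon_val
  by (intro sum.cong refl arg_cong2[where f = "(*)"] mon_val_cong) (use assms in auto)

lemma eval_poly_0 [simp]: "eval_poly c x 0 = 0"
  by (simp add: eval_poly_def)

text \<open>A homomorphism of coefficient rings, along which polynomials are evaluated.\<close>

locale scalar_hom =
  fixes c :: "'k::comm_ring_1 \<Rightarrow> 'a::comm_ring_1"
  assumes hom_add: "c (a + b) = c a + c b"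
    and hom_mult: "c (a * b) = c a * c b"
    and hom_one: "c 1 = 1"
begin

lemma hom_zero: "c 0 = 0"
  using hom_add[of 0 0] by simp

lemma hom_minus: "c (- a) = - c a"
  using hom_add[of a "- a"] by (simp add: hom_zero add_eq_0_iff)

lemma eval_single: "eval_poly c x (single m a) = c a * mon_val x m"
  by (cases "a = 0") (auto simp: eval_poly_mon_val hom_zero)

lemma eval_add: "eval_poly c x (p + q) = eval_poly c x p + eval_poly c x q"
  unfolding eval_poly_mon_val
  by (rule sum_keys_add[where f = "\<lambda>m a. c a * mon_val x m"])
     (auto simp: hom_zero hom_add algebra_simps)

lemma eval_minus: "eval_poly c x (- p) = - eval_poly c x p"
  using eval_add[of x p "- p"] by (simp add: add_eq_0_iff)

lemma eval_diff: "eval_poly c x (p - q) = eval_poly c x p - eval_poly c x q"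
  using eval_add[of x p "- q"] by (simp add: eval_minus)

lemma eval_mult: "eval_poly c x (p * q) = eval_poly c x p * eval_poly c x q"
proof (induction p rule: additive_induct)
  case (3 m a)
  show ?case
    by (induction q rule: additive_induct)
       (auto simp: distrib_left eval_add eval_single mult_single mon_val_add hom_mult algebra_simps)
qed (auto simp: distrib_right eval_add)

lemma eval_Const: "eval_poly c x (Const a) = c a"
  by (simp add: Const_def eval_single)

lemma eval_1: "eval_poly c x 1 = 1"
  using eval_Const[of x 1] by (simp add: Const_1 hom_one)

lemma eval_Var: "eval_poly c x (Var i) = x i"
  by (simp add: Var_def eval_single hom_one mon_val_single)

lemma eval_power: "eval_poly c x (p ^ k) = eval_poly c x p ^ k"
  by (induction k) (auto simp: eval_1 eval_mult)

lemma eval_of_nat: "eval_poly c x (of_nat k) = of_nat k"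
  by (induction k) (auto simp: eval_1 eval_add)

lemma eval_numeral: "eval_poly c x (numeral k) = numeral k"
  using eval_of_nat[of x "numeral k"] by simp

lemma eval_sum: "eval_poly c x (sum f S) = (\<Sum>i\<in>S. eval_poly c x (f i))"
  by (induction S rule: infinite_finite_induct) (auto simp: eval_add)

lemmas eval_simps = eval_add eval_minus eval_diff eval_mult eval_1 eval_Var eval_power
  eval_numeral eval_poly_0

lemma eval_form_scale:
  assumes "p \<in> forms n d"
  shows "eval_poly c (\<lambda>i. t * x i) p = t ^ d * eval_poly c x p"
  unfolding eval_poly_mon_val sum_distrib_left
  by (intro sum.cong refl) (use assms in \<open>auto simp: mon_val_scale forms_def\<close>)

end

lemma scalar_hom_of_rat: "scalar_hom (of_rat :: rat \<Rightarrow> 'a::field_char_0)"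
  by unfold_locales (auto simp: of_rat_add of_rat_mult)

lemma scalar_hom_Const: "scalar_hom (Const :: 'k \<Rightarrow> 'k::comm_ring_1 mpoly)"
  by unfold_locales (auto simp: Const_add Const_mult Const_1)

lemma to_fract_simps:
  "to_fract (p + q) = to_fract p + to_fract q"
  "to_fract (p - q) = to_fract p - to_fract q"
  "to_fract (p * q) = to_fract p * to_fract q"
  "to_fract (- p) = - to_fract p"
  "to_fract 1 = 1" "to_fract 0 = 0"
  by (auto simp: to_fract_def One_fract_def Zero_fract_def)

lemma to_fract_eq_iff: "to_fract p = to_fract q \<longleftrightarrow> p = q"
  by (simp add: to_fract_def eq_fract)

lemma scalar_hom_fract: "scalar_hom (\<lambda>a. to_fract (Const a))"
  by unfold_locales (auto simp: Const_add Const_mult Const_1 to_fract_simps)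

lemma scalar_hom_eval_poly:
  assumes "scalar_hom h"
  shows "h (eval_poly c x p) = eval_poly (\<lambda>a. h (c a)) (\<lambda>i. h (x i)) p"
proof -
  interpret h: scalar_hom h by fact
  have sum: "h (sum f S) = (\<Sum>i\<in>S. h (f i))" for f :: "mon \<Rightarrow> _" and S
    by (induction S rule: infinite_finite_induct) (auto simp: h.hom_zero h.hom_add)
  have pow: "h (a ^ k) = h a ^ k" for a k
    by (induction k) (auto simp: h.hom_one h.hom_mult)
  have prod: "h (prod f S) = (\<Prod>i\<in>S. h (f i))" for f :: "nat \<Rightarrow> _" and S
    by (induction S rule: infinite_finite_induct) (auto simp: h.hom_one h.hom_mult)
  show ?thesis by (simp add: eval_poly_def sum prod pow h.hom_mult)
qed

lemma scalar_hom_comp: "scalar_hom f \<Longrightarrow> scalar_hom g \<Longrightarrow> scalar_hom (\<lambda>a. f (g a))"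
  by (simp add: scalar_hom_def)

lemma eval_Const_Var: "eval_poly Const Var p = p"
proof -
  have "mon_val Var m = single m (1 :: 'a)" for m
  proof (induction m rule: additive_induct)
    case (3 i k)
    show ?case by (induction k) (auto simp: mon_val_single Var_def mult_single simp flip: single_add)
  qed (auto simp: mon_val_add mult_single)
  then have "eval_poly Const Var p
      = (\<Sum>m\<in>keys p. single m (lookup p m))"
    by (simp add: eval_poly_mon_val Const_def mult_single)
  then show ?thesis by (simp add: sum_single_keys)
qed

subsection \<open>Partial derivatives\<close>

lemma partial_deriv_0 [simp]: "partial_deriv i 0 = 0"
  by (simp add: partial_deriv_def)

lemma partial_deriv_single:
  "partial_deriv i (single m c)
     = single (m - single i 1) (of_nat (lookup m i) * c)"
  by (cases "c = 0") (auto simp: partial_deriv_def)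

lemma partial_deriv_add: "partial_deriv i (p + q) = partial_deriv i p + partial_deriv i q"
  unfolding partial_deriv_def
  by (rule sum_keys_add[where f = "\<lambda>m a. single (m - single i 1)
        (of_nat (lookup m i) * a)"])
     (auto simp: algebra_simps single_add)

lemma mon_diff_add:
  fixes m :: mon
  assumes "lookup m i > 0"
  shows "m - single i 1 + n = m + n - single i 1"
  by (rule poly_mapping_eqI) (use assms in \<open>auto simp: lookup_add lookup_minus lookup_single when_def\<close>)

lemma partial_deriv_mult:
  "partial_deriv i (p * q) = partial_deriv i p * q + p * partial_deriv i q"
proof (induction p rule: additive_induct)
  case (3 m a)
  show ?case
  proof (induction q rule: additive_induct)
    case (3 n b)
    show ?case
    proof -
      have l: "partial_deriv i (single m a) * single n b
          = single (m + n - single i 1)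
              (of_nat (lookup m i) * a * b)"
        using mon_diff_add[of m i n]
        by (cases "lookup m i = 0") (auto simp: partial_deriv_single mult_single)
      have r: "single m a * partial_deriv i (single n b)
          = single (m + n - single i 1)
              (of_nat (lookup n i) * a * b)"
        using mon_diff_add[of n i m]
        by (cases "lookup n i = 0")
           (auto simp: partial_deriv_single mult_single algebra_simps)
      show ?thesis
        unfolding l r
        by (simp add: mult_single partial_deriv_single lookup_add algebra_simps flip: single_add)
    qed
  qed (auto simp: partial_deriv_add algebra_simps)
qed (auto simp: partial_deriv_add algebra_simps)

lemma partial_deriv_Const [simp]: "partial_deriv i (Const c) = 0"
  by (simp add: Const_def partial_deriv_single)

lemma partial_deriv_Var: "partial_deriv i (Var j) = (if i = j then 1 else 0)"
  by (auto simp: Var_def partial_deriv_single lookup_single)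

lemma partial_deriv_minus: "partial_deriv i (- p) = - partial_deriv i p"
  using partial_deriv_add[of i p "- p"] by (simp add: add_eq_0_iff)

lemma partial_deriv_diff: "partial_deriv i (p - q) = partial_deriv i p - partial_deriv i q"
  using partial_deriv_add[of i p "- q"] by (simp add: partial_deriv_minus)

text \<open>
  Multiplying by a variable makes up for the degree lost by differentiation, also in degree 0,
  where the derivative vanishes.
\<close>

lemma partial_deriv_forms:
  assumes "p \<in> forms n d" "k \<le> n" shows "partial_deriv i p * Var k \<in> forms n d"
  unfolding partial_deriv_def sum_distrib_right
proof (rule forms_sum)
  fix m assume m: "m \<in> keys p"
  define c where "c = of_nat (lookup m i) * lookup p m"
  have deg: "mon_degree m = d" "keys m \<subseteq> {..n}"
    using m assms by (auto simp: forms_def polys_def)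
  have "single (m - single i 1) c * Var k \<in> forms n d"
  proof (cases "lookup m i = 0")
    case False
    then have eq: "m = (m - single i 1) + single i 1"
      by (intro poly_mapping_eqI) (auto simp: lookup_add lookup_minus lookup_single when_def)
    have "mon_degree m = mon_degree (m - single i 1) + 1"
      by (subst eq) simp
    moreover have "keys (m - single i 1) \<subseteq> keys m"
      by (auto simp: in_keys_iff lookup_minus)
    ultimately show ?thesis
      using deg assms(2) by (auto simp: Var_def mult_single forms_def polys_def keys_add_mon)
  qed (simp add: c_def)
  then show "single (m - single i 1)
      (of_nat (lookup m i) * lookup p m) * Var k \<in> forms n d"
    by (simp add: c_def)
qed

section \<open>Ideals of the polynomial ring\<close>

lemma poly_ring_simps [simp]:
  "carrier (poly_ring n) = polys n" "monoid.mult (poly_ring n) = (*)" "monoid.one (poly_ring n) = 1"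
  "ring.zero (poly_ring n) = 0" "ring.add (poly_ring n) = (+)"
  by (auto simp: poly_ring_def)

lemma poly_ring_cring: "cring (poly_ring n :: 'k::comm_ring_1 mpoly ring)"
proof (rule cringI)
  show "abelian_group (poly_ring n :: 'k mpoly ring)"
    by (rule abelian_groupI)
       (auto intro: polys_add simp: algebra_simps intro!: bexI[OF _ polys_uminus])
  show "comm_monoid (poly_ring n :: 'k mpoly ring)"
    by (rule comm_monoidI) (auto intro: polys_mult simp: algebra_simps)
qed (auto simp: algebra_simps)

lemma poly_ring_ring: "ring (poly_ring n :: 'k::comm_ring_1 mpoly ring)"
  using poly_ring_cring by (rule cring.axioms(1))

lemma ideal_poly_ringI:
  assumes "I \<subseteq> polys n" "0 \<in> I" "\<And>p q. p \<in> I \<Longrightarrow> q \<in> I \<Longrightarrow> p + q \<in> I"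
    and "\<And>p q. p \<in> I \<Longrightarrow> q \<in> polys n \<Longrightarrow> q * p \<in> I"
  shows "ideal I (poly_ring n)"
proof (rule idealI[OF poly_ring_ring])
  have neg: "- p \<in> I" if "p \<in> I" for p
    using assms(4)[OF that, of "- 1"] by (simp add: polys_uminus)
  have inv: "inv\<^bsub>add_monoid (poly_ring n)\<^esub> p = - p" if "p \<in> polys n" for p :: "'a mpoly"
    unfolding a_inv_def[symmetric]
    by (rule abelian_group.minus_equality[OF ring.is_abelian_group[OF poly_ring_ring]])
       (use that in \<open>auto intro: polys_uminus\<close>)
  show "subgroup I (add_monoid (poly_ring n))"
    by (rule subgroup.intro) (use assms(1-3) neg inv in auto)
qed (use assms in \<open>auto simp: mult.commute\<close>)

lemma ideal_poly_ringD:
  assumes "ideal I (poly_ring n)"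
  shows "I \<subseteq> polys n" "0 \<in> I" "p \<in> I \<Longrightarrow> q \<in> I \<Longrightarrow> p + q \<in> I"
    "p \<in> I \<Longrightarrow> q \<in> polys n \<Longrightarrow> q * p \<in> I"
proof -
  interpret ideal I "poly_ring n" by fact
  show "I \<subseteq> polys n" using a_subset by simp
  show "0 \<in> I" using additive_subgroup.zero_closed[OF is_additive_subgroup] by simp
  show "p \<in> I \<Longrightarrow> q \<in> I \<Longrightarrow> p + q \<in> I" using additive_subgroup.a_closed[OF is_additive_subgroup] by simp
  show "p \<in> I \<Longrightarrow> q \<in> polys n \<Longrightarrow> q * p \<in> I" using I_l_closed[of p q] by simp
qed

lemma genideal_pair:
  fixes p q :: "'k::comm_ring_1 mpoly"
  assumes "p \<in> polys n" "q \<in> polys n"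
  shows "genideal (poly_ring n) {p, q} = {a * p + b * q | a b. a \<in> polys n \<and> b \<in> polys n}"
    (is "_ = ?K")
proof
  have K: "ideal ?K (poly_ring n)"
  proof (rule ideal_poly_ringI)
    show "?K \<subseteq> polys n" using assms by (auto intro: polys_intros)
    show "0 \<in> ?K" by (rule CollectI, rule exI[of _ 0], rule exI[of _ 0]) simp
    fix r s :: "'k mpoly" assume "r \<in> ?K"
    then obtain a b where r: "r = a * p + b * q" "a \<in> polys n" "b \<in> polys n" by blast
    { assume "s \<in> ?K"
      then obtain c d where s: "s = c * p + d * q" "c \<in> polys n" "d \<in> polys n" by blast
      have "r + s = (a + c) * p + (b + d) * q" using r s by (simp add: algebra_simps)
      then show "r + s \<in> ?K" using r s by (blast intro: polys_add) }
    { assume s: "s \<in> polys n"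
      have "s * r = (s * a) * p + (s * b) * q" using r by (simp add: algebra_simps)
      then show "s * r \<in> ?K" using r s by (blast intro: polys_mult) }
  qed
  have "p \<in> ?K" by (rule CollectI, rule exI[of _ 1], rule exI[of _ 0]) simp
  moreover have "q \<in> ?K" by (rule CollectI, rule exI[of _ 0], rule exI[of _ 1]) simp
  ultimately show "genideal (poly_ring n) {p, q} \<subseteq> ?K"
    by (intro ring.genideal_minimal[OF poly_ring_ring K]) auto
  have I: "ideal (genideal (poly_ring n) {p, q}) (poly_ring n)"
    by (rule ring.genideal_ideal[OF poly_ring_ring]) (use assms in auto)
  have "{p, q} \<subseteq> genideal (poly_ring n) {p, q}"
    by (rule ring.genideal_self[OF poly_ring_ring]) (use assms in auto)
  then show "?K \<subseteq> genideal (poly_ring n) {p, q}"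
    using ideal_poly_ringD[OF I] by auto
qed

section \<open>The generic point of the surface\<close>

text \<open>The two quadrics and their ideal, over an arbitrary ring of coefficients.\<close>

definition quadric1 :: "'k::comm_ring_1 mpoly" where
  "quadric1 = Var 0 ^ 2 + Var 1 * Var 4 - Var 2 ^ 2"

definition quadric2 :: "'k::comm_ring_1 mpoly" where
  "quadric2 = Var 0 * Var 4 + Var 1 ^ 2 - Var 3 ^ 2"

definition quadI :: "'k::comm_ring_1 mpoly set" where
  "quadI = genideal (poly_ring 4) {quadric1, quadric2}"

text \<open>The polynomials whose square roots are the coordinates u and v of the generic point.\<close>

definition square1 :: "'k::comm_ring_1 mpoly" where
  "square1 = Var 0 ^ 2 + Var 1 * Var 4"

definition square2 :: "'k::comm_ring_1 mpoly" where
  "square2 = Var 0 * Var 4 + Var 1 ^ 2"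

lemma forms_Var2: "i \<le> n \<Longrightarrow> j \<le> n \<Longrightarrow> Var i * Var j \<in> forms n 2"
  by (rule forms_mult'[OF forms_Var forms_Var]) auto

lemma quadric_forms: "quadric1 \<in> forms 4 2" "quadric2 \<in> forms 4 2"
  unfolding quadric1_def quadric2_def power2_eq_square
  by (intro forms_add forms_diff forms_Var2; simp)+

lemma quadric_polys: "quadric1 \<in> polys 4" "quadric2 \<in> polys 4"
  using quadric_forms forms_polys by blast+

lemma quadrics_ideal_eq:
  "quadI = {a * quadric1 + b * quadric2 | a b. a \<in> polys 4 \<and> b \<in> polys 4}"
  unfolding quadI_def by (rule genideal_pair[OF quadric_polys])

lemma quadrics_ideal_ideal: "ideal quadI (poly_ring 4)"
  unfolding quadI_def
  by (rule ring.genideal_ideal[OF poly_ring_ring]) (use quadric_polys in auto)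

lemmas quadrics_idealD = ideal_poly_ringD[OF quadrics_ideal_ideal]

subsection \<open>Non-squares\<close>

text \<open>A polynomial as a univariate polynomial in X_i with coefficients in the other variables.\<close>

definition as_poly :: "nat \<Rightarrow> 'k::idom mpoly \<Rightarrow> 'k mpoly poly" where
  "as_poly i = eval_poly (\<lambda>a. [:Const a:]) (\<lambda>j. if j = i then [:0, 1:] else [:Var j:])"

lemma scalar_hom_pConst: "scalar_hom (\<lambda>a. [:Const a:])"
  by unfold_locales (auto simp: Const_add Const_mult Const_1 one_pCons)

lemma poly_as_poly: "poly (as_poly i p) (Var i) = p"
proof -
  have "scalar_hom (\<lambda>q. poly q (Var i))" by unfold_locales auto
  from scalar_hom_eval_poly[OF this, of "\<lambda>a. [:Const a:]" "\<lambda>j. if j = i then [:0, 1:] else [:Var j:]" p]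
  have "poly (as_poly i p) (Var i) =
      eval_poly Const (\<lambda>j. poly (if j = i then [:0, 1:] else [:Var j:]) (Var i)) p"
    by (simp add: as_poly_def)
  also have "(\<lambda>j. poly (if j = i then [:0, 1:] else [:Var j:]) (Var i)) = Var" by auto
  finally show ?thesis by (simp add: eval_Const_Var)
qed

lemma as_poly_simps:
  "as_poly i (p + q) = as_poly i p + as_poly i q"
  "as_poly i (p * q) = as_poly i p * as_poly i q"
  "as_poly i (p ^ k) = as_poly i p ^ k"
  "as_poly i (Var j) = (if j = i then [:0, 1:] else [:Var j:])"
  by (simp_all add: as_poly_def scalar_hom.eval_simps[OF scalar_hom_pConst])

lemma as_poly_eq_0_iff [simp]: "as_poly i p = 0 \<longleftrightarrow> p = 0"
proof
  assume "as_poly i p = 0"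
  then show "p = 0" using poly_as_poly[of i p] by simp
qed (simp add: as_poly_def)

text \<open>A polynomial of odd degree in one of the variables is not a square of a fraction.\<close>

lemma odd_degree_nonsquare:
  assumes "odd (Polynomial.degree (as_poly i p))" "a ^ 2 = p * b ^ 2"
  shows "b = 0"
proof (rule ccontr)
  assume b: "b \<noteq> 0"
  have p: "p \<noteq> 0" using assms(1) by (auto simp: as_poly_def)
  then have a: "a \<noteq> 0" using b assms(2) by auto
  have "as_poly i a ^ 2 = as_poly i p * as_poly i b ^ 2"
    using assms(2) by (metis as_poly_simps(2,3))
  then have "Polynomial.degree (as_poly i a ^ 2) = Polynomial.degree (as_poly i p * as_poly i b ^ 2)"
    by simp
  then have "2 * Polynomial.degree (as_poly i a)
      = Polynomial.degree (as_poly i p) + 2 * Polynomial.degree (as_poly i b)"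
    using a b p by (simp add: power2_eq_square degree_mult_eq)
  then show False using assms(1) by presburger
qed

lemma Var_nonzero [simp]: "Var i \<noteq> (0 :: 'k::comm_ring_1 mpoly)"
proof
  assume "Var i = (0 :: 'k mpoly)"
  then have "lookup (Var i :: 'k mpoly) (single i 1) = 0" by simp
  then show False by (simp add: Var_def)
qed

lemma odd_degrees:
  "odd (Polynomial.degree (as_poly 1 (square1 :: 'k::idom mpoly)))"
  "odd (Polynomial.degree (as_poly 4 (square2 :: 'k::idom mpoly)))"
  "odd (Polynomial.degree (as_poly 1 (square1 * square2 :: 'k::idom mpoly)))"
  by (simp_all add: square1_def square2_def as_poly_simps power2_eq_square degree_mult_eq)

subsection \<open>A field containing the function field\<close>

text \<open>
  An algebraic closure of the field of fractions of all polynomials; it contains the square roots that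
  are needed for the generic point.
\<close>

type_synonym 'k big_field = "'k mpoly fract alg_closure"

text \<open>The inclusion of the polynomials into the big field.\<close>

definition embed :: "'k::field_char_0 mpoly \<Rightarrow> 'k big_field" where
  "embed p = to_ac (Fraction_Field.Fract p 1)"

lemma scalar_hom_embed: "scalar_hom embed"
  by unfold_locales
     (auto simp: embed_def One_fract_def[symmetric] simp flip: to_ac_add to_ac_mult)

lemma embed_eq_0_iff [simp]: "embed p = 0 \<longleftrightarrow> p = 0"
  by (simp add: embed_def Zero_fract_def eq_fract)

text \<open>
  The generic point: u and v are chosen square roots of \<open>square1\<close> and \<open>square2\<close>; all other
  variables are independent. The value of a polynomial at this point is \<open>gval\<close>.
\<close>

definition gpt :: "nat \<Rightarrow> 'k::field_char_0 big_field" where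
  "gpt i =
     (if i = 2 then (SOME w. w ^ 2 = embed square1)
      else if i = 3 then (SOME w. w ^ 2 = embed square2)
      else embed (Var i))"

definition gval :: "'k::field_char_0 mpoly \<Rightarrow> 'k big_field" where
  "gval = eval_poly (\<lambda>a. embed (Const a)) gpt"

lemma scalar_hom_embed_Const: "scalar_hom (\<lambda>a. embed (Const a))"
  by (rule scalar_hom_comp[OF scalar_hom_embed scalar_hom_Const])

interpretation gen: scalar_hom "\<lambda>a. embed (Const a)" by (rule scalar_hom_embed_Const)

interpretation emb: scalar_hom embed by (rule scalar_hom_embed)

lemma generic_value_simps:
  "gval (p + q) = gval p + gval q"
  "gval (p - q) = gval p - gval q"
  "gval (- p) = - gval p"
  "gval (p * q) = gval p * gval q"
  "gval (p ^ k) = gval p ^ k"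
  "gval (numeral l) = numeral l"
  "gval 0 = 0"
  "gval 1 = 1"
  "gval (Var i) = gpt i"
  "gval (Const a) = embed (Const a)"
  by (simp_all add: gval_def gen.eval_simps gen.eval_Const)

lemma generic_point_square:
  "gpt 2 ^ 2 = embed square1" "gpt 3 ^ 2 = embed square2"
proof -
  have "\<exists>w. w ^ 2 = embed square1" "\<exists>w. w ^ 2 = embed square2"
    by (rule nth_root_exists; simp)+
  from this[THEN someI_ex] show "gpt 2 ^ 2 = embed square1"
    "gpt 3 ^ 2 = embed square2"
    by (simp_all add: gpt_def)
qed

lemma embed_simps:
  "embed (p + q) = embed p + embed q" "embed (p * q) = embed p * embed q"
  "embed (p ^ k) = embed p ^ k" "embed 1 = 1" "embed 0 = 0"
proof -
  show "embed (p ^ k) = embed p ^ k"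
    by (induction k) (auto simp: emb.hom_mult emb.hom_one)
qed (auto simp: emb.hom_add emb.hom_mult emb.hom_one)

lemma generic_point_relations:
  "gpt 2 ^ 2 = gpt 0 ^ 2 + gpt 1 * gpt 4"
  "gpt 3 ^ 2 = gpt 0 * gpt 4 + gpt 1 ^ 2"
  using generic_point_square
  by (simp_all add: square1_def square2_def embed_simps gpt_def)

lemma generic_value_quadrics: "gval quadric1 = 0" "gval quadric2 = 0"
  by (simp_all add: quadric1_def quadric2_def generic_value_simps generic_point_relations)

lemma generic_value_ideal: "p \<in> quadI \<Longrightarrow> gval p = 0"
  by (auto simp: quadrics_ideal_eq generic_value_simps generic_value_quadrics)

lemma nonsquare_range:
  assumes "odd (Polynomial.degree (as_poly i p))" "w ^ 2 = embed p"
  shows "w \<notin> range to_ac"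
proof
  assume "w \<in> range to_ac"
  then obtain r where "w = to_ac r" by auto
  moreover obtain a b where r: "r = Fraction_Field.Fract a b" "b \<noteq> 0"
    by (cases r rule: Fract_cases_nonzero) (auto simp: Zero_fract_def)
  ultimately have "r ^ 2 = Fraction_Field.Fract p 1"
    using assms(2) by (simp add: embed_def flip: to_ac_power)
  then have "a ^ 2 = p * b ^ 2"
    using r by (simp add: power2_eq_square eq_fract)
  from odd_degree_nonsquare[OF assms(1) this] r(2) show False by simp
qed

text \<open>
  In a field, the elements 1, u, v, uv are independent over a subfield K that contains the squares
  of u and v, but none of u, v, uv.
\<close>

lemma biquadratic_independent:
  fixes K :: "'a::field set"
  assumes K: "0 \<in> K" "\<And>a b. a \<in> K \<Longrightarrow> b \<in> K \<Longrightarrow> a + b \<in> K"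
      "\<And>a b. a \<in> K \<Longrightarrow> b \<in> K \<Longrightarrow> a - b \<in> K" "\<And>a b. a \<in> K \<Longrightarrow> b \<in> K \<Longrightarrow> a * b \<in> K"
      "\<And>a b. a \<in> K \<Longrightarrow> b \<in> K \<Longrightarrow> a / b \<in> K"
    and two: "(2 :: 'a) \<noteq> 0"
    and uv: "u ^ 2 \<in> K" "v ^ 2 \<in> K" "u \<notin> K" "v \<notin> K" "u * v \<notin> K"
    and abcd: "a \<in> K" "b \<in> K" "c \<in> K" "d \<in> K"
    and eq: "a + b * u + c * v + d * (u * v) = 0"
  shows "a = 0 \<and> b = 0 \<and> c = 0 \<and> d = 0"
proof -
  have lin: "p = 0 \<and> q = 0" if "p \<in> K" "q \<in> K" "p + q * u = 0" for p q
  proof -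
    have "q = 0"
    proof (rule ccontr)
      assume "q \<noteq> 0"
      then have "u = (0 - p) / q" using that(3) by (simp add: field_simps eq_neg_iff_add_eq_0)
      then show False using uv(3) that K by metis
    qed
    then show ?thesis using that by simp
  qed
  have cd: "c + d * u = 0"
  proof (rule ccontr)
    assume nz: "c + d * u \<noteq> 0"
    have d': "- d \<in> K" using K(3)[OF K(1) abcd(4)] by simp
    have nz': "c - d * u \<noteq> 0"
    proof
      assume "c - d * u = 0"
      then have "c + (- d) * u = 0" by simp
      then have "c = 0 \<and> - d = 0" by (intro lin abcd d')
      then show False using nz by simp
    qed
    define N where "N = (c + d * u) * (c - d * u)"
    have N: "N \<noteq> 0" using nz nz' by (simp add: N_def)
    have "N = c * c - (d * d) * u ^ 2" by (simp add: N_def algebra_simps power2_eq_square)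
    then have NK: "N \<in> K" by (simp only:) (intro K abcd uv(1))
    define P where "P = (b * d * u ^ 2 - a * c) / N"
    define Q where "Q = (a * d - b * c) / N"
    \<comment> \<open>Otherwise v = P + Q u lies in the quadratic extension, and comparing squares gives P = 0 or Q = 0.\<close>
    have PQ: "P \<in> K" "Q \<in> K" unfolding P_def Q_def by (intro K abcd uv(1) NK)+
    have "(c + d * u) * v = - (a + b * u)" using eq by (simp add: algebra_simps eq_neg_iff_add_eq_0)
    then have "((c + d * u) * v) * (c - d * u) = - (a + b * u) * (c - d * u)" by simp
    then have "N * v = - (a + b * u) * (c - d * u)" by (simp add: N_def mult_ac)
    also have "\<dots> = (b * d * u ^ 2 - a * c) + (a * d - b * c) * u"
      by (simp add: algebra_simps power2_eq_square)
    also have "\<dots> = N * (P + Q * u)" using N by (simp add: P_def Q_def field_simps)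
    finally have v: "v = P + Q * u" using N by simp
    have "(P ^ 2 + Q ^ 2 * u ^ 2 - v ^ 2) + (2 * P * Q) * u = 0"
      unfolding v by (simp add: algebra_simps power2_eq_square)
    moreover have "P ^ 2 + Q ^ 2 * u ^ 2 - v ^ 2 \<in> K"
      unfolding power2_eq_square[of P] power2_eq_square[of Q] by (intro K PQ uv(1,2))
    moreover have "2 * P * Q \<in> K"
      unfolding mult_2 distrib_right by (intro K PQ)
    ultimately have "2 * P * Q = 0" using lin by blast
    then consider "P = 0" | "Q = 0" using two by auto
    then show False
    proof cases
      case 1
      then have "u * v = Q * u ^ 2" using v by (simp add: power2_eq_square)
      then show False using uv K PQ by simp
    next
      case 2
      then show False using v uv PQ by simp
    qed
  qed
  have "(a + b * u) + (c + d * u) * v = 0" using eq by (simp add: algebra_simps)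
  then have "a + b * u = 0" using cd by simp
  then show ?thesis using lin[OF abcd(1,2)] lin[OF abcd(3,4) cd] by simp
qed

lemma big_field_independent:
  fixes a b c d :: "'k::field_char_0 mpoly"
  assumes "embed a + embed b * gpt 2 + embed c * gpt 3
             + embed d * (gpt 2 * gpt 3) = 0"
  shows "a = 0 \<and> b = 0 \<and> c = 0 \<and> d = 0"
proof -
  let ?K = "range (to_ac :: 'k mpoly fract \<Rightarrow> _)"
  have "embed a = 0 \<and> embed b = 0 \<and> embed c = 0 \<and> embed d = 0"
  proof (rule biquadratic_independent[where K = ?K])
    show "a + b \<in> ?K" "a - b \<in> ?K" "a * b \<in> ?K" "a / b \<in> ?K" if "a \<in> ?K" "b \<in> ?K" for a b
      using that by (auto simp flip: to_ac_add to_ac_diff to_ac_mult to_ac_divide)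
    show "(2 :: 'k big_field) \<noteq> 0"
    proof -
      have "embed (2 :: 'k mpoly) = 2"
        using emb.hom_add[of 1 "1 :: 'k mpoly"] by (simp add: emb.hom_one)
      moreover have "embed (2 :: 'k mpoly) \<noteq> 0" by simp
      ultimately show ?thesis by simp
    qed
    show "gpt 2 \<notin> ?K" "gpt 3 \<notin> ?K"
      using nonsquare_range odd_degrees generic_point_square by blast+
    show "gpt 2 * gpt 3 \<notin> ?K"
      by (rule nonsquare_range[OF odd_degrees(3)])
         (simp add: power_mult_distrib generic_point_square embed_simps)
    show "0 \<in> ?K" using to_ac_0 by (metis rangeI)
    show "gpt 2 ^ 2 \<in> ?K" "gpt 3 ^ 2 \<in> ?K"
      by (simp_all only: generic_point_square) (simp_all add: embed_def)
    show "embed a + embed b * gpt 2 + embed c * gpt 3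
             + embed d * (gpt 2 * gpt 3) = 0" by (rule assms)
  qed (simp_all add: embed_def)
  then show ?thesis by simp
qed

subsection \<open>Normal forms\<close>

text \<open>Normal forms modulo the quadrics: no monomial is divisible by the square of u or of v.\<close>

definition normal_mon :: "mon \<Rightarrow> bool" where
  "normal_mon m \<longleftrightarrow> keys m \<subseteq> {..4} \<and>
     lookup m 2 \<le> 1 \<and> lookup m 3 \<le> 1"

definition normal_polys :: "'k::comm_ring_1 mpoly set" where
  "normal_polys = {p. \<forall>m\<in>keys p. normal_mon m}"

lemma normal_polys_0 [simp]: "0 \<in> normal_polys" by (simp add: normal_polys_def)

lemma normal_polys_add: "p \<in> normal_polys \<Longrightarrow> q \<in> normal_polys \<Longrightarrow> p + q \<in> normal_polys"
  using keys_add[of p q] by (auto simp: normal_polys_def)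

lemma normal_polys_polys: "p \<in> normal_polys \<Longrightarrow> p \<in> polys 4"
  by (auto simp: normal_polys_def polys_def normal_mon_def)

lemma Var_square: "Var i ^ 2 = single (single i 2) 1"
  by (simp add: Var_def power2_eq_square mult_single numeral_2_eq_2 flip: single_add)

lemma quadrics_ideal_mult:
  assumes "a \<in> polys 4" shows "a * quadric1 \<in> quadI" "a * quadric2 \<in> quadI"
proof -
  have "a * quadric1 = a * quadric1 + 0 * quadric2" "a * quadric2 = 0 * quadric1 + a * quadric2"
    by simp_all
  then show "a * quadric1 \<in> quadI" "a * quadric2 \<in> quadI"
    using assms polys_0 unfolding quadrics_ideal_eq by blast+
qed

lemma quadrics_ideal_uminus: "p \<in> quadI \<Longrightarrow> - p \<in> quadI"
  using quadrics_idealD(4)[of p "- 1"] by (simp add: polys_uminus)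

text \<open>Replacing the square of u or v lowers the total exponent of these two variables by 2.\<close>

lemma normal_form_monomial:
  assumes "keys m \<subseteq> {..4}"
  shows "\<exists>q\<in>normal_polys. single m c - q \<in> quadI"
  using assms
proof (induction "lookup m 2 + lookup m 3" arbitrary: m rule: less_induct)
  case less
  have step: "\<exists>q\<in>normal_polys. single m c - q \<in> quadI"
    if m: "m = m' + single i 2" and i: "i = 2 \<or> i = 3"
      and eq: "single m c
                 - (single (m' + single a 2) c
                    + single (m' + (single b 1 + single 4 1)) c)
               \<in> quadI"
      and ab: "a < 2" "b < 2" for m' i a b
  proof -
    let ?m1 = "m' + single a 2"
    let ?m2 = "m' + (single b 1 + single 4 1)"
    have keys: "keys ?m1 \<subseteq> {..4}" "keys ?m2 \<subseteq> {..4}"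
      using less.prems m ab by (auto simp: keys_add_mon)
    have *: "lookup ?m1 2 + lookup ?m1 3
              < lookup m 2 + lookup m 3"
      "lookup ?m2 2 + lookup ?m2 3
              < lookup m 2 + lookup m 3"
      using ab i by (auto simp: m lookup_add lookup_single when_def)
    obtain q1 where q1: "q1 \<in> normal_polys" "single ?m1 c - q1 \<in> quadI"
      using less.hyps[OF *(1) keys(1)] by blast
    obtain q2 where q2: "q2 \<in> normal_polys" "single ?m2 c - q2 \<in> quadI"
      using less.hyps[OF *(2) keys(2)] by blast
    have "single m c - (q1 + q2)
        = (single m c - (single ?m1 c + single ?m2 c))
          + (single ?m1 c - q1) + (single ?m2 c - q2)"
      by (simp add: algebra_simps)
    then have "single m c - (q1 + q2) \<in> quadI"
      using eq q1(2) q2(2) quadrics_idealD(3) by metis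
    then show ?thesis using normal_polys_add[OF q1(1) q2(1)] by blast
  qed
  have split: "m = (m - single i 2) + single i 2"
    if "lookup m i \<ge> 2" for i
    using that
    by (intro poly_mapping_eqI) (auto simp: lookup_add lookup_minus lookup_single when_def)
  have sub: "single (m - single i 2) c \<in> polys 4" for i
    using less.prems by (intro polys_single) (auto simp: in_keys_iff lookup_minus subset_iff)
  consider "lookup m 2 \<ge> 2" | "lookup m 3 \<ge> 2"
    | "lookup m 2 \<le> 1" "lookup m 3 \<le> 1" by linarith
  then show ?case
  proof cases
    case 1
    define m' where "m' = m - single 2 2"
    have m: "m = m' + single 2 2" using split[OF 1] by (simp add: m'_def)
    have "single m c
        - (single (m' + single 0 2) c
           + single (m' + (single 1 1 + single 4 1)) c)
        = - (single m' c * quadric1)"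
      unfolding m quadric1_def Var_square by (simp add: Var_def mult_single algebra_simps)
    then show ?thesis
      using quadrics_ideal_uminus[OF quadrics_ideal_mult(1)[OF sub[of 2]]]
      by (intro step[OF m, of 0 1]) (auto simp: m'_def)
  next
    case 2
    define m' where "m' = m - single 3 2"
    have m: "m = m' + single 3 2" using split[OF 2] by (simp add: m'_def)
    have "single m c
        - (single (m' + single 1 2) c
           + single (m' + (single 0 1 + single 4 1)) c)
        = - (single m' c * quadric2)"
      unfolding m quadric2_def Var_square by (simp add: Var_def mult_single algebra_simps)
    then show ?thesis
      using quadrics_ideal_uminus[OF quadrics_ideal_mult(2)[OF sub[of 3]]]
      by (intro step[OF m, of 1 0]) (auto simp: m'_def)
  next
    case 3
    then have "single m c \<in> normal_polys"
      using less.prems by (auto simp: normal_polys_def normal_mon_def)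
    then show ?thesis using quadrics_idealD(2) by (metis diff_self)
  qed
qed

lemma normal_form_exists:
  assumes "p \<in> polys 4" shows "\<exists>q\<in>normal_polys. p - q \<in> quadI"
proof (rule poly_mapping_additive_induct[where p = p])
  show "\<exists>q\<in>normal_polys. (0 :: 'a mpoly) - q \<in> quadI"
    using quadrics_idealD(2) by (intro bexI[of _ 0]) auto
next
  fix m assume "m \<in> keys p"
  then show "\<exists>q\<in>normal_polys. single m (lookup p m) - q \<in> quadI"
    using assms by (intro normal_form_monomial) (auto simp: polys_def)
next
  fix r s :: "'a mpoly"
  assume "\<exists>q\<in>normal_polys. r - q \<in> quadI" "\<exists>q\<in>normal_polys. s - q \<in> quadI"
  then obtain q q' where q: "q \<in> normal_polys" "r - q \<in> quadI"
    "q' \<in> normal_polys" "s - q' \<in> quadI" by blast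
  have "r + s - (q + q') = (r - q) + (s - q')" by simp
  then show "\<exists>q\<in>normal_polys. r + s - q \<in> quadI"
    using q normal_polys_add quadrics_idealD(3) by metis
qed

text \<open>The polynomials in x, y and z only, over which u and v are algebraic.\<close>

definition base_polys :: "'k::comm_ring_1 mpoly set" where
  "base_polys = {p. \<forall>m\<in>keys p. keys m \<subseteq> {0, 1, 4}}"

lemma base_polys_add: "p \<in> base_polys \<Longrightarrow> q \<in> base_polys \<Longrightarrow> p + q \<in> base_polys"
  using keys_add[of p q] by (auto simp: base_polys_def)

lemma generic_value_base: "p \<in> base_polys \<Longrightarrow> gval p = embed p"
proof -
  assume p: "p \<in> base_polys"
  have "embed p = embed (eval_poly Const Var p)" by (simp add: eval_Const_Var)
  also have "\<dots> = eval_poly (\<lambda>a. embed (Const a)) (\<lambda>i. embed (Var i)) p"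
    by (rule scalar_hom_eval_poly[OF scalar_hom_embed])
  also have "\<dots> = gval p"
    unfolding gval_def
  proof (rule eval_poly_cong_keys)
    fix m i assume "m \<in> keys p" "i \<in> keys m"
    then have "i \<in> {0, 1, 4}" using p unfolding base_polys_def by blast
    then show "embed (Var i) = gpt i" by (auto simp: gpt_def)
  qed
  finally show ?thesis by simp
qed

lemma normal_polys_decompose:
  assumes "p \<in> normal_polys"
  shows "\<exists>a\<in>base_polys. \<exists>b\<in>base_polys. \<exists>c\<in>base_polys. \<exists>d\<in>base_polys.
           p = a + b * Var 2 + c * Var 3 + d * (Var 2 * Var 3)"
proof (rule poly_mapping_additive_induct[where p = p])
  show "\<exists>a\<in>base_polys. \<exists>b\<in>base_polys. \<exists>c\<in>base_polys. \<exists>d\<in>base_polys.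
          (0 :: 'a mpoly) = a + b * Var 2 + c * Var 3 + d * (Var 2 * Var 3)"
    by (intro bexI[of _ 0]) (auto simp: base_polys_def)
next
  fix m assume "m \<in> keys p"
  then have m: "keys m \<subseteq> {..4}" "lookup m 2 \<le> 1" "lookup m 3 \<le> 1"
    using assms by (auto simp: normal_polys_def normal_mon_def)
  define k where "k = lookup p m"
  define i where "i = lookup m 2"
  define j where "j = lookup m 3"
  define m' where "m' = m - single 2 i - single 3 j"
  have eq: "m = m' + (single 2 i + single 3 j)"
    by (intro poly_mapping_eqI)
       (auto simp: lookup_add lookup_minus lookup_single when_def m'_def i_def j_def)
  have "keys m' \<subseteq> {0, 1, 4}"
  proof
    fix l assume l: "l \<in> keys m'"
    then have "l \<in> keys m" by (auto simp: m'_def in_keys_iff lookup_minus)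
    moreover have "l \<noteq> 2" "l \<noteq> 3"
      using l by (auto simp: m'_def in_keys_iff lookup_minus lookup_single i_def j_def)
    ultimately show "l \<in> {0, 1, 4}" using m(1) by (auto dest!: subsetD)
  qed
  then have base: "single m' k \<in> base_polys" "(0 :: 'a mpoly) \<in> base_polys"
    by (auto simp: base_polys_def)
  have "i = 0 \<or> i = 1" "j = 0 \<or> j = 1" using m by (auto simp: i_def j_def)
  then show "\<exists>a\<in>base_polys. \<exists>b\<in>base_polys. \<exists>c\<in>base_polys. \<exists>d\<in>base_polys.
      single m (lookup p m)
        = a + b * Var 2 + c * Var 3 + d * (Var 2 * Var 3)" (is ?D)
  proof (elim disjE)
    assume "i = 0" "j = 0"
    then have "single m k = single m' k + 0 * Var 2 + 0 * Var 3 + 0 * (Var 2 * Var 3)"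
      by (simp add: eq)
    then show ?D using base k_def by metis
  next
    assume "i = 1" "j = 0"
    then have "single m k = 0 + single m' k * Var 2 + 0 * Var 3 + 0 * (Var 2 * Var 3)"
      by (simp add: eq Var_def mult_single)
    then show ?D using base k_def by metis
  next
    assume "i = 0" "j = 1"
    then have "single m k = 0 + 0 * Var 2 + single m' k * Var 3 + 0 * (Var 2 * Var 3)"
      by (simp add: eq Var_def mult_single)
    then show ?D using base k_def by metis
  next
    assume "i = 1" "j = 1"
    then have "single m k = 0 + 0 * Var 2 + 0 * Var 3 + single m' k * (Var 2 * Var 3)"
      by (simp add: eq Var_def mult_single)
    then show ?D using base k_def by metis
  qed
next
  fix r s :: "'a mpoly"
  assume "\<exists>a\<in>base_polys. \<exists>b\<in>base_polys. \<exists>c\<in>base_polys. \<exists>d\<in>base_polys.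
      r = a + b * Var 2 + c * Var 3 + d * (Var 2 * Var 3)"
    "\<exists>a\<in>base_polys. \<exists>b\<in>base_polys. \<exists>c\<in>base_polys. \<exists>d\<in>base_polys.
      s = a + b * Var 2 + c * Var 3 + d * (Var 2 * Var 3)"
  then obtain a b c d a' b' c' d' where
    "a \<in> base_polys" "b \<in> base_polys" "c \<in> base_polys" "d \<in> base_polys"
    "r = a + b * Var 2 + c * Var 3 + d * (Var 2 * Var 3)"
    "a' \<in> base_polys" "b' \<in> base_polys" "c' \<in> base_polys" "d' \<in> base_polys"
    "s = a' + b' * Var 2 + c' * Var 3 + d' * (Var 2 * Var 3)" by blast
  then show "\<exists>a\<in>base_polys. \<exists>b\<in>base_polys. \<exists>c\<in>base_polys. \<exists>d\<in>base_polys.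
      r + s = a + b * Var 2 + c * Var 3 + d * (Var 2 * Var 3)"
    by (intro bexI[of _ "a + a'"] bexI[of _ "b + b'"] bexI[of _ "c + c'"] bexI[of _ "d + d'"])
       (auto intro: base_polys_add simp: algebra_simps)
qed

lemma normal_polys_kernel:
  assumes "p \<in> normal_polys" "gval p = 0" shows "p = 0"
proof -
  obtain a b c d where abcd: "a \<in> base_polys" "b \<in> base_polys" "c \<in> base_polys" "d \<in> base_polys"
    and p: "p = a + b * Var 2 + c * Var 3 + d * (Var 2 * Var 3)"
    using normal_polys_decompose[OF assms(1)] by blast
  have "embed a + embed b * gpt 2 + embed c * gpt 3
          + embed d * (gpt 2 * gpt 3) = 0"
    using assms(2) by (simp add: p generic_value_simps generic_value_base abcd)
  then show ?thesis using big_field_independent p by fastforce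
qed

text \<open>The quadrics generate the ideal of all polynomials that vanish at the generic point.\<close>

theorem quadrics_ideal_kernel:
  "p \<in> quadI \<longleftrightarrow> p \<in> polys 4 \<and> gval p = 0"
proof
  assume p: "p \<in> polys 4 \<and> gval p = 0"
  then obtain q where q: "q \<in> normal_polys" "p - q \<in> quadI"
    using normal_form_exists by blast
  have "gval q = 0"
    using generic_value_ideal[OF q(2)] p by (simp add: generic_value_simps)
  then have "q = 0" by (rule normal_polys_kernel[OF q(1)])
  then show "p \<in> quadI" using q(2) by simp
qed (use quadrics_idealD(1) generic_value_ideal in auto)

lemma quadrics_ideal_prime:
  "primeideal (quadI :: 'k::field_char_0 mpoly set) (poly_ring 4)"
proof (rule primeidealI[OF quadrics_ideal_ideal poly_ring_cring])
  have "1 \<notin> (quadI :: 'k mpoly set)" by (simp add: quadrics_ideal_kernel generic_value_simps)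
  then show "carrier (poly_ring 4) \<noteq> (quadI :: 'k mpoly set)" by auto
qed (auto simp: quadrics_ideal_kernel generic_value_simps)

lemma generic_point_nonzero:
  "gpt 0 \<noteq> (0 :: 'a::field_char_0 big_field)"
  "gpt 1 \<noteq> (0 :: 'a big_field)" "gpt 4 \<noteq> (0 :: 'a big_field)"
  "gpt 2 \<noteq> (0 :: 'a big_field)" "gpt 3 \<noteq> (0 :: 'a big_field)"
proof -
  have "(square1 :: 'a mpoly) \<noteq> 0" "(square2 :: 'a mpoly) \<noteq> 0"
    using odd_degrees(1,2)[where 'k = 'a] by (auto simp: as_poly_def)
  then have "gpt 2 ^ 2 \<noteq> (0 :: 'a big_field)" "gpt 3 ^ 2 \<noteq> (0 :: 'a big_field)"
    by (simp_all only: generic_point_square embed_eq_0_iff not_False_eq_True)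
  then show "gpt 2 \<noteq> (0 :: 'a big_field)" "gpt 3 \<noteq> (0 :: 'a big_field)" by auto
qed (simp_all add: gpt_def)

subsection \<open>Homogeneous parts\<close>

lemma lookup_hom_part:
  "lookup (hom_part d p) m = (if mon_degree m = d then lookup p m else 0)"
  unfolding hom_part_def lookup_sum lookup_single when_def
  by (subst sum.delta) (auto simp: in_keys_iff)

lemma keys_hom_part: "keys (hom_part d p) = {m \<in> keys p. mon_degree m = d}"
  by (auto simp: in_keys_iff lookup_hom_part split: if_splits)

lemma hom_part_add: "hom_part d (p + q) = hom_part d p + hom_part d q"
  by (rule poly_mapping_eqI) (simp add: lookup_hom_part lookup_add)

lemma hom_part_forms: "p \<in> polys n \<Longrightarrow> hom_part d p \<in> forms n d"
  by (auto simp: forms_def polys_def keys_hom_part)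

lemma hom_part_homogeneous:
  assumes "\<And>m. m \<in> keys p \<Longrightarrow> mon_degree m = e"
  shows "hom_part d p = (if d = e then p else 0)"
  by (rule poly_mapping_eqI)
     (use assms in \<open>auto simp: lookup_hom_part simp flip: not_in_keys_iff_lookup_eq_zero\<close>)

lemma hom_part_form: "p \<in> forms n d \<Longrightarrow> hom_part d p = p"
  by (subst hom_part_homogeneous[of _ d]) (auto simp: forms_def)

lemma hom_part_mult_form:
  assumes q: "q \<in> forms n e"
  shows "hom_part d (a * q) = (if e \<le> d then hom_part (d - e) a * q else 0)"
proof (induction a rule: additive_induct)
  case (3 m c)
  have "mon_degree k = mon_degree m + e"
    if "k \<in> keys (single m c * q)" for k
  proof -
    have "c \<noteq> 0" using that by auto
    then have "keys (single m c) = {m}" by simp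
    then show ?thesis
      using that keys_mult[of "single m c" q] q by (fastforce simp: forms_def)
  qed
  note l = hom_part_homogeneous[OF this, of _ d]
  have r: "hom_part f (single m c)
      = (if f = mon_degree m then single m c else 0)" for f
    by (rule hom_part_homogeneous) (auto split: if_splits)
  show ?case by (cases "e \<le> d") (auto simp: l r)
qed (simp_all add: hom_part_add distrib_right hom_part_def[of _ 0])

lemma quadrics_ideal_homogeneous: "homogeneous_ideal 4 quadI"
  unfolding homogeneous_ideal_def
proof (intro conjI ballI allI quadrics_ideal_ideal)
  fix p :: "rat mpoly" and d assume "p \<in> quadI"
  then obtain a b where p: "p = a * quadric1 + b * quadric2" "a \<in> polys 4" "b \<in> polys 4"
    unfolding quadrics_ideal_eq by blast
  have h: "hom_part (d - 2) a \<in> polys 4" "hom_part (d - 2) b \<in> polys 4"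
    using p hom_part_forms forms_polys by blast+
  have "hom_part d p = (if 2 \<le> d then hom_part (d - 2) a * quadric1 + hom_part (d - 2) b * quadric2 else 0)"
    by (simp add: p(1) hom_part_add hom_part_mult_form[OF quadric_forms(1)]
        hom_part_mult_form[OF quadric_forms(2)])
  then show "hom_part d p \<in> quadI"
    using quadrics_idealD(2) quadrics_idealD(3)[OF quadrics_ideal_mult(1)[OF h(1)]
      quadrics_ideal_mult(2)[OF h(2)]] by auto
qed

lemma quadrics_variety: "projective_variety 4 quadI"
  unfolding projective_variety_def
proof (intro conjI quadrics_ideal_homogeneous quadrics_ideal_prime)
  have "Var 4 \<notin> (quadI :: rat mpoly set)"
    by (simp add: quadrics_ideal_kernel generic_value_simps generic_point_nonzero)
  then show "\<not> Var ` {..4} \<subseteq> (quadI :: rat mpoly set)" by blast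
qed

subsection \<open>Extension of the ground field\<close>

lemma keys_map_of_rat:
  "keys (Poly_Mapping.map of_rat p :: 'm \<Rightarrow>\<^sub>0 'k::field_char_0) = keys p"
  by (auto simp: in_keys_iff map.rep_eq when_def)

lemma eval_map_of_rat:
  "eval_poly c x (Poly_Mapping.map of_rat p) = eval_poly (\<lambda>a. c (of_rat a :: 'k::field_char_0)) x p"
  unfolding eval_poly_def keys_map_of_rat
  by (intro sum.cong refl) (auto simp: map.rep_eq when_def in_keys_iff)

lemma polys_map_of_rat:
  "p \<in> polys n \<Longrightarrow> (Poly_Mapping.map of_rat p :: 'k::field_char_0 mpoly) \<in> polys n"
  by (simp add: polys_def keys_map_of_rat)

lemma map_of_rat_ideal:
  assumes "p \<in> quadI"
  shows "(Poly_Mapping.map of_rat p :: 'k::field_char_0 mpoly) \<in> quadI"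
proof -
  let ?e = "eval_poly (\<lambda>a. embed (Const (of_rat a :: 'k))) gpt"
  interpret h: scalar_hom "\<lambda>a. embed (Const (of_rat a :: 'k))"
    by (rule scalar_hom_comp[OF scalar_hom_embed_Const scalar_hom_of_rat])
  obtain a b where p: "p = a * quadric1 + b * quadric2" "a \<in> polys 4" "b \<in> polys 4"
    using assms unfolding quadrics_ideal_eq by blast
  have "?e quadric1 = 0" "?e quadric2 = 0"
    by (simp_all add: quadric1_def quadric2_def h.eval_simps generic_point_relations)
  then have "?e p = 0" by (simp add: p(1) h.eval_simps)
  then show ?thesis
    using assms polys_map_of_rat[of p 4]
    by (simp add: quadrics_ideal_kernel gval_def eval_map_of_rat)
qed

lemma map_of_rat_quadrics:
  "Poly_Mapping.map of_rat quadric1 = (quadric1 :: 'k::field_char_0 mpoly)"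
  "Poly_Mapping.map of_rat quadric2 = (quadric2 :: 'k::field_char_0 mpoly)"
proof -
  interpret C: scalar_hom "\<lambda>a. Const (of_rat a :: 'k)"
    by (rule scalar_hom_comp[OF scalar_hom_Const scalar_hom_of_rat])
  have "Poly_Mapping.map of_rat p = eval_poly (\<lambda>a. Const (of_rat a :: 'k)) Var p" for p
    using eval_map_of_rat[of Const Var p] eval_Const_Var by metis
  then show "Poly_Mapping.map of_rat quadric1 = (quadric1 :: 'k mpoly)"
    "Poly_Mapping.map of_rat quadric2 = (quadric2 :: 'k mpoly)"
    by (simp_all add: quadric1_def quadric2_def C.eval_simps)
qed

lemma quadrics_geometrically_integral: "geometrically_integral 4 quadI"
proof -
  let ?S = "Poly_Mapping.map of_rat ` (quadI :: rat mpoly set) :: complex mpoly set"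
  have q: "quadric1 \<in> (quadI :: rat mpoly set)" "quadric2 \<in> (quadI :: rat mpoly set)"
    by (auto simp: quadrics_ideal_kernel generic_value_quadrics quadric_polys)
  have S: "?S \<subseteq> quadI" using map_of_rat_ideal by blast
  have "genideal (poly_ring 4) ?S = quadI"
  proof
    show "genideal (poly_ring 4) ?S \<subseteq> quadI"
      by (rule ring.genideal_minimal[OF poly_ring_ring quadrics_ideal_ideal S])
    have c: "?S \<subseteq> carrier (poly_ring 4)" using S quadrics_idealD(1) by auto
    have "?S \<subseteq> genideal (poly_ring 4) ?S"
      by (rule ring.genideal_self[OF poly_ring_ring c])
    moreover have "quadric1 \<in> ?S" "quadric2 \<in> ?S"
      using q map_of_rat_quadrics by (metis imageI)+
    ultimately show "quadI \<subseteq> genideal (poly_ring 4) ?S"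
      unfolding quadI_def[where 'k = complex]
      by (intro ring.genideal_minimal[OF poly_ring_ring ring.genideal_ideal[OF poly_ring_ring c]]) auto
  qed
  then show ?thesis unfolding geometrically_integral_def by (simp add: quadrics_ideal_prime)
qed

subsection \<open>The projective closure\<close>

lemma mon_degree_le_total:
  "m \<in> keys p \<Longrightarrow> mon_degree m \<le> total_degree p"
  by (auto simp: total_degree_def)

lemma generic_value_homogenize:
  "gval (homogenize 4 p) =
     gpt 4 ^ total_degree p
       * eval_poly (\<lambda>a. embed (Const a)) (\<lambda>i. gpt i / gpt 4) p"
proof -
  let ?z = "gpt 4" and ?x = "\<lambda>i. gpt i / gpt 4"
  have "gval (homogenize 4 p) = (\<Sum>m\<in>keys p.
      embed (Const (lookup p m)) * (mon_val gpt m * ?z ^ (total_degree p - mon_degree m)))"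
    by (simp add: homogenize_def gval_def gen.eval_sum gen.eval_single mon_val_add mon_val_single)
  also have "\<dots> = (\<Sum>m\<in>keys p.
      ?z ^ total_degree p * (embed (Const (lookup p m)) * mon_val ?x m))"
  proof (intro sum.cong refl)
    fix m assume m: "m \<in> keys p"
    have "mon_val gpt m = mon_val (\<lambda>i. ?z * ?x i) m"
      by (simp add: generic_point_nonzero)
    also have "\<dots> = ?z ^ mon_degree m * mon_val ?x m" by (rule mon_val_scale)
    finally have *: "mon_val gpt m = ?z ^ mon_degree m * mon_val ?x m" .
    have "mon_val gpt m * ?z ^ (total_degree p - mon_degree m)
        = ?z ^ (mon_degree m + (total_degree p - mon_degree m)) * mon_val ?x m"
      unfolding * by (simp only: power_add mult_ac)
    also have "mon_degree m + (total_degree p - mon_degree m) = total_degree p"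
      using mon_degree_le_total[OF m] by simp
    finally have eq: "mon_val gpt m * ?z ^ (total_degree p - mon_degree m)
        = ?z ^ total_degree p * mon_val ?x m" .
    show "embed (Const (lookup p m))
        * (mon_val gpt m * ?z ^ (total_degree p - mon_degree m))
        = ?z ^ total_degree p * (embed (Const (lookup p m)) * mon_val ?x m)"
      unfolding eq by (simp only: mult_ac)
  qed
  finally show ?thesis by (simp add: eval_poly_mon_val sum_distrib_left)
qed

lemma homogenize_polys:
  assumes "p \<in> polys n" shows "homogenize (Suc n) p \<in> polys (Suc n)"
  unfolding homogenize_def
proof (intro polys_sum polys_single)
  fix m assume "m \<in> keys p"
  then have "keys m \<subseteq> {..n}" using assms by (auto simp: polys_def)
  then show "keys (m + single (Suc n) (total_degree p - mon_degree m)) \<subseteq> {..Suc n}"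
    by (auto simp: keys_add_mon)
qed

lemma single_mon_eq_iff:
  "single i a = (single j b :: mon) \<longleftrightarrow> a = b \<and> (i = j \<or> a = 0)"
proof
  assume "single i a = (single j b :: mon)"
  then have "lookup (single i a) l
      = lookup (single j b :: mon) l" for l by simp
  from this[of i] this[of j] show "a = b \<and> (i = j \<or> a = 0)"
    by (auto simp: lookup_single when_def split: if_splits)
qed auto

text \<open>The homogenization of a polynomial with three given terms, of degrees 2, 1 and 2.\<close>

lemma homogenize_affine_quadric:
  fixes i j k n :: nat
  assumes "i \<noteq> k"
  shows "homogenize n (Var i ^ 2 + Var j - Var k ^ 2 :: 'k::field_char_0 mpoly)
           = Var i ^ 2 + Var j * Var n - Var k ^ 2"
proof -
  let ?p = "Var i ^ 2 + Var j - Var k ^ 2 :: 'k mpoly"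
  let ?a = "single i 2 :: mon" and ?b = "single j 1 :: mon"
    and ?c = "single k 2 :: mon"
  have ne: "?a \<noteq> ?b" "?a \<noteq> ?c" "?b \<noteq> ?c" using assms by (simp_all add: single_mon_eq_iff)
  have p: "?p = single ?a 1 + single ?b 1 + single ?c (- 1)"
    unfolding Var_square by (simp add: Var_def single_uminus)
  have l: "lookup ?p m = (if m = ?a \<or> m = ?b then 1 else if m = ?c then - 1 else 0)" for m
    using ne unfolding p by (auto simp: lookup_add lookup_single when_def)
  have keys: "keys ?p = {?a, ?b, ?c}"
    using l by (auto simp: in_keys_iff split: if_splits)
  have nz: "?p \<noteq> 0" using keys by force
  have deg: "total_degree ?p = 2" unfolding total_degree_def keys using nz by simp
  have "homogenize n ?p = single ?a 1
      + single (?b + single n 1) 1 + single ?c (- 1)"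
    unfolding homogenize_def keys deg using ne
    by (simp add: l)
  also have "\<dots> = Var i ^ 2 + Var j * Var n - Var k ^ 2"
    unfolding Var_square by (simp add: Var_def single_uminus mult_single)
  finally show ?thesis .
qed

theorem projective_closure_quadrics:
  "projective_closure 3 (genideal (poly_ring 3)
     {Var 0 ^ 2 + Var 1 - Var 2 ^ 2, Var 0 + Var 1 ^ 2 - Var 3 ^ 2}) = quadI"
proof -
  let ?p = "Var 0 ^ 2 + Var 1 - Var 2 ^ 2 :: rat mpoly" and ?q = "Var 0 + Var 1 ^ 2 - Var 3 ^ 2 :: rat mpoly"
  let ?J = "genideal (poly_ring 3) {?p, ?q}" and ?z = "gpt 4 :: rat big_field"
  have pq: "?p \<in> polys 3" "?q \<in> polys 3" by (intro polys_intros polys_Var; simp)+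
  note J = genideal_pair[OF pq]
  have S: "homogenize 4 ` ?J \<subseteq> quadI"
  proof
    fix h assume "h \<in> homogenize 4 ` ?J"
    then obtain a b where h: "h = homogenize 4 (a * ?p + b * ?q)" and ab: "a \<in> polys 3" "b \<in> polys 3"
      unfolding J by blast
    have "a * ?p + b * ?q \<in> polys 3" by (intro polys_add polys_mult ab pq)
    from homogenize_polys[OF this] have "h \<in> polys 4" by (simp add: h)
    moreover have "(gpt 0 / ?z) ^ 2 + gpt 1 / ?z - (gpt 2 / ?z) ^ 2 = 0"
      "gpt 0 / ?z + (gpt 1 / ?z) ^ 2 - (gpt 3 / ?z) ^ 2 = 0"
      unfolding power_divide generic_point_relations
      by (simp_all add: add_divide_distrib generic_point_nonzero power2_eq_square[of ?z])
    then have "gval h = 0"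
      by (simp add: h generic_value_homogenize gen.eval_simps)
    ultimately show "h \<in> quadI" by (simp add: quadrics_ideal_kernel)
  qed
  have c: "homogenize 4 ` ?J \<subseteq> carrier (poly_ring 4)" using S quadrics_idealD(1) by auto
  have "?p = 1 * ?p + 0 * ?q" "?q = 0 * ?p + 1 * ?q" by simp_all
  then have "?p \<in> ?J" "?q \<in> ?J" unfolding J using polys_0 polys_1 by blast+
  moreover have "homogenize 4 ?p = quadric1" "homogenize 4 ?q = quadric2"
    using homogenize_affine_quadric[of 0 2 4 1] homogenize_affine_quadric[of 1 3 4 0]
    by (simp_all add: quadric1_def quadric2_def add.commute)
  ultimately have mem: "quadric1 \<in> homogenize 4 ` ?J" "quadric2 \<in> homogenize 4 ` ?J"
    by (metis imageI)+
  have "genideal (poly_ring 4) (homogenize 4 ` ?J) = quadI"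
  proof
    show "genideal (poly_ring 4) (homogenize 4 ` ?J) \<subseteq> quadI"
      by (rule ring.genideal_minimal[OF poly_ring_ring quadrics_ideal_ideal S])
    have "homogenize 4 ` ?J \<subseteq> genideal (poly_ring 4) (homogenize 4 ` ?J)"
      by (rule ring.genideal_self[OF poly_ring_ring c])
    then show "quadI \<subseteq> genideal (poly_ring 4) (homogenize 4 ` ?J)"
      unfolding quadI_def using mem
      by (intro ring.genideal_minimal[OF poly_ring_ring ring.genideal_ideal[OF poly_ring_ring c]]) auto
  qed
  then show ?thesis by (simp add: projective_closure_def)
qed

section \<open>The Hilbert polynomial\<close>

lemma Const_mult_map: "Const c * p = Poly_Mapping.map ((*) c) p"
  by (simp add: Const_def mult_map_scale_conv_mult)

lemma lookup_map_mult:
  fixes c :: "'k::comm_ring_1"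
  shows
  "lookup (Poly_Mapping.map ((*) c) p) m = c * lookup p m"
  by (simp add: map.rep_eq when_def)

lemma lookup_Const_mult: "lookup (Const c * p) m = c * lookup p m"
  by (simp add: Const_mult_map lookup_map_mult)

lemma vector_space_mpoly: "vector_space (\<lambda>c p. Const c * p :: 'k::field mpoly)"
  by unfold_locales (auto simp: Const_add Const_mult Const_1 algebra_simps)

interpretation mp: vector_space "\<lambda>c p. Const c * p :: rat mpoly" by (rule vector_space_mpoly)

text \<open>A spanning family that is dual to coefficient functionals is a basis.\<close>

lemma dim_dual_basis:
  fixes g :: "mon \<Rightarrow> rat mpoly"
  assumes S: "finite S"
    and dual: "\<And>m k. m \<in> S \<Longrightarrow> k \<in> S \<Longrightarrow> lookup (g m) k = (if m = k then 1 else 0)"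
    and V: "g ` S \<subseteq> V" "V \<subseteq> mp.span (g ` S)"
  shows "mp.dim V = card S"
proof (rule mp.dim_unique[OF V])
  have inj: "inj_on g S"
  proof (rule inj_onI)
    fix m k assume "m \<in> S" "k \<in> S" "g m = g k"
    then show "m = k" using dual[of m k] dual[of k k] by (auto split: if_splits)
  qed
  then show "card (g ` S) = card S" by (rule card_image)
  show "\<not> mp.dependent (g ` S)"
  proof (rule mp.independent_if_scalars_zero)
    fix f x assume sum: "(\<Sum>x\<in>g ` S. Const (f x) * x) = 0" and "x \<in> g ` S"
    then obtain k where k: "x = g k" "k \<in> S" by blast
    have "0 = lookup (\<Sum>x\<in>g ` S. Const (f x) * x) k" by (simp add: sum)
    also have "\<dots> = (\<Sum>m\<in>S. f (g m) * lookup (g m) k)"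
      by (simp add: sum.reindex[OF inj] lookup_sum lookup_Const_mult)
    also have "\<dots> = (\<Sum>m\<in>S. if m = k then f (g m) else 0)"
      by (intro sum.cong refl) (use dual k in auto)
    also have "\<dots> = f x" using k S by (simp add: sum.delta)
    finally show "f x = 0" by simp
  qed (use S in simp)
qed

text \<open>The monomials of degree \<open>d\<close> in X_0, ..., X_n.\<close>

definition monomials :: "nat \<Rightarrow> nat \<Rightarrow> mon set" where
  "monomials n d = {m. keys m \<subseteq> {..n} \<and> mon_degree m = d}"

lemma lookup_le_mon_degree: "lookup m i \<le> mon_degree m"
proof (cases "i \<in> keys m")
  case True
  then show ?thesis unfolding mon_degree_def by (intro member_le_sum) auto
qed (simp add: in_keys_iff)

lemma finite_monomials: "finite (monomials n d)"
proof -
  let ?F = "{f :: nat \<Rightarrow> nat. \<forall>i. (i \<in> {..n} \<longrightarrow> f i \<in> {..d}) \<and> (i \<notin> {..n} \<longrightarrow> f i = 0)}"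
  have "lookup m \<in> ?F" if "m \<in> monomials n d" for m
  proof -
    have "lookup m i \<le> d" for i
      using that lookup_le_mon_degree[of m i] by (simp add: monomials_def)
    moreover have "lookup m i = 0" if "i \<notin> {..n}" for i
      using that \<open>m \<in> monomials n d\<close> not_in_keys_iff_lookup_eq_zero[of i m]
      unfolding monomials_def by blast
    ultimately show ?thesis by simp
  qed
  then have "lookup ` monomials n d \<subseteq> ?F" by (rule image_subsetI)
  moreover have "finite ?F" by (rule finite_set_of_finite_funs) simp_all
  ultimately have "finite (lookup ` monomials n d)" by (rule finite_subset)
  moreover have "inj_on lookup (monomials n d)"
    by (intro inj_onI poly_mapping_eqI) simp
  ultimately show ?thesis by (rule finite_imageD)
qed

lemma dim_forms: "mp.dim (forms n d) = card (monomials n d)"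
proof (rule dim_dual_basis[where g = "\<lambda>m. single m 1"])
  show "forms n d \<subseteq> mp.span ((\<lambda>m. single m 1) ` monomials n d)"
  proof
    fix p :: "rat mpoly" assume p: "p \<in> forms n d"
    have "p = (\<Sum>m\<in>keys p. Const (lookup p m) * single m 1)"
      by (simp add: Const_def mult_single sum_single_keys)
    also have "\<dots> \<in> mp.span ((\<lambda>m. single m 1) ` monomials n d)"
      using p by (intro mp.span_sum mp.span_scale mp.span_base)
        (auto simp: forms_def polys_def monomials_def)
    finally show "p \<in> mp.span ((\<lambda>m. single m 1) ` monomials n d)" .
  qed
qed (use finite_monomials[of n d] in \<open>auto simp: lookup_single monomials_def forms_def polys_def\<close>)

text \<open>The homogeneous part of a normal form is a normal form, and the ideal is homogeneous.\<close>

lemma normal_form_form: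
  assumes "p \<in> forms 4 d"
  shows "\<exists>q. q \<in> normal_polys \<and> q \<in> forms 4 d \<and> (p - q :: rat mpoly) \<in> quadI"
proof -
  obtain q where q: "q \<in> normal_polys" "p - q \<in> quadI"
    using normal_form_exists forms_polys[OF assms] by blast
  have "hom_part d (p - q) \<in> quadI"
    using quadrics_ideal_homogeneous q(2) by (auto simp: homogeneous_ideal_def)
  moreover have "hom_part d (p - q) = p - hom_part d q"
    using hom_part_add[of d "p - q" q] hom_part_form[OF assms] by (simp add: algebra_simps)
  moreover have "hom_part d q \<in> normal_polys"
    using q(1) by (auto simp: normal_polys_def keys_hom_part)
  moreover have "hom_part d q \<in> forms 4 d"
    by (rule hom_part_forms[OF normal_polys_polys[OF q(1)]])
  ultimately show ?thesis by auto
qed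

lemma dim_quadrics_forms:
  "mp.dim (quadI \<inter> forms 4 d) = card {m \<in> monomials 4 d. \<not> normal_mon m}"
proof -
  define S where "S = {m \<in> monomials 4 d. \<not> normal_mon m}"
  have mono: "single m (1 :: rat) \<in> forms 4 d" if "m \<in> S" for m
    using that by (simp add: S_def forms_def polys_def monomials_def)
  have "\<forall>m\<in>S. \<exists>q. q \<in> normal_polys \<and> q \<in> forms 4 d \<and>
      (single m 1 - q :: rat mpoly) \<in> quadI"
    by (intro ballI normal_form_form mono)
  from bchoice[OF this] obtain nf :: "mon \<Rightarrow> rat mpoly" where
    "\<forall>m\<in>S. nf m \<in> normal_polys \<and> nf m \<in> forms 4 d \<and>
       single m 1 - nf m \<in> quadI" ..
  then have nf: "nf m \<in> normal_polys" "nf m \<in> forms 4 d"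
    "single m 1 - nf m \<in> quadI" if "m \<in> S" for m
    using that by simp_all
  define g where "g m = single m 1 - nf m" for m
  have S: "finite S" using finite_monomials by (simp add: S_def)
  have dual: "lookup (g m) k = (if m = k then 1 else 0)" if "m \<in> S" "k \<in> S" for m k
  proof -
    have "lookup (nf m) k = 0"
      using nf(1)[OF that(1)] that(2) by (auto simp: S_def normal_polys_def in_keys_iff)
    then show ?thesis by (simp add: g_def lookup_minus lookup_single when_def)
  qed
  have sub: "g ` S \<subseteq> quadI \<inter> forms 4 d"
  proof (rule image_subsetI)
    fix m assume m: "m \<in> S"
    show "g m \<in> quadI \<inter> forms 4 d"
      unfolding g_def by (intro IntI nf(3)[OF m] forms_diff mono[OF m] nf(2)[OF m])
  qed
  then have gen0: "gval (g m) = 0" if "m \<in> S" for m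
    using that generic_value_ideal[of "g m"] by blast
  show ?thesis unfolding S_def[symmetric]
  proof (rule dim_dual_basis[OF S dual sub])
    show "quadI \<inter> forms 4 d \<subseteq> mp.span (g ` S)"
    proof
      fix p :: "rat mpoly" assume p: "p \<in> quadI \<inter> forms 4 d"
      define s where "s = (\<Sum>m\<in>S. Const (lookup p m) * g m)"
      have sform: "s \<in> forms 4 d" unfolding s_def
      proof (rule forms_sum)
        fix m assume "m \<in> S"
        then have "g m \<in> forms 4 d" using sub by blast
        then show "Const (lookup p m) * g m \<in> forms 4 d"
          by (rule forms_mult'[OF forms_Const]) simp
      qed
      have "gval s = 0"
        using gen0 unfolding s_def gval_def gen.eval_sum gen.eval_mult
        by (intro sum.neutral) simp
      then have g0: "gval (p - s) = 0"
        using p by (simp add: generic_value_simps quadrics_ideal_kernel)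
      have "lookup (p - s) k = 0" if k: "k \<in> S" for k
      proof -
        have "lookup s k = (\<Sum>m\<in>S. lookup p m * lookup (g m) k)"
          by (simp add: s_def lookup_sum lookup_Const_mult)
        also have "\<dots> = (\<Sum>m\<in>S. if m = k then lookup p m else 0)"
          by (intro sum.cong refl) (use dual k in auto)
        also have "\<dots> = lookup p k" using k S by (simp only: sum.delta if_True)
        finally show ?thesis by (simp add: lookup_minus)
      qed
      moreover have "keys (p - s) \<subseteq> monomials 4 d"
      proof -
        have "p - s \<in> forms 4 d" using p sform by (intro forms_diff) simp_all
        then show ?thesis unfolding forms_def polys_def monomials_def by blast
      qed
      ultimately have "p - s \<in> normal_polys"
        unfolding normal_polys_def S_def by (blast dest: lookup_eq_zero_in_keys_contradict)
      then have "p - s = 0" using g0 by (rule normal_polys_kernel)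
      then have "p = s" by simp
      also have "s \<in> mp.span (g ` S)"
        unfolding s_def by (intro mp.span_sum mp.span_scale mp.span_base) auto
      finally show "p \<in> mp.span (g ` S)" .
    qed
  qed
qed

lemma hilbert_function_quadrics:
  "hilbert_function 4 quadI d = card {m \<in> monomials 4 d. normal_mon m}"
proof -
  let ?M = "monomials 4 d"
  have "card ?M = card {m \<in> ?M. normal_mon m} + card {m \<in> ?M. \<not> normal_mon m}"
  proof (subst card_Un_disjoint[symmetric])
    show "card ?M = card ({m \<in> ?M. normal_mon m} \<union> {m \<in> ?M. \<not> normal_mon m})"
      by (rule arg_cong[of _ _ card]) auto
  qed (use finite_monomials in auto)
  then show ?thesis by (simp add: hilbert_function_def dim_forms dim_quadrics_forms)
qed

lemma card_triangle: "2 * card {(a :: nat, b :: nat). a + b \<le> n} = (n + 1) * (n + 2)"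
proof -
  have "{(a :: nat, b :: nat). a + b \<le> n} = (SIGMA a:{..n}. {..n - a})" by auto
  then have "card {(a :: nat, b :: nat). a + b \<le> n} = (\<Sum>a\<le>n. n - a + 1)" by simp
  also have "\<dots> = (\<Sum>a\<le>n. a + 1)"
    by (rule sum.reindex_bij_witness[of _ "\<lambda>a. n - a" "\<lambda>a. n - a"]) auto
  also have "2 * \<dots> = (n + 1) * (n + 2)" by (induction n) auto
  finally show ?thesis .
qed

lemma atMost_4: "{..4 :: nat} = {0, 1, 2, 3, 4}" by auto

lemma card_normal_monomials:
  assumes "d \<ge> 2"
  shows "card {m \<in> monomials 4 d. normal_mon m} = 2 * d ^ 2 + 2 * d + 1"
proof -
  let ?N = "{m \<in> monomials 4 d. normal_mon m}"
  let ?T = "SIGMA ij : {0..1::nat} \<times> {0..1::nat}. {(a :: nat, b :: nat). a + b \<le> d - (fst ij + snd ij)}"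
  let ?f = "\<lambda>m :: mon. ((lookup m 2, lookup m 3),
                 (lookup m 0, lookup m 1))"
  let ?g = "\<lambda>((i, j), (a, b)). single 0 a + single 1 b
      + single 2 i + single 3 j + single 4 (d - (a + b + i + j)) :: mon"
  have deg: "mon_degree m = lookup m 0 + lookup m 1 + lookup m 2
      + lookup m 3 + lookup m 4" if "keys m \<subseteq> {..4}" for m
    using mon_degree_superset[OF _ that] by (simp add: atMost_4)
  \<comment> \<open>The exponents of u, v and of x, y determine that of z. For d at least 2, all four pairs of exponents of u and v occur.\<close>
  have "bij_betw ?f ?N ?T"
  proof (rule bij_betw_byWitness[where f' = ?g])
    show "\<forall>m\<in>?N. ?g (?f m) = m"
    proof
      fix m assume "m \<in> ?N"
      then have m: "keys m \<subseteq> {..4}" "mon_degree m = d" by (auto simp: monomials_def)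
      have "lookup m i = 0" if "i > 4" for i
        using m(1) that by (auto simp: in_keys_iff subset_iff)
      then have z: "i = 0 \<or> i = 1 \<or> i = 2 \<or> i = 3 \<or> i = 4 \<or> lookup m i = 0" for i
        by (cases "i > 4") auto
      have "lookup (?g (?f m)) i = lookup m i" for i
        using z[of i] deg[OF m(1)] m(2) by (auto simp: lookup_add lookup_single when_def)
      then show "?g (?f m) = m" by (rule poly_mapping_eqI)
    qed
    show "\<forall>t\<in>?T. ?f (?g t) = t"
      by (auto simp: lookup_add lookup_single)
    show "?f ` ?N \<subseteq> ?T"
    proof
      fix t assume "t \<in> ?f ` ?N"
      then obtain m where m: "m \<in> ?N" "t = ?f m" by blast
      then show "t \<in> ?T" using deg[of m] by (auto simp: monomials_def normal_mon_def)
    qed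
    show "?g ` ?T \<subseteq> ?N"
    proof
      fix m assume "m \<in> ?g ` ?T"
      then obtain i j a b where m: "m = ?g ((i, j), (a, b))" and ij: "i \<le> 1" "j \<le> 1"
        and "a + b \<le> d - (i + j)" by auto
      then have "a + b + i + j \<le> d" using assms by linarith
      then have "mon_degree m = d" by (simp add: m)
      moreover have "lookup m 2 = i" "lookup m 3 = j"
        by (simp_all add: m lookup_add lookup_single)
      moreover have "keys m \<subseteq> {..4}" by (simp add: m keys_add_mon)
      ultimately show "m \<in> ?N" using ij by (simp add: monomials_def normal_mon_def)
    qed
  qed
  then have "card ?N = card ?T" by (rule bij_betw_same_card)
  also have "\<dots> = (\<Sum>ij\<in>{0..1}\<times>{0..1}. card {(a :: nat, b :: nat). a + b \<le> d - (fst ij + snd ij)})"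
  proof (rule card_SigmaI)
    have "finite {(a :: nat, b :: nat). a + b \<le> n}" for n
      by (rule finite_subset[of _ "{..n} \<times> {..n}"]) auto
    then show "\<forall>ij\<in>{0..1}\<times>{0..1}. finite {(a :: nat, b :: nat). a + b \<le> d - (fst ij + snd ij)}" by blast
  qed simp
  also have "{0..1::nat} \<times> {0..1::nat} = {(0,0), (0,1), (1,0), (1,1)}" by auto
  finally have "2 * card ?N = 2 * card {(a :: nat, b :: nat). a + b \<le> d}
      + 2 * (2 * card {(a :: nat, b :: nat). a + b \<le> d - 1}) + 2 * card {(a :: nat, b :: nat). a + b \<le> d - 2}"
    by (simp add: numeral_2_eq_2)
  also have "\<dots> = 2 * (2 * d ^ 2 + 2 * d + 1)"
    unfolding card_triangle
  proof -
    obtain e where "d = e + 2" using assms by (metis le_add_diff_inverse2)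
    then show "(d + 1) * (d + 2) + 2 * ((d - 1 + 1) * (d - 1 + 2)) + (d - 2 + 1) * (d - 2 + 2)
        = 2 * (2 * d ^ 2 + 2 * d + 1)"
      by (simp add: algebra_simps power2_eq_square)
  qed
  finally show ?thesis by simp
qed

lemma quadrics_dim_degree: "has_dim_degree 4 quadI 2 4"
  unfolding has_dim_degree_def
proof (intro exI[of _ "[:1, 2, 2:]"] conjI)
  have "of_nat (hilbert_function 4 quadI d) = poly [:1, 2, 2 :: rat:] (of_nat d)" if "d \<ge> 2" for d
    by (simp add: hilbert_function_quadrics card_normal_monomials[OF that] algebra_simps power2_eq_square)
  then show "\<forall>\<^sub>F d in sequentially.
      of_nat (hilbert_function 4 quadI d) = poly [:1, 2, 2 :: rat:] (of_nat d)"
    by (auto simp: eventually_sequentially)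
qed (simp_all add: fact_2)

section \<open>Smoothness\<close>

interpretation vec: vector_space "\<lambda>c. Poly_Mapping.map ((*) c) :: (nat \<Rightarrow>\<^sub>0 complex) \<Rightarrow> _"
  by unfold_locales
     (auto intro!: poly_mapping_eqI simp: lookup_map_mult lookup_add algebra_simps)

interpretation cplx: scalar_hom "of_rat :: rat \<Rightarrow> complex" by (rule scalar_hom_of_rat)

lemma lookup_gradient:
  "lookup (gradient n F p) i = (if i \<le> n then eval_poly of_rat p (partial_deriv i F) else 0)"
  unfolding gradient_def lookup_sum lookup_single when_def by (subst sum.delta) auto

lemma points_quadrics:
  "p \<in> points 4 quadI \<longleftrightarrow>
     (\<exists>i\<le>4. p i \<noteq> 0) \<and> p 0 ^ 2 + p 1 * p 4 = p 2 ^ 2 \<and> p 0 * p 4 + p 1 ^ 2 = p 3 ^ 2"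
proof -
  have "(\<forall>F\<in>quadI. eval_poly of_rat p F = 0)
      \<longleftrightarrow> eval_poly of_rat p quadric1 = 0 \<and> eval_poly of_rat p quadric2 = 0"
    (is "?L \<longleftrightarrow> ?R")
  proof
    assume ?L
    then show ?R by (simp add: quadrics_ideal_kernel generic_value_quadrics quadric_polys)
  next
    assume ?R
    then show ?L by (auto simp: quadrics_ideal_eq cplx.eval_simps)
  qed
  then show ?thesis
    by (simp add: points_def quadric1_def quadric2_def cplx.eval_simps)
qed

text \<open>The rows of the Jacobian matrix of the two quadrics.\<close>

lemma partial_deriv_quadrics:
  "partial_deriv 0 quadric1 = 2 * Var 0" "partial_deriv 1 quadric1 = Var 4"
  "partial_deriv 2 quadric1 = - (2 * Var 2)" "partial_deriv 3 quadric1 = 0"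
  "partial_deriv 4 quadric1 = Var 1"
  "partial_deriv 0 quadric2 = Var 4" "partial_deriv 1 quadric2 = 2 * Var 1"
  "partial_deriv 2 quadric2 = 0" "partial_deriv 3 quadric2 = - (2 * Var 3)"
  "partial_deriv 4 quadric2 = Var 0"
  by (simp_all add: quadric1_def quadric2_def power2_eq_square partial_deriv_add partial_deriv_diff
      partial_deriv_mult partial_deriv_Var)

lemma jacobian_independent:
  fixes x y u v z a b :: "'a::field_char_0"
  assumes "x ^ 2 + y * z = u ^ 2" "x * z + y ^ 2 = v ^ 2"
    and "x \<noteq> 0 \<or> y \<noteq> 0 \<or> u \<noteq> 0 \<or> v \<noteq> 0 \<or> z \<noteq> 0"
    and eqs: "2 * a * x + b * z = 0" "a * z + 2 * b * y = 0" "a * u = 0" "b * v = 0" "a * y + b * x = 0"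
  shows "a = 0 \<and> b = 0"
proof (rule ccontr)
  assume "\<not> (a = 0 \<and> b = 0)"
  then consider "a \<noteq> 0" "b \<noteq> 0" | "a = 0" "b \<noteq> 0" | "a \<noteq> 0" "b = 0" by blast
  then show False
  proof cases
    case 1
    then have uv: "u = 0" "v = 0" using eqs by auto
    have y: "y = - (b * x / a)" and z: "z = - (2 * a * x / b)"
      using eqs(1,5) 1 by (simp_all add: field_simps eq_neg_iff_add_eq_0)
    have "y * z = 2 * x ^ 2" using 1 by (simp add: y z power2_eq_square)
    then have "3 * x ^ 2 = 0" using assms(1) uv by simp
    then have "x = 0" by simp
    then show False using uv y z assms(3) by simp
  qed (use assms in auto)
qed

lemma quadrics_smooth: "smooth_variety 4 quadI 2"
  unfolding smooth_variety_def
proof (intro conjI ballI quadrics_variety quadrics_geometrically_integral exI[of _ 4] quadrics_dim_degree)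
  fix p assume p: "p \<in> points 4 quadI"
  let ?G = "{gradient 4 F p | F. F \<in> quadI}"
  let ?g1 = "gradient 4 quadric1 p" and ?g2 = "gradient 4 quadric2 p"
  have q: "quadric1 \<in> (quadI :: rat mpoly set)" "quadric2 \<in> (quadI :: rat mpoly set)"
    by (simp_all add: quadrics_ideal_kernel generic_value_quadrics quadric_polys)
  have indep: "a = 0 \<and> b = 0"
    if "Poly_Mapping.map ((*) a) ?g1 + Poly_Mapping.map ((*) b) ?g2 = 0" for a b
  proof -
    have l: "a * eval_poly of_rat p (partial_deriv i quadric1)
        + b * eval_poly of_rat p (partial_deriv i quadric2) = 0" if "i \<le> 4" for i
      using arg_cong[OF \<open>_ + _ = 0\<close>, of "\<lambda>g. lookup g i"] that
      by (simp add: lookup_add lookup_map_mult lookup_gradient)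
    have "\<exists>i\<in>{..4}. p i \<noteq> 0" using p by (auto simp: points_quadrics)
    then have "p 0 \<noteq> 0 \<or> p 1 \<noteq> 0 \<or> p 2 \<noteq> 0 \<or> p 3 \<noteq> 0 \<or> p 4 \<noteq> 0"
      unfolding atMost_4 by auto
    with l[of 0] l[of 1] l[of 2] l[of 3] l[of 4] p
      jacobian_independent[of "p 0" "p 1" "p 4" "p 2" "p 3" a b]
    show ?thesis
      by (simp add: partial_deriv_quadrics cplx.eval_simps points_quadrics mult_ac del: One_nat_def)
  qed
  have ne: "?g1 \<noteq> ?g2"
  proof
    assume "?g1 = ?g2"
    then have "Poly_Mapping.map ((*) 1) ?g1 + Poly_Mapping.map ((*) (- 1)) ?g2 = 0"
      by (intro poly_mapping_eqI) (simp add: lookup_add lookup_map_mult)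
    from indep[OF this] show False by simp
  qed
  have "vec.dim ?G = 2"
  proof (rule vec.dim_unique[of "{?g1, ?g2}"])
    show "{?g1, ?g2} \<subseteq> ?G" using q by blast
    show "?G \<subseteq> vec.span {?g1, ?g2}"
    proof
      fix g assume "g \<in> ?G"
      then obtain a b where g: "g = gradient 4 (a * quadric1 + b * quadric2) p"
        unfolding quadrics_ideal_eq by blast
      have "eval_poly of_rat p quadric1 = 0" "eval_poly of_rat p quadric2 = 0"
        using p q by (auto simp: points_def)
      then have "g = Poly_Mapping.map ((*) (eval_poly of_rat p a)) ?g1
          + Poly_Mapping.map ((*) (eval_poly of_rat p b)) ?g2"
        by (intro poly_mapping_eqI)
           (simp add: g lookup_gradient lookup_add lookup_map_mult partial_deriv_add partial_deriv_mult
             cplx.eval_simps)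
      then show "g \<in> vec.span {?g1, ?g2}"
        by (simp add: vec.span_add vec.span_scale vec.span_base)
    qed
    show "\<not> vec.dependent {?g1, ?g2}"
      by (rule vec.independent_if_scalars_zero) (use indep ne in auto)
    show "card {?g1, ?g2} = 2" using ne by simp
  qed
  then show "vec.dim ?G + 2 = 4" by simp
qed

section \<open>Quotients of forms\<close>

abbreviation frac :: "rat mpoly \<Rightarrow> rat mpoly \<Rightarrow> rat mpoly fract" where
  "frac \<equiv> Fraction_Field.Fract"

text \<open>
  The quotients of forms of the same degree with denominators in a given set. Function fields and
  local rings of points are the cases of the complement of an ideal and of the forms that do not
  vanish at a point.
\<close>

definition fracs :: "nat \<Rightarrow> rat mpoly set \<Rightarrow> rat mpoly fract set" where
  "fracs n U = {frac F G | F G d. F \<in> forms n d \<and> G \<in> forms n d \<and> G \<in> U}"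

lemma rat_fun_fracs: "rat_fun n I = fracs n (- I)"
  by (simp add: rat_fun_def fracs_def)

lemma local_ring_fracs: "local_ring n p = fracs n {G. eval_poly of_rat p G \<noteq> 0}"
  by (simp add: local_ring_def fracs_def)

lemma fracsI: "F \<in> forms n d \<Longrightarrow> G \<in> forms n d \<Longrightarrow> G \<in> U \<Longrightarrow> frac F G \<in> fracs n U"
  unfolding fracs_def by blast

lemma fracsE:
  assumes "f \<in> fracs n U"
  obtains F G d where "f = frac F G" "F \<in> forms n d" "G \<in> forms n d" "G \<in> U"
  using assms unfolding fracs_def by blast

lemma fracs_mono: "U \<subseteq> V \<Longrightarrow> fracs n U \<subseteq> fracs n V"
  unfolding fracs_def by blast

text \<open>Sets of denominators for which the quotients of forms are a ring.\<close>

locale denominators =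
  fixes n :: nat and U :: "rat mpoly set"
  assumes one_mem: "1 \<in> U" and zero_notin: "0 \<notin> U"
    and mult_mem: "p \<in> polys n \<Longrightarrow> q \<in> polys n \<Longrightarrow> p \<in> U \<Longrightarrow> q \<in> U \<Longrightarrow> p * q \<in> U"
begin

lemma fracs_form0: "F \<in> forms n 0 \<Longrightarrow> to_fract F \<in> fracs n U"
  unfolding to_fract_def by (rule fracsI[of _ _ 0]) (auto simp: one_mem)

lemma fracs_0: "0 \<in> fracs n U"
  using fracs_form0[of 0] by (simp add: to_fract_simps)

lemma fracs_1: "1 \<in> fracs n U"
  using fracs_form0[of 1] by (simp add: to_fract_simps)

lemma fracs_add:
  assumes "f \<in> fracs n U" "g \<in> fracs n U" shows "f + g \<in> fracs n U"
proof -
  obtain F G d where f: "f = frac F G" "F \<in> forms n d" "G \<in> forms n d" "G \<in> U"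
    using assms(1) by (rule fracsE)
  obtain F' G' d' where g: "g = frac F' G'" "F' \<in> forms n d'" "G' \<in> forms n d'" "G' \<in> U"
    using assms(2) by (rule fracsE)
  have nz: "G \<noteq> 0" "G' \<noteq> 0" using f g zero_notin by auto
  have "F * G' + F' * G \<in> forms n (d + d')"
    by (intro forms_add forms_mult f g forms_mult'[OF g(2) f(3)]) simp
  moreover have "G * G' \<in> forms n (d + d')" by (intro forms_mult f g)
  moreover have "G * G' \<in> U" using f g forms_polys by (intro mult_mem) auto
  ultimately have "frac (F * G' + F' * G) (G * G') \<in> fracs n U" by (rule fracsI)
  then show ?thesis using nz by (simp add: f(1) g(1))
qed

lemma fracs_mult:
  assumes "f \<in> fracs n U" "g \<in> fracs n U" shows "f * g \<in> fracs n U"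
proof -
  obtain F G d where f: "f = frac F G" "F \<in> forms n d" "G \<in> forms n d" "G \<in> U"
    using assms(1) by (rule fracsE)
  obtain F' G' d' where g: "g = frac F' G'" "F' \<in> forms n d'" "G' \<in> forms n d'" "G' \<in> U"
    using assms(2) by (rule fracsE)
  have "G * G' \<in> U" using f g forms_polys by (intro mult_mem) auto
  with forms_mult[OF f(2) g(2)] forms_mult[OF f(3) g(3)]
  have "frac (F * F') (G * G') \<in> fracs n U" by (rule fracsI)
  then show ?thesis by (simp add: f(1) g(1))
qed

lemma fracs_uminus:
  assumes "f \<in> fracs n U" shows "- f \<in> fracs n U"
proof -
  obtain F G d where f: "f = frac F G" "F \<in> forms n d" "G \<in> forms n d" "G \<in> U"
    using assms(1) by (rule fracsE)
  from fracsI[OF forms_uminus[OF f(2)] f(3,4)] show ?thesis by (simp add: f(1))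
qed

lemma fracs_diff: "f \<in> fracs n U \<Longrightarrow> g \<in> fracs n U \<Longrightarrow> f - g \<in> fracs n U"
  using fracs_add[OF _ fracs_uminus] by fastforce

lemma fracs_power: "f \<in> fracs n U \<Longrightarrow> f ^ k \<in> fracs n U"
  by (induction k) (auto intro: fracs_1 fracs_mult)

lemma fracs_of_nat: "of_nat k \<in> fracs n U"
  by (induction k) (auto intro: fracs_0 fracs_1 fracs_add)

lemma fracs_numeral: "numeral k \<in> fracs n U"
  using fracs_of_nat[of "numeral k"] by simp

lemma fracs_sum: "(\<And>i. i \<in> S \<Longrightarrow> f i \<in> fracs n U) \<Longrightarrow> sum f S \<in> fracs n U"
  by (induction S rule: infinite_finite_induct) (auto intro: fracs_0 fracs_add)

lemmas fracs_intros = fracs_0 fracs_1 fracs_add fracs_mult fracs_uminus fracs_diff fracs_power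
  fracs_numeral

end

text \<open>Sets closed under the ring operations are closed under polynomial substitutions.\<close>

lemma eval_poly_closed:
  assumes "p \<in> polys n" "0 \<in> A" "\<And>a b. a \<in> A \<Longrightarrow> b \<in> A \<Longrightarrow> a + b \<in> A"
    "1 \<in> A" "\<And>a b. a \<in> A \<Longrightarrow> b \<in> A \<Longrightarrow> a * b \<in> A"
    "\<And>a. c a \<in> A" "\<And>i. i \<le> n \<Longrightarrow> x i \<in> A"
  shows "eval_poly c x p \<in> A"
proof -
  have sum: "sum f S \<in> A" if "\<And>i. i \<in> S \<Longrightarrow> f i \<in> A" for f and S :: "mon set"
    using that by (induction S rule: infinite_finite_induct) (auto intro: assms)
  have pow: "a ^ k \<in> A" if "a \<in> A" for a k
    using that by (induction k) (auto intro: assms)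
  have prod: "prod f S \<in> A" if "\<And>i. i \<in> S \<Longrightarrow> f i \<in> A" for f and S :: "nat set"
    using that by (induction S rule: infinite_finite_induct) (auto intro: assms)
  show ?thesis unfolding eval_poly_def
  proof (intro sum assms(5,6) prod pow)
    fix m i assume "m \<in> keys p" "i \<in> keys m"
    then have "i \<le> n" using assms(1) by (auto simp: polys_def)
    then show "x i \<in> A" by (rule assms(7))
  qed
qed

interpretation fr: scalar_hom "\<lambda>a. to_fract (Const a)" by (rule scalar_hom_fract)

lemma (in denominators) fracs_subst_poly:
  assumes "p \<in> polys m" "\<And>i. i \<le> m \<Longrightarrow> r i \<in> fracs n U"
  shows "subst_poly r p \<in> fracs n U"
  unfolding subst_poly_def
  by (rule eval_poly_closed[OF assms(1)])
     (auto intro: fracs_intros assms fracs_form0)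

lemma denominators_compl:
  assumes "primeideal I (poly_ring n)"
  shows "denominators n (- I)"
proof -
  interpret primeideal I "poly_ring n" by fact
  note I = ideal_poly_ringD[OF is_ideal]
  show ?thesis
  proof
    show "1 \<in> - I"
    proof
      assume "1 \<in> I"
      then have "p \<in> I" if "p \<in> polys n" for p using I(4)[of 1 p] that by simp
      then show False using I(1) I_notcarr by auto
    qed
    show "0 \<notin> - I" using I(2) by simp
    show "p * q \<in> - I" if "p \<in> polys n" "q \<in> polys n" "p \<in> - I" "q \<in> - I" for p q
      using that I_prime by auto
  qed
qed

lemma denominators_point:
  "denominators n {G. eval_poly of_rat p G \<noteq> (0 :: complex)}"
  by unfold_locales (auto simp: cplx.eval_simps)

interpretation X: denominators 4 "- quadI"
  by (rule denominators_compl[OF quadrics_ideal_prime])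

lemma zero_ideal_prime: "primeideal ({0} :: 'k::field mpoly set) (poly_ring n)"
proof (rule primeidealI[OF _ poly_ring_cring])
  show "ideal ({0} :: 'k mpoly set) (poly_ring n)" by (rule ideal_poly_ringI) simp_all
  have "(1 :: 'k mpoly) \<in> polys n" "(1 :: 'k mpoly) \<notin> {0}" by simp_all
  then show "carrier (poly_ring n) \<noteq> ({0} :: 'k mpoly set)" unfolding poly_ring_simps by metis
qed simp

lemma projective_space_variety: "projective_variety n {0}"
  unfolding projective_variety_def homogeneous_ideal_def
proof (intro conjI zero_ideal_prime)
  show "ideal {0} (poly_ring n :: rat mpoly ring)"
    using zero_ideal_prime by (rule primeideal.axioms(1))
  show "\<not> Var ` {..n} \<subseteq> {0 :: rat mpoly}" by auto
qed (auto simp: hom_part_def)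

interpretation P: denominators n "- {0}" for n
  by (rule denominators_compl[OF zero_ideal_prime])

section \<open>Values of rational functions at the generic point\<close>

text \<open>
  The fractions with a denominator that does not vanish on the surface have a value at the generic
  point. Among them, the null functions are those with value 0, so that two elements of
  \<open>rat_fun 4 quadI\<close> represent the same rational function if and only if their values agree. Outside
  of \<open>regs\<close>, the function \<open>fval\<close> is not used.
\<close>

definition regs :: "rat mpoly fract set" where
  "regs = {frac F G | F G. F \<in> polys 4 \<and> G \<in> polys 4 \<and> gval G \<noteq> 0}"

definition fval :: "rat mpoly fract \<Rightarrow> rat big_field" where
  "fval f = (THE w. \<exists>F G. f = frac F G \<and> gval G \<noteq> 0 \<and> w = gval F / gval G)"

lemma fval_Fract:
  assumes "gval G \<noteq> 0" shows "fval (frac F G) = gval F / gval G"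
  unfolding fval_def
proof (rule the_equality)
  show "\<exists>F' G'. frac F G = frac F' G' \<and> gval G' \<noteq> 0 \<and>
          gval F / gval G = gval F' / gval G'"
    by (rule exI[of _ F], rule exI[of _ G]) (simp add: assms)
next
  fix w
  assume "\<exists>F' G'. frac F G = frac F' G' \<and> gval G' \<noteq> 0 \<and> w = gval F' / gval G'"
  then obtain F' G' where w: "frac F G = frac F' G'" "gval G' \<noteq> 0"
    "w = gval F' / gval G'" by blast
  have "G \<noteq> 0" "G' \<noteq> 0" using assms w(2) by (auto simp: generic_value_simps)
  then have "F * G' = F' * G" using w(1) by (simp add: eq_fract)
  then have "gval (F * G') = gval (F' * G)" by (rule arg_cong)
  then have "gval F * gval G' = gval F' * gval G"
    by (simp only: generic_value_simps)
  then show "w = gval F / gval G"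
    unfolding w(3) using assms w(2) by (simp add: frac_eq_eq)
qed

lemma regular_fracsE:
  assumes "f \<in> regs"
  obtains F G where "f = frac F G" "F \<in> polys 4" "G \<in> polys 4" "gval G \<noteq> 0" "G \<noteq> 0"
proof -
  obtain F G where "f = frac F G" "F \<in> polys 4" "G \<in> polys 4" "gval G \<noteq> 0"
    using assms unfolding regs_def by blast
  moreover from this have "G \<noteq> 0" by (auto simp: generic_value_simps)
  ultimately show thesis using that by blast
qed

lemma regular_fracsI:
  "F \<in> polys 4 \<Longrightarrow> G \<in> polys 4 \<Longrightarrow> gval G \<noteq> 0 \<Longrightarrow> frac F G \<in> regs"
  unfolding regs_def by blast

lemma regular_to_fract:
  assumes "F \<in> polys 4" shows "to_fract F \<in> regs" "fval (to_fract F) = gval F"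
  using assms by (auto simp: to_fract_def generic_value_simps fval_Fract intro: regular_fracsI)

lemma regular_add_mult:
  assumes "f \<in> regs" "g \<in> regs"
  shows "f + g \<in> regs \<and> fval (f + g) = fval f + fval g
    \<and> f * g \<in> regs \<and> fval (f * g) = fval f * fval g"
proof -
  obtain F G where f: "f = frac F G" "F \<in> polys 4" "G \<in> polys 4" "gval G \<noteq> 0" "G \<noteq> 0"
    using assms(1) by (rule regular_fracsE)
  obtain F' G' where g: "g = frac F' G'" "F' \<in> polys 4" "G' \<in> polys 4" "gval G' \<noteq> 0" "G' \<noteq> 0"
    using assms(2) by (rule regular_fracsE)
  have nz: "gval (G * G') \<noteq> 0" using f g by (simp add: generic_value_simps)
  have "frac (F * G' + F' * G) (G * G') \<in> regs" "frac (F * F') (G * G') \<in> regs"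
    by (intro regular_fracsI polys_add polys_mult f g nz)+
  moreover have "fval (frac (F * G' + F' * G) (G * G')) = fval f + fval g"
    unfolding f(1) g(1) fval_Fract[OF nz] fval_Fract[OF f(4)] fval_Fract[OF g(4)]
      add_frac_eq[OF f(4) g(4)] by (simp only: generic_value_simps)
  moreover have "fval (frac (F * F') (G * G')) = fval f * fval g"
    unfolding f(1) g(1) fval_Fract[OF nz] fval_Fract[OF f(4)] fval_Fract[OF g(4)]
    by (simp only: generic_value_simps times_divide_times_eq)
  moreover have "f + g = frac (F * G' + F' * G) (G * G')" "f * g = frac (F * F') (G * G')"
    unfolding f(1) g(1) using f(5) g(5) by simp_all
  ultimately show ?thesis by (simp only:)
qed

lemma regular_uminus:
  assumes "f \<in> regs"
  shows "- f \<in> regs \<and> fval (- f) = - fval f"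
proof -
  obtain F G where f: "f = frac F G" "F \<in> polys 4" "G \<in> polys 4" "gval G \<noteq> 0" "G \<noteq> 0"
    using assms(1) by (rule regular_fracsE)
  have "frac (- F) G \<in> regs" by (intro regular_fracsI polys_uminus f)
  moreover have "fval (frac (- F) G) = - fval f"
    using f by (simp add: fval_Fract generic_value_simps)
  ultimately show ?thesis using f by simp
qed

lemma regular_inverse:
  assumes "f \<in> regs" "fval f \<noteq> 0"
  shows "inverse f \<in> regs \<and> fval (inverse f) = inverse (fval f)"
proof -
  obtain F G where f: "f = frac F G" "F \<in> polys 4" "G \<in> polys 4" "gval G \<noteq> 0" "G \<noteq> 0"
    using assms(1) by (rule regular_fracsE)
  have F: "gval F \<noteq> 0" using assms(2) f by (simp add: fval_Fract)
  have "frac G F \<in> regs" by (intro regular_fracsI f F)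
  then show ?thesis using f F by (simp add: fval_Fract)
qed

lemma regular_intros:
  "0 \<in> regs" "1 \<in> regs" "numeral k \<in> regs"
  "f \<in> regs \<Longrightarrow> g \<in> regs \<Longrightarrow> f + g \<in> regs"
  "f \<in> regs \<Longrightarrow> g \<in> regs \<Longrightarrow> f - g \<in> regs"
  "f \<in> regs \<Longrightarrow> g \<in> regs \<Longrightarrow> f * g \<in> regs"
  "f \<in> regs \<Longrightarrow> - f \<in> regs"
  "f \<in> regs \<Longrightarrow> g \<in> regs \<Longrightarrow> fval g \<noteq> 0 \<Longrightarrow> f / g \<in> regs"
  "f \<in> regs \<Longrightarrow> f ^ l \<in> regs"
  and fval_simps:
  "fval 0 = 0" "fval 1 = 1" "fval (numeral k) = numeral k"
  "f \<in> regs \<Longrightarrow> g \<in> regs \<Longrightarrow> fval (f + g) = fval f + fval g"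
  "f \<in> regs \<Longrightarrow> g \<in> regs \<Longrightarrow> fval (f - g) = fval f - fval g"
  "f \<in> regs \<Longrightarrow> g \<in> regs \<Longrightarrow> fval (f * g) = fval f * fval g"
  "f \<in> regs \<Longrightarrow> fval (- f) = - fval f"
  "f \<in> regs \<Longrightarrow> g \<in> regs \<Longrightarrow> fval g \<noteq> 0 \<Longrightarrow> fval (f / g) = fval f / fval g"
  "f \<in> regs \<Longrightarrow> fval (f ^ l) = fval f ^ l"
proof -
  show 0: "0 \<in> regs" "fval 0 = 0" and 1: "1 \<in> regs" "fval 1 = 1"
    using regular_to_fract[of 0] regular_to_fract[of 1]
    by (simp_all add: to_fract_simps generic_value_simps)
  have nat: "of_nat j \<in> regs \<and> fval (of_nat j) = of_nat j" for j
    by (induction j) (use 0 1 regular_add_mult in auto)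
  from nat[of "numeral k"] show "numeral k \<in> regs" "fval (numeral k) = numeral k" by simp_all
  show "f / g \<in> regs" "fval (f / g) = fval f / fval g"
    if "f \<in> regs" "g \<in> regs" "fval g \<noteq> 0" for f g
    using regular_add_mult[OF that(1) conjunct1[OF regular_inverse[OF that(2,3)]]]
      regular_inverse[OF that(2,3)] by (simp_all add: divide_fract_def divide_inverse)
  show "f - g \<in> regs" "fval (f - g) = fval f - fval g"
    if "f \<in> regs" "g \<in> regs" for f g
    using regular_add_mult[OF that(1) conjunct1[OF regular_uminus[OF that(2)]]]
      regular_uminus[OF that(2)] by simp_all
  have "f ^ l \<in> regs \<and> fval (f ^ l) = fval f ^ l" if "f \<in> regs" for f l
    by (induction l) (use that 1 regular_add_mult in auto)
  then show "f ^ l \<in> regs" "fval (f ^ l) = fval f ^ l" if "f \<in> regs" for f l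
    using that by simp_all
qed (simp_all add: regular_add_mult regular_uminus)

lemma rat_fun_regular: "f \<in> rat_fun 4 quadI \<Longrightarrow> f \<in> regs"
  unfolding rat_fun_fracs
  by (erule fracsE) (auto intro!: regular_fracsI simp: quadrics_ideal_kernel dest: forms_polys)

abbreviation null4 :: "rat mpoly fract set" where
  "null4 \<equiv> null_fun 4 quadI"

lemma null_fun_iff: "f \<in> null4 \<longleftrightarrow> f \<in> regs \<and> fval f = 0"
proof
  assume "f \<in> null4"
  then obtain F G where "f = frac F G" "F \<in> quadI" "G \<in> polys 4" "G \<notin> quadI"
    unfolding null_fun_def by blast
  then show "f \<in> regs \<and> fval f = 0"
    by (auto simp: quadrics_ideal_kernel fval_Fract intro: regular_fracsI)
next
  assume f: "f \<in> regs \<and> fval f = 0"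
  then obtain F G where "f = frac F G" "F \<in> polys 4" "G \<in> polys 4" "gval G \<noteq> 0"
    using regular_fracsE by blast
  moreover from this have "gval F = 0" using f by (simp add: fval_Fract)
  ultimately show "f \<in> null4"
    unfolding null_fun_def using quadrics_ideal_kernel by blast
qed

lemma null_fun_diff_iff:
  "f \<in> regs \<Longrightarrow> g \<in> regs \<Longrightarrow> f - g \<in> null4 \<longleftrightarrow> fval f = fval g"
  by (simp add: null_fun_iff regular_intros fval_simps)

lemma null_fun_space: "null_fun n {0} = {0}"
proof
  show "null_fun n {0} \<subseteq> {0}" by (auto simp: null_fun_def Zero_fract_def eq_fract)
  show "{0} \<subseteq> null_fun n {0}"
    using polys_1[of n, where 'a = rat]
    by (auto simp: null_fun_def Zero_fract_def intro!: exI[of _ 0] exI[of _ 1])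
qed

lemma regular_eval_poly:
  assumes "p \<in> polys n" "\<And>i. i \<le> n \<Longrightarrow> r i \<in> regs"
  shows "subst_poly r p \<in> regs"
    "fval (subst_poly r p) = eval_poly (\<lambda>a. embed (Const a)) (\<lambda>i. fval (r i)) p"
proof -
  have C: "to_fract (Const a) \<in> regs" "fval (to_fract (Const a)) = embed (Const a)" for a
    using regular_to_fract[OF polys_Const[of a]] by (simp_all add: generic_value_simps)
  show "subst_poly r p \<in> regs"
    unfolding subst_poly_def
    by (rule eval_poly_closed[OF assms(1)]) (simp_all add: regular_intros assms C)
  have mon: "mon_val r m \<in> regs \<and> fval (mon_val r m) = mon_val (\<lambda>i. fval (r i)) m"
    if "keys m \<subseteq> {..n}" for m
  proof -
    have "(\<Prod>i\<in>S. r i ^ f i) \<in> regs \<and> fval (\<Prod>i\<in>S. r i ^ f i) = (\<Prod>i\<in>S. fval (r i) ^ f i)"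
      if "finite S" "S \<subseteq> {..n}" for S f
      using that
    proof (induction S rule: finite_induct)
      case (insert i S)
      then have "r i ^ f i \<in> regs \<and> fval (r i ^ f i) = fval (r i) ^ f i"
        using assms(2) by (simp add: regular_intros fval_simps)
      then show ?case using insert regular_add_mult by simp
    qed (simp add: regular_intros fval_simps)
    from this[OF finite_keys that, of "lookup m"] show ?thesis
      unfolding mon_val_def .
  qed
  have "subst_poly r p \<in> regs \<and>
      fval (subst_poly r p) = eval_poly (\<lambda>a. embed (Const a)) (\<lambda>i. fval (r i)) p"
    unfolding subst_poly_def
  proof (rule poly_mapping_additive_induct[where p = p])
    fix m assume "m \<in> keys p"
    then have "keys m \<subseteq> {..n}" using assms(1) by (auto simp: polys_def)
    then show "eval_poly (\<lambda>a. to_fract (Const a)) r (single m (lookup p m)) \<in> regs \<and>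
        fval (eval_poly (\<lambda>a. to_fract (Const a)) r (single m (lookup p m)))
          = eval_poly (\<lambda>a. embed (Const a)) (\<lambda>i. fval (r i)) (single m (lookup p m))"
      by (simp add: fr.eval_single gen.eval_single regular_intros fval_simps mon C)
  qed (auto simp: fr.eval_add gen.eval_add regular_intros fval_simps)
  then show "fval (subst_poly r p) = eval_poly (\<lambda>a. embed (Const a)) (\<lambda>i. fval (r i)) p" by simp
qed

section \<open>Derivations of the function field\<close>

instance fract :: ("{idom, ring_char_0}") field_char_0
proof
  show "inj (of_nat :: nat \<Rightarrow> 'a fract)"
    by (rule injI) (simp add: of_nat_fract eq_fract)
qed

text \<open>Representatives of the elements of the function field of the surface.\<close>

abbreviation coord_field :: "rat mpoly fract set" where
  "coord_field \<equiv> rat_fun 4 quadI"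

lemma generic_point_nonzero_le: "i \<le> 4 \<Longrightarrow> gpt i \<noteq> (0 :: rat big_field)"
proof -
  assume "i \<le> 4"
  then have "i \<in> {0, 1, 2, 3, 4}" using atMost_4 by (metis atMost_iff)
  then show ?thesis using generic_point_nonzero[where 'a = rat] by auto
qed

lemma Var_notin_ideal: "i \<le> 4 \<Longrightarrow> Var i \<notin> (quadI :: rat mpoly set)"
  by (simp add: quadrics_ideal_kernel generic_value_simps generic_point_nonzero_le)

lemma affine_coord_rat_fun:
  assumes "i \<le> 4" "k \<le> 4" shows "affine_coord k i \<in> coord_field"
  unfolding affine_coord_def rat_fun_fracs
  by (rule fracsI[OF forms_Var forms_Var]) (use assms Var_notin_ideal in auto)

lemma affine_coord_regular: "i \<le> 4 \<Longrightarrow> k \<le> 4 \<Longrightarrow> affine_coord k i \<in> regs"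
  by (rule rat_fun_regular[OF affine_coord_rat_fun])

lemma fval_affine_coord: "k \<le> 4 \<Longrightarrow> fval (affine_coord k i) = gpt i / gpt k"
  by (simp add: affine_coord_def fval_Fract generic_value_simps generic_point_nonzero_le)

lemmas coord_field_intros = X.fracs_intros[folded rat_fun_fracs]

lemma rat_fun_Const: "to_fract (Const a) \<in> coord_field"
  unfolding rat_fun_fracs by (rule X.fracs_form0) simp

text \<open>
  The derivative of a rational function, as an element of the big field. On representatives of
  rational functions, a derivation is additive and satisfies the Leibniz rule only up to null
  functions; for the values \<open>dval\<close>, both hold exactly.
\<close>

definition dval :: "(rat mpoly fract \<Rightarrow> rat mpoly fract) \<Rightarrow> rat mpoly fract \<Rightarrow> rat big_field" where
  "dval D f = fval (D f)"

abbreviation dcoord :: "(rat mpoly fract \<Rightarrow> rat mpoly fract) \<Rightarrow> nat \<Rightarrow> nat \<Rightarrow> rat big_field" where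
  "dcoord D i j \<equiv> dval D (affine_coord i j)"

abbreviation deriv4 :: "(rat mpoly fract \<Rightarrow> rat mpoly fract) \<Rightarrow> bool" where
  "deriv4 \<equiv> derivation 4 quadI"

lemma deriv4_regular: "deriv4 D \<Longrightarrow> f \<in> coord_field \<Longrightarrow> D f \<in> regs"
  unfolding derivation_def by (blast intro: rat_fun_regular)

lemma dval_add:
  assumes "deriv4 D" "f \<in> coord_field" "g \<in> coord_field"
  shows "dval D (f + g) = dval D f + dval D g"
proof -
  have "D (f + g) - (D f + D g) \<in> null4"
    using assms unfolding derivation_def by blast
  moreover have "D f \<in> regs" "D g \<in> regs" "D (f + g) \<in> regs"
    using assms by (simp_all add: deriv4_regular coord_field_intros)
  ultimately have "fval (D (f + g)) = fval (D f + D g)"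
    by (simp add: null_fun_diff_iff regular_intros)
  then show ?thesis using assms by (simp add: dval_def fval_simps deriv4_regular)
qed

lemma dval_mult:
  assumes "deriv4 D" "f \<in> coord_field" "g \<in> coord_field"
  shows "dval D (f * g) = fval f * dval D g + fval g * dval D f"
proof -
  have "D (f * g) - (f * D g + g * D f) \<in> null4"
    using assms unfolding derivation_def by blast
  moreover have "D f \<in> regs" "D g \<in> regs" "D (f * g) \<in> regs"
    "f \<in> regs" "g \<in> regs"
    using assms by (simp_all add: deriv4_regular coord_field_intros rat_fun_regular)
  ultimately have "fval (D (f * g)) = fval (f * D g + g * D f)"
    by (simp add: null_fun_diff_iff regular_intros)
  then show ?thesis
    using assms by (simp add: dval_def fval_simps regular_intros deriv4_regular rat_fun_regular)
qed

lemma dval_0: "deriv4 D \<Longrightarrow> dval D 0 = 0"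
  using dval_add[of D 0 0] by (simp add: coord_field_intros)

lemma dval_1: "deriv4 D \<Longrightarrow> dval D 1 = 0"
  using dval_mult[of D 1 1] by (simp add: coord_field_intros fval_simps)

lemma dval_uminus:
  assumes "deriv4 D" "f \<in> coord_field" shows "dval D (- f) = - dval D f"
  using dval_add[OF assms(1), of f "- f"] assms
  by (simp add: coord_field_intros dval_0 add_eq_0_iff)

lemma dval_cong:
  assumes "deriv4 D" "f \<in> coord_field" "g \<in> coord_field" "fval f = fval g"
  shows "dval D f = dval D g"
proof -
  have "f - g \<in> null4"
    using assms by (simp add: null_fun_diff_iff rat_fun_regular)
  moreover have m: "f - g \<in> coord_field" using assms coord_field_intros by simp
  ultimately have "D (f - g) \<in> null4"
    using assms(1) unfolding derivation_def by simp
  then have "dval D (f - g) = 0" by (simp add: dval_def null_fun_iff)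
  then show ?thesis using dval_add[OF assms(1) m assms(3)] by simp
qed

lemma dval_Const:
  assumes D: "deriv4 D" shows "dval D (to_fract (Const a)) = 0"
proof -
  let ?c = "\<lambda>a. to_fract (Const a)"
  have nat: "dval D (?c (of_nat k)) = 0" for k
  proof (induction k)
    case (Suc k)
    have "?c (of_nat (Suc k)) = ?c 1 + ?c (of_nat k)" by (simp add: fr.hom_add)
    then show ?case
      using Suc dval_add[OF D rat_fun_Const rat_fun_Const, of 1 "of_nat k"] dval_1[OF D]
      by (simp add: fr.hom_one)
  qed (simp add: to_fract_simps dval_0[OF D])
  have int: "dval D (?c (of_int k)) = 0" for k
  proof (cases k rule: int_cases2)
    case (nonneg n)
    then show ?thesis using nat[of n] by simp
  next
    case (nonpos n)
    then show ?thesis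
      using nat[of n] dval_uminus[OF D rat_fun_Const, of "of_nat n"] by (simp add: fr.hom_minus)
  qed
  obtain k l :: int where kl: "a = of_int k / of_int l" "l \<noteq> 0"
    by (metis quotient_of_div quotient_of_denom_pos' less_irrefl prod.collapse)
  have "?c (of_int l) * ?c a = ?c (of_int k)"
    using kl by (simp flip: fr.hom_mult)
  then have "fval (?c (of_int l)) * dval D (?c a) + fval (?c a) * dval D (?c (of_int l)) = 0"
    using dval_mult[OF D rat_fun_Const rat_fun_Const, of "of_int l" a] int[of k] by simp
  moreover have "fval (?c (of_int l)) \<noteq> 0"
  proof -
    have "lookup (Const (of_int l :: rat)) 0 = of_int l"
      unfolding Const_def lookup_single by simp
    then have "Const (of_int l :: rat) \<noteq> 0" using kl(2) by (metis lookup_zero of_int_eq_0_iff)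
    then show ?thesis
      by (simp only: regular_to_fract(2)[OF polys_Const] generic_value_simps embed_eq_0_iff
          not_False_eq_True)
  qed
  ultimately show ?thesis using int[of l] by simp
qed

text \<open>The chain rule for polynomials in elements of the function field.\<close>

lemma dval_subst_poly:
  assumes D: "deriv4 D" and x: "\<And>i. i \<le> 4 \<Longrightarrow> x i \<in> coord_field" and p: "p \<in> polys 4"
  shows "dval D (subst_poly x p) =
    (\<Sum>j\<le>4. eval_poly (\<lambda>a. embed (Const a)) (\<lambda>i. fval (x i)) (partial_deriv j p) * dval D (x j))"
proof -
  let ?e = "eval_poly (\<lambda>a. embed (Const a)) (\<lambda>i. fval (x i))"
  define A where "A = {p \<in> polys 4. dval D (subst_poly x p) =
      (\<Sum>j\<le>4. ?e (partial_deriv j p) * dval D (x j))}"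
  have mem: "subst_poly x q \<in> coord_field" if "q \<in> polys 4" for q
    unfolding rat_fun_fracs
    by (rule X.fracs_subst_poly[OF that]) (use x in \<open>simp add: rat_fun_fracs\<close>)
  have val: "fval (subst_poly x q) = ?e q" if "q \<in> polys 4" for q
    by (rule regular_eval_poly[OF that]) (use x rat_fun_regular in simp)
  have C: "Const a \<in> A" for a
    by (simp add: A_def subst_poly_def fr.eval_Const dval_Const[OF D])
  have "eval_poly Const Var p \<in> A"
  proof (rule eval_poly_closed[OF p])
    show "0 \<in> A" "1 \<in> A" using C[of 0] C[of 1] by (simp_all add: Const_1)
    show "Var i \<in> A" if "i \<le> 4" for i
      using that by (simp add: A_def subst_poly_def fr.eval_Var partial_deriv_Var if_distrib
          if_distribR gen.eval_1 sum.delta cong: if_cong)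
  next
    fix q r assume "q \<in> A" "r \<in> A"
    then have q: "q \<in> polys 4" "dval D (subst_poly x q) = (\<Sum>j\<le>4. ?e (partial_deriv j q) * dval D (x j))"
      and r: "r \<in> polys 4" "dval D (subst_poly x r) = (\<Sum>j\<le>4. ?e (partial_deriv j r) * dval D (x j))"
      by (simp_all add: A_def)
    have "subst_poly x (q + r) = subst_poly x q + subst_poly x r"
      "subst_poly x (q * r) = subst_poly x q * subst_poly x r"
      by (simp_all add: subst_poly_def fr.eval_add fr.eval_mult)
    then have "dval D (subst_poly x (q + r)) = dval D (subst_poly x q) + dval D (subst_poly x r)"
      "dval D (subst_poly x (q * r)) = ?e q * dval D (subst_poly x r) + ?e r * dval D (subst_poly x q)"
      using dval_add[OF D mem[OF q(1)] mem[OF r(1)]] dval_mult[OF D mem[OF q(1)] mem[OF r(1)]]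
        val q(1) r(1) by simp_all
    then show "q + r \<in> A" "q * r \<in> A"
      using q r by (simp_all add: A_def polys_add polys_mult partial_deriv_add partial_deriv_mult
          gen.eval_add gen.eval_mult distrib_right distrib_left sum.distrib sum_distrib_left mult_ac add_ac)
  qed (rule C)
  then show ?thesis by (simp add: eval_Const_Var A_def)
qed

subsection \<open>Derivatives in an affine chart\<close>

lemma eval_chart:
  assumes "F \<in> forms 4 d" "i \<le> 4"
  shows "eval_poly (\<lambda>a. embed (Const a)) (\<lambda>j. fval (affine_coord i j)) F
           = gval F / gpt i ^ d"
proof -
  have "(\<lambda>j. fval (affine_coord i j)) = (\<lambda>j. (1 / gpt i) * gpt j)"
    using assms(2) by (auto simp: fval_affine_coord)
  then show ?thesis
    using gen.eval_form_scale[OF assms(1), of "1 / gpt i" gpt]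
    by (simp add: gval_def power_divide)
qed

lemma eval_chart_deriv:
  assumes "F \<in> forms 4 d" "i \<le> 4"
  shows "eval_poly (\<lambda>a. embed (Const a)) (\<lambda>j. fval (affine_coord i j)) (partial_deriv k F)
           = gval (partial_deriv k F) * gpt i / gpt i ^ d"
  using eval_chart[OF partial_deriv_forms[OF assms, of k] assms(2)] assms(2)
  by (simp add: gen.eval_mult gen.eval_Var fval_affine_coord generic_point_nonzero_le generic_value_simps)

lemma dval_chart_self: "deriv4 D \<Longrightarrow> i \<le> 4 \<Longrightarrow> dcoord D i i = 0"
  using dval_cong[OF _ affine_coord_rat_fun coord_field_intros(2), of D i i] dval_1[of D]
  by (simp add: fval_affine_coord generic_point_nonzero_le fval_simps)

text \<open>The differentials of the affine coordinates satisfy the differentiated equations.\<close>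

lemma dval_chart_relation:
  assumes D: "deriv4 D" and i: "i \<le> 4" and Q: "Q \<in> forms 4 2" "gval Q = 0"
  shows "(\<Sum>j\<le>4. gval (partial_deriv j Q) * dcoord D i j) = 0"
proof -
  let ?g = "gpt i :: rat big_field"
  have g: "?g \<noteq> 0" by (rule generic_point_nonzero_le[OF i])
  have Qp: "Q \<in> polys 4" using Q(1) by (rule forms_polys)
  have x: "affine_coord i j \<in> coord_field" if "j \<le> 4" for j
    by (rule affine_coord_rat_fun[OF that i])
  have mem: "subst_poly (affine_coord i) Q \<in> coord_field"
    unfolding rat_fun_fracs
    by (rule X.fracs_subst_poly[OF Qp]) (use x in \<open>simp add: rat_fun_fracs\<close>)
  have "fval (subst_poly (affine_coord i) Q) = 0"
    using regular_eval_poly(2)[OF Qp rat_fun_regular[OF x]] eval_chart[OF Q(1) i] Q(2) by simp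
  then have "dval D (subst_poly (affine_coord i) Q) = 0"
    using dval_cong[OF D mem coord_field_intros(1)] dval_0[OF D] by (simp add: fval_simps)
  then have "(\<Sum>j\<le>4. gval (partial_deriv j Q) * ?g / ?g ^ 2 * dcoord D i j) = 0"
    using dval_subst_poly[OF D x Qp] eval_chart_deriv[OF Q(1) i] by simp
  then have "?g * (\<Sum>j\<le>4. gval (partial_deriv j Q) * ?g / ?g ^ 2 * dcoord D i j) = 0"
    by simp
  then show ?thesis using g by (simp add: sum_distrib_left power2_eq_square)
qed

lemma dval_chart_relations:
  assumes D: "deriv4 D" and i: "i \<le> 4"
  defines "d \<equiv> \<lambda>j. dcoord D i j"
  shows "2 * gpt 0 * d 0 + gpt 4 * d 1 + gpt 1 * d 4 = 2 * gpt 2 * d 2"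
    "gpt 4 * d 0 + 2 * gpt 1 * d 1 + gpt 0 * d 4 = 2 * gpt 3 * d 3"
  using dval_chart_relation[OF D i quadric_forms(1) generic_value_quadrics(1)]
    dval_chart_relation[OF D i quadric_forms(2) generic_value_quadrics(2)]
  unfolding atMost_4
  by (simp_all add: partial_deriv_quadrics generic_value_simps d_def algebra_simps del: One_nat_def)

lemma point_not_ideal:
  assumes "p \<in> points 4 quadI" "G \<in> polys 4" "eval_poly of_rat p G \<noteq> 0"
  shows "gval G \<noteq> 0"
  using assms by (auto simp: points_def quadrics_ideal_kernel)

lemma local_ring_rat_fun:
  assumes "p \<in> points 4 quadI" "f \<in> local_ring 4 p" shows "f \<in> coord_field"
proof -
  have "{G. eval_poly of_rat p G \<noteq> 0} \<subseteq> - quadI"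
    using assms(1) by (auto simp: points_def)
  from fracs_mono[OF this] show ?thesis
    using assms(2) unfolding local_ring_fracs rat_fun_fracs by blast
qed

text \<open>The derivative of an element of a local ring, in terms of the coordinates of a chart.\<close>

lemma dval_local_ring:
  assumes p: "p \<in> points 4 quadI" and i: "i \<le> 4" and f: "f \<in> local_ring 4 p"
  shows "\<exists>c. (\<forall>j\<le>4. c j \<in> local_ring 4 p) \<and>
    (\<forall>D. deriv4 D \<longrightarrow> dval D f = (\<Sum>j\<le>4. fval (c j) * dcoord D i j))"
proof -
  obtain F G d where FG: "f = frac F G" "F \<in> forms 4 d" "G \<in> forms 4 d" "eval_poly of_rat p G \<noteq> 0"
    using f unfolding local_ring_def by blast
  have polys: "F \<in> polys 4" "G \<in> polys 4" using FG forms_polys by blast+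
  have G: "gval G \<noteq> 0" by (rule point_not_ideal[OF p polys(2) FG(4)])
  let ?g = "gpt i :: rat big_field" and ?x = "affine_coord i"
  have g: "?g \<noteq> 0" by (rule generic_point_nonzero_le[OF i])
  have fK: "f \<in> coord_field" by (rule local_ring_rat_fun[OF p f])
  have x: "?x j \<in> coord_field" if "j \<le> 4" for j by (rule affine_coord_rat_fun[OF that i])
  have mem: "subst_poly ?x H \<in> coord_field" if "H \<in> polys 4" for H
    unfolding rat_fun_fracs
    by (rule X.fracs_subst_poly[OF that]) (use x in \<open>simp add: rat_fun_fracs\<close>)
  have val: "fval (subst_poly ?x H) = gval H / ?g ^ d" if "H \<in> forms 4 d" for H
    using regular_eval_poly(2)[OF forms_polys[OF that] rat_fun_regular[OF x]] eval_chart[OF that i] by simp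
  have fv: "fval f = gval F / gval G" using G by (simp add: FG(1) fval_Fract)
  \<comment> \<open>By the quotient rule in the chart; the factor X_i makes up for the degree lost by differentiation.\<close>
  define c where "c j = frac ((partial_deriv j F * Var i) * G - F * (partial_deriv j G * Var i)) (G * G)" for j
  have c: "c j \<in> local_ring 4 p" for j
    unfolding c_def local_ring_fracs
    by (rule fracsI[of _ _ "d + d"])
       (use FG in \<open>auto intro!: forms_diff forms_mult partial_deriv_forms i simp: cplx.eval_mult\<close>)
  have cv: "fval (c j) = (gval (partial_deriv j F) * gval G
      - gval F * gval (partial_deriv j G)) * ?g / (gval G * gval G)" for j
    using G by (simp add: c_def fval_Fract generic_value_simps algebra_simps)
  have "dval D f = (\<Sum>j\<le>4. fval (c j) * dval D (?x j))" if D: "deriv4 D" for D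
  proof -
    have "fval (f * subst_poly ?x G) = fval (subst_poly ?x F)"
      unfolding fval_simps(6)[OF rat_fun_regular[OF fK] rat_fun_regular[OF mem[OF polys(2)]]]
        val[OF FG(2)] val[OF FG(3)] fv using G by simp
    then have "dval D (f * subst_poly ?x G) = dval D (subst_poly ?x F)"
      by (intro dval_cong[OF D] mem polys coord_field_intros fK)
    then have "fval f * dval D (subst_poly ?x G) + gval G / ?g ^ d * dval D f
        = dval D (subst_poly ?x F)"
      unfolding dval_mult[OF D fK mem[OF polys(2)]] val[OF FG(3)] .
    then have "gval G / ?g ^ d * dval D f
        = dval D (subst_poly ?x F) - fval f * dval D (subst_poly ?x G)"
      by (simp add: algebra_simps)
    also have "\<dots> = (\<Sum>j\<le>4. (gval (partial_deriv j F) * ?g / ?g ^ d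
        - fval f * (gval (partial_deriv j G) * ?g / ?g ^ d)) * dval D (?x j))"
      by (simp only: dval_subst_poly[OF D x polys(1)] dval_subst_poly[OF D x polys(2)]
          eval_chart_deriv[OF FG(2) i] eval_chart_deriv[OF FG(3) i] sum_distrib_left
          left_diff_distrib sum_subtractf mult.assoc)
    also have "\<dots> = (\<Sum>j\<le>4. gval G / ?g ^ d * (fval (c j) * dval D (?x j)))"
    proof (intro sum.cong refl)
      fix j
      have "gval (partial_deriv j F) * ?g / ?g ^ d
        - fval f * (gval (partial_deriv j G) * ?g / ?g ^ d) = gval G / ?g ^ d * fval (c j)"
        using G g by (simp add: cv fv field_simps)
      then show "(gval (partial_deriv j F) * ?g / ?g ^ d
        - fval f * (gval (partial_deriv j G) * ?g / ?g ^ d)) * dval D (?x j)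
        = gval G / ?g ^ d * (fval (c j) * dval D (?x j))" by simp
    qed
    also have "\<dots> = gval G / ?g ^ d * (\<Sum>j\<le>4. fval (c j) * dval D (?x j))"
      by (simp add: sum_distrib_left)
    finally show ?thesis using G g by simp
  qed
  then show ?thesis using c by blast
qed

section \<open>The canonical sheaf\<close>

lemma fval_sum:
  assumes "\<And>j. j \<in> S \<Longrightarrow> f j \<in> regs"
  shows "sum f S \<in> regs \<and> fval (sum f S) = (\<Sum>j\<in>S. fval (f j))"
  using assms
  by (induction S rule: infinite_finite_induct) (simp_all add: regular_intros fval_simps)

lemma null_fun_add:
  assumes "f \<in> null4" "g \<in> null4"
  shows "f + g \<in> null4"
  using assms by (simp add: null_fun_iff regular_intros fval_simps)

lemma d_wedge_value:
  assumes "deriv4 D" "deriv4 E" "f \<in> coord_field" "g \<in> coord_field"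
  shows "d_wedge f g D E \<in> regs"
    "fval (d_wedge f g D E) = dval D f * dval E g - dval D g * dval E f"
  using assms by (simp_all add: d_wedge_def dval_def regular_intros fval_simps deriv4_regular)

lemma affine_coord_local:
  assumes "i \<le> 4" "j \<le> 4" "p i \<noteq> 0" shows "affine_coord i j \<in> local_ring 4 p"
  unfolding affine_coord_def local_ring_fracs
  by (rule fracsI[OF forms_Var forms_Var]) (use assms in \<open>auto simp: cplx.eval_Var\<close>)

text \<open>
  The differential of \<open>f\<close> is a combination of the differentials of the coordinates X_a / X_i and
  X_b / X_i, with coefficients in the local ring at \<open>p\<close>. Both sides are compared by their values on
  all derivations.
\<close>

definition chart_span :: "(nat \<Rightarrow> complex) \<Rightarrow> nat \<Rightarrow> nat \<Rightarrow> nat \<Rightarrow> rat mpoly fract \<Rightarrow> bool" where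
  "chart_span p i a b f \<longleftrightarrow>
     (\<exists>k l. k \<in> local_ring 4 p \<and> l \<in> local_ring 4 p \<and>
       (\<forall>D. deriv4 D \<longrightarrow>
          dval D f = fval k * dcoord D i a + fval l * dcoord D i b))"

context
  fixes p :: "nat \<Rightarrow> complex"
  assumes p: "p \<in> points 4 quadI"
begin

interpretation L: denominators 4 "{G. eval_poly of_rat p G \<noteq> 0}"
  by (rule denominators_point)

lemmas local_intros = L.fracs_intros[folded local_ring_fracs]

lemma local_regular: "f \<in> local_ring 4 p \<Longrightarrow> f \<in> regs"
  by (rule rat_fun_regular[OF local_ring_rat_fun[OF p]])

lemma local_sum: "(\<And>j. j \<in> S \<Longrightarrow> f j \<in> local_ring 4 p) \<Longrightarrow> sum f S \<in> local_ring 4 p"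
  unfolding local_ring_fracs by (rule L.fracs_sum)

lemma local_frac:
  assumes "F \<in> forms 4 d" "G \<in> forms 4 d" "eval_poly of_rat p G \<noteq> 0"
  shows "frac F G \<in> local_ring 4 p" "fval (frac F G) = gval F / gval G"
    "gval G \<noteq> 0"
proof -
  show "frac F G \<in> local_ring 4 p" unfolding local_ring_def using assms by blast
  show "gval G \<noteq> 0" using point_not_ideal[OF p forms_polys[OF assms(2)] assms(3)] .
  then show "fval (frac F G) = gval F / gval G" by (rule fval_Fract)
qed

lemma chart_span_combination:
  assumes "\<And>j. j \<in> S \<Longrightarrow> chart_span p i a b (f j)" "\<And>j. j \<in> S \<Longrightarrow> c j \<in> local_ring 4 p"
    and "\<And>D. deriv4 D \<Longrightarrow> dval D g = (\<Sum>j\<in>S. fval (c j) * dval D (f j))"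
  shows "chart_span p i a b g"
proof -
  have "\<forall>j\<in>S. \<exists>kl. fst kl \<in> local_ring 4 p \<and> snd kl \<in> local_ring 4 p \<and>
      (\<forall>D. deriv4 D \<longrightarrow> dval D (f j)
         = fval (fst kl) * dcoord D i a + fval (snd kl) * dcoord D i b)"
    using assms(1) unfolding chart_span_def by simp
  from bchoice[OF this] obtain kl where kl: "\<forall>j\<in>S. fst (kl j) \<in> local_ring 4 p \<and> snd (kl j) \<in> local_ring 4 p \<and>
      (\<forall>D. deriv4 D \<longrightarrow> dval D (f j)
         = fval (fst (kl j)) * dcoord D i a + fval (snd (kl j)) * dcoord D i b)" ..
  define k where "k = (\<Sum>j\<in>S. c j * fst (kl j))"
  define l where "l = (\<Sum>j\<in>S. c j * snd (kl j))"
  have loc: "k \<in> local_ring 4 p" "l \<in> local_ring 4 p"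
    unfolding k_def l_def by (intro local_sum local_intros; use kl assms(2) in simp)+
  have val: "fval k = (\<Sum>j\<in>S. fval (c j) * fval (fst (kl j)))"
    "fval l = (\<Sum>j\<in>S. fval (c j) * fval (snd (kl j)))"
    unfolding k_def l_def using kl assms(2)
    by (simp_all add: fval_sum regular_intros fval_simps local_regular)
  have "dval D g = fval k * dcoord D i a + fval l * dcoord D i b"
    if D: "deriv4 D" for D
    using assms(3)[OF D] kl D
    by (simp add: val sum_distrib_right sum.distrib distrib_left mult.assoc)
  then show ?thesis unfolding chart_span_def using loc by blast
qed

lemma chart_span_pair:
  assumes "chart_span p i a b f" "chart_span p i a b g" "r \<in> local_ring 4 p" "s \<in> local_ring 4 p"
    and "\<And>D. deriv4 D \<Longrightarrow> dval D h = fval r * dval D f + fval s * dval D g"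
  shows "chart_span p i a b h"
  by (rule chart_span_combination[of "{True, False}" i a b "\<lambda>t. if t then f else g"
        "\<lambda>t. if t then r else s"]) (use assms in auto)

lemma chart_span_self:
  assumes "i \<le> 4"
  shows "chart_span p i a b (affine_coord i a)" "chart_span p i a b (affine_coord i b)"
    "chart_span p i a b (affine_coord i i)"
proof -
  show "chart_span p i a b (affine_coord i a)" unfolding chart_span_def
    by (rule exI[of _ 1], rule exI[of _ 0]) (simp add: local_intros fval_simps)
  show "chart_span p i a b (affine_coord i b)" unfolding chart_span_def
    by (rule exI[of _ 0], rule exI[of _ 1]) (simp add: local_intros fval_simps)
  show "chart_span p i a b (affine_coord i i)" unfolding chart_span_def
    by (rule exI[of _ 0], rule exI[of _ 0]) (simp add: local_intros fval_simps dval_chart_self assms)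
qed

text \<open>
  If this holds for all coordinates X_j / X_i, then the wedge product of the two differentials generates the
  canonical sheaf at \<open>p\<close>.
\<close>

lemma canonical_generator:
  assumes i: "i \<le> 4" "a \<le> 4" "b \<le> 4" "p i \<noteq> 0"
    and span: "\<And>j. j \<le> 4 \<Longrightarrow> chart_span p i a b (affine_coord i j)"
  shows "generates_canonical_stalk 4 quadI p (d_wedge (affine_coord i a) (affine_coord i b))"
proof -
  let ?a = "affine_coord i a" and ?b = "affine_coord i b"
  have ab: "?a \<in> local_ring 4 p" "?b \<in> local_ring 4 p" using i affine_coord_local by blast+
  have abK: "?a \<in> coord_field" "?b \<in> coord_field" using i affine_coord_rat_fun by blast+
  have all: "chart_span p i a b f" if f: "f \<in> local_ring 4 p" for f
  proof -
    obtain c where "\<forall>j\<le>4. c j \<in> local_ring 4 p"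
      "\<forall>D. deriv4 D \<longrightarrow> dval D f = (\<Sum>j\<le>4. fval (c j) * dcoord D i j)"
      using dval_local_ring[OF p i(1) f] by blast
    then show ?thesis
      by (intro chart_span_combination[of "{..4}" i a b "affine_coord i" c f] span) simp_all
  qed
  have "d_wedge ?a ?b \<in> canonical_stalk 4 quadI p"
  proof -
    have "form_eq 4 quadI (d_wedge ?a ?b) (\<lambda>D E. \<Sum>k<(1::nat). 1 * d_wedge ?a ?b D E)"
      by (simp add: form_eq_def null_fun_iff regular_intros fval_simps)
    then show ?thesis unfolding canonical_stalk_def mem_Collect_eq
      using ab local_intros(2)
      by (intro exI[of _ "1::nat"] exI[of _ "\<lambda>_. 1"] exI[of _ "\<lambda>_. ?a"] exI[of _ "\<lambda>_. ?b"]) simp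
  qed
  moreover have "\<exists>h\<in>local_ring 4 p. form_eq 4 quadI \<omega> (\<lambda>D E. h * d_wedge ?a ?b D E)"
    if om: "\<omega> \<in> canonical_stalk 4 quadI p" for \<omega>
  proof -
    obtain N :: nat and h f g where
      loc: "\<forall>k<N. h k \<in> local_ring 4 p \<and> f k \<in> local_ring 4 p \<and> g k \<in> local_ring 4 p"
      and eq: "form_eq 4 quadI \<omega> (\<lambda>D E. \<Sum>k<N. h k * d_wedge (f k) (g k) D E)"
      using om unfolding canonical_stalk_def by blast
    have ex: "\<forall>k\<in>{..<N}. \<exists>c. c \<in> local_ring 4 p \<and>
        (\<forall>D E. deriv4 D \<longrightarrow> deriv4 E \<longrightarrow> fval (d_wedge (f k) (g k) D E) = fval c * fval (d_wedge ?a ?b D E))"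
    proof
      fix k assume "k \<in> {..<N}"
      then have k: "f k \<in> local_ring 4 p" "g k \<in> local_ring 4 p" using loc by auto
      obtain r s where rs: "r \<in> local_ring 4 p" "s \<in> local_ring 4 p"
        "\<And>D. deriv4 D \<Longrightarrow> dval D (f k) = fval r * dval D ?a + fval s * dval D ?b"
        using all[OF k(1)] unfolding chart_span_def by blast
      obtain r' s' where rs': "r' \<in> local_ring 4 p" "s' \<in> local_ring 4 p"
        "\<And>D. deriv4 D \<Longrightarrow> dval D (g k) = fval r' * dval D ?a + fval s' * dval D ?b"
        using all[OF k(2)] unfolding chart_span_def by blast
      have "r * s' - s * r' \<in> local_ring 4 p" by (intro local_intros rs rs')
      moreover have "fval (d_wedge (f k) (g k) D E) = fval (r * s' - s * r') * fval (d_wedge ?a ?b D E)"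
        if DE: "deriv4 D" "deriv4 E" for D E
      proof -
        have v: "fval (r * s' - s * r') = fval r * fval s' - fval s * fval r'"
          using rs(1,2) rs'(1,2) by (simp add: fval_simps regular_intros local_regular)
        show ?thesis
          unfolding v d_wedge_value(2)[OF DE local_ring_rat_fun[OF p k(1)] local_ring_rat_fun[OF p k(2)]]
            d_wedge_value(2)[OF DE abK] rs(3)[OF DE(1)] rs(3)[OF DE(2)] rs'(3)[OF DE(1)] rs'(3)[OF DE(2)]
          by (simp add: algebra_simps)
      qed
      ultimately show "\<exists>c. c \<in> local_ring 4 p \<and>
          (\<forall>D E. deriv4 D \<longrightarrow> deriv4 E \<longrightarrow> fval (d_wedge (f k) (g k) D E) = fval c * fval (d_wedge ?a ?b D E))"
        by blast
    qed
    from bchoice[OF ex] obtain c where c: "\<forall>k\<in>{..<N}. c k \<in> local_ring 4 p \<and>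
        (\<forall>D E. deriv4 D \<longrightarrow> deriv4 E \<longrightarrow> fval (d_wedge (f k) (g k) D E) = fval (c k) * fval (d_wedge ?a ?b D E))" ..
    define H where "H = (\<Sum>k<N. h k * c k)"
    have H: "H \<in> local_ring 4 p"
      unfolding H_def by (intro local_sum local_intros; use c loc in simp)
    have Hv: "fval H = (\<Sum>k<N. fval (h k) * fval (c k))"
    proof -
      have "h k * c k \<in> regs \<and> fval (h k * c k) = fval (h k) * fval (c k)" if "k < N" for k
        using c loc that by (simp add: regular_intros fval_simps local_regular)
      then show ?thesis
        using fval_sum[of "{..<N}" "\<lambda>k. h k * c k"] by (simp add: H_def)
    qed
    have "\<omega> D E - H * d_wedge ?a ?b D E \<in> null4"
      if DE: "deriv4 D" "deriv4 E" for D E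
    proof -
      let ?S = "\<Sum>k<N. h k * d_wedge (f k) (g k) D E"
      have "h k * d_wedge (f k) (g k) D E \<in> regs \<and>
          fval (h k * d_wedge (f k) (g k) D E) = fval (h k) * fval (c k) * fval (d_wedge ?a ?b D E)"
        if "k < N" for k
        using loc c that DE d_wedge_value(1)[OF DE, of "f k" "g k"]
        by (simp add: regular_intros fval_simps local_regular local_ring_rat_fun[OF p])
      then have S: "?S \<in> regs" "fval ?S = fval H * fval (d_wedge ?a ?b D E)"
        using fval_sum[of "{..<N}" "\<lambda>k. h k * d_wedge (f k) (g k) D E"]
        by (simp_all add: Hv sum_distrib_right)
      have T: "H * d_wedge ?a ?b D E \<in> regs"
        "fval (H * d_wedge ?a ?b D E) = fval H * fval (d_wedge ?a ?b D E)"
        using d_wedge_value(1)[OF DE abK] local_regular[OF H] by (simp_all add: regular_intros fval_simps)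
      have "\<omega> D E - ?S \<in> null4"
        using eq DE unfolding form_eq_def by blast
      moreover have "?S - H * d_wedge ?a ?b D E \<in> null4"
        using S T by (simp add: null_fun_diff_iff)
      ultimately have "(\<omega> D E - ?S) + (?S - H * d_wedge ?a ?b D E) \<in> null4"
        by (rule null_fun_add)
      then show ?thesis by simp
    qed
    then show ?thesis using H unfolding form_eq_def by blast
  qed
  ultimately show ?thesis unfolding generates_canonical_stalk_def by blast
qed

end

lemma forms_Var_mult: "i \<le> 4 \<Longrightarrow> numeral k * Var i \<in> forms 4 1"
  by (rule forms_mult'[OF forms_numeral forms_Var]) simp_all

lemma forms_Var_mult2: "i \<le> 4 \<Longrightarrow> j \<le> 4 \<Longrightarrow> numeral k * (Var i * Var j) \<in> forms 4 2"
  by (rule forms_mult'[OF forms_numeral forms_Var2]) simp_all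

lemma forms_Var_square: "i \<le> 4 \<Longrightarrow> Var i ^ 2 \<in> forms 4 2"
  unfolding power2_eq_square by (rule forms_Var2)

text \<open>Passing from the chart with denominator X_4 to another chart.\<close>

lemma dval_change_chart:
  assumes D: "deriv4 D" and i: "i \<le> 4" and j: "j \<le> 4"
  shows "dcoord D i j = gpt 4 / gpt i ^ 2 *
    (gpt i * dcoord D 4 j - gpt j * dcoord D 4 i)"
proof -
  let ?i = "gpt i :: rat big_field" and ?z = "gpt 4 :: rat big_field"
  have nz: "?i \<noteq> 0" "?z \<noteq> 0" using i generic_point_nonzero_le by simp_all
  have K: "affine_coord i j \<in> coord_field" "affine_coord 4 i \<in> coord_field" "affine_coord 4 j \<in> coord_field"
    using i j by (simp_all add: affine_coord_rat_fun)
  have "fval (affine_coord i j * affine_coord 4 i) = fval (affine_coord 4 j)"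
    using nz i K by (simp add: fval_simps fval_affine_coord rat_fun_regular)
  then have "dval D (affine_coord i j * affine_coord 4 i) = dcoord D 4 j"
    by (intro dval_cong[OF D] coord_field_intros K)
  then have "gpt j / ?i * dcoord D 4 i + ?i / ?z * dcoord D i j
      = dcoord D 4 j"
    using i by (simp add: dval_mult[OF D K(1,2)] fval_affine_coord)
  then show ?thesis using nz by (simp add: field_simps power2_eq_square)
qed

text \<open>
  The rational 2-form dx dy / (4uv) in the affine coordinates with z = 1; here, 4uv is the minor of the Jacobian
  matrix of the two affine equations that belongs to u and v.
\<close>

definition residue_form :: two_form where
  "residue_form = (\<lambda>D E. frac (Var 4 ^ 2) (4 * (Var 2 * Var 3))
     * d_wedge (affine_coord 4 0) (affine_coord 4 1) D E)"

lemma residue_form_value: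
  assumes "deriv4 D" "deriv4 E"
  shows "residue_form D E \<in> regs"
    "fval (residue_form D E) = gpt 4 ^ 2 / (4 * (gpt 2 * gpt 3)) *
      (dcoord D 4 0 * dcoord E 4 1 - dcoord D 4 1 * dcoord E 4 0)"
proof -
  have nz: "gval (4 * (Var 2 * Var 3)) \<noteq> (0 :: rat big_field)"
    using generic_point_nonzero[where 'a = rat] by (simp add: generic_value_simps)
  have r: "frac (Var 4 ^ 2) (4 * (Var 2 * Var 3)) \<in> regs"
    by (rule regular_fracsI[OF forms_polys[OF forms_Var_square] forms_polys[OF forms_Var_mult2] nz]) simp_all
  note w = d_wedge_value[OF assms affine_coord_rat_fun[of 0 4] affine_coord_rat_fun[of 1 4]]
  show "residue_form D E \<in> regs"
    unfolding residue_form_def using r w by (simp add: regular_intros del: One_nat_def)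
  show "fval (residue_form D E) = gpt 4 ^ 2 / (4 * (gpt 2 * gpt 3)) *
      (dcoord D 4 0 * dcoord E 4 1 - dcoord D 4 1 * dcoord E 4 0)"
    unfolding residue_form_def using r w nz
    by (simp add: fval_simps fval_Fract generic_value_simps del: One_nat_def)
qed

text \<open>The condition of the anticanonical sheaf being O(1) at a point, from data in a chart.\<close>

lemma anticanonical_at_point:
  assumes p: "p \<in> points 4 quadI" and i: "i \<le> 4" "a \<le> 4" "b \<le> 4" "p i \<noteq> 0"
    and span: "\<And>j. j \<le> 4 \<Longrightarrow> chart_span p i a b (affine_coord i j)"
    and h: "h \<in> coord_field" and c: "F \<in> forms 4 d" "G \<in> forms 4 d"
      "eval_poly of_rat p F \<noteq> 0" "eval_poly of_rat p G \<noteq> 0"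
    and hc: "fval h * (gpt 4 / gpt i) = gval F / gval G"
    and val: "\<And>D E. deriv4 D \<Longrightarrow> deriv4 E \<Longrightarrow> fval (residue_form D E)
      = fval h * (dcoord D i a * dcoord E i b
          - dcoord D i b * dcoord E i a)"
  shows "\<exists>\<tau> h i. generates_canonical_stalk 4 quadI p \<tau> \<and>
           h \<in> coord_field \<and> form_eq 4 quadI residue_form (\<lambda>D E. h * \<tau> D E) \<and> i \<le> 4 \<and> p i \<noteq> 0 \<and>
           (\<exists>c\<in>local_units 4 p. h ^ 1 * Fraction_Field.Fract (Var 4) (1 * Var i) - c \<in> null4)"
proof (intro exI conjI)
  let ?t = "d_wedge (affine_coord i a) (affine_coord i b)"
  show "generates_canonical_stalk 4 quadI p ?t"
    by (rule canonical_generator[OF p i span])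
  have K: "affine_coord i a \<in> coord_field" "affine_coord i b \<in> coord_field"
    using i affine_coord_rat_fun by simp_all
  have "residue_form D E - h * ?t D E \<in> null4" if DE: "deriv4 D" "deriv4 E" for D E
    using residue_form_value(1)[OF DE] val[OF DE] d_wedge_value[OF DE K] rat_fun_regular[OF h]
    by (simp add: null_fun_diff_iff regular_intros fval_simps)
  then show "form_eq 4 quadI residue_form (\<lambda>D E. h * ?t D E)" unfolding form_eq_def by blast
  have "frac F G \<in> local_units 4 p" unfolding local_units_def using c by blast
  moreover have "h ^ 1 * frac (Var 4) (1 * Var i) - frac F G \<in> null4"
  proof -
    have f: "frac (Var 4) (1 * Var i) = affine_coord i 4" by (simp add: affine_coord_def)
    have "affine_coord i 4 \<in> regs" "h \<in> regs"
      using i h affine_coord_regular rat_fun_regular by simp_all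
    moreover have "frac F G \<in> regs" "fval (frac F G) = gval F / gval G"
      using local_frac[OF p c(1,2,4)] local_regular[OF p] by simp_all
    ultimately show ?thesis
      unfolding f using hc i
      by (simp add: null_fun_diff_iff regular_intros fval_simps fval_affine_coord)
  qed
  ultimately show "\<exists>c\<in>local_units 4 p. h ^ 1 * frac (Var 4) (1 * Var i) - c \<in> null4" by blast
qed (use i h in auto)

text \<open>
  Linear algebra of the differentiated equations: \<open>D0\<close>, ..., \<open>D3\<close> and \<open>E0\<close>, ..., \<open>E3\<close> are the
  derivatives of the coordinates x/z, y/z, u/z, v/z under two derivations.
\<close>

lemma chart_solve:
  fixes x y z u a b c :: "'a::field_char_0"
  shows "z \<noteq> 0 \<Longrightarrow> z * a + 2 * y * b = 2 * u * c \<Longrightarrow> a = - (2 * y) / z * b + 2 * u / z * c"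
    and "u \<noteq> 0 \<Longrightarrow> x * a + y * b = 2 * u * c \<Longrightarrow> c = x / (2 * u) * a + y / (2 * u) * b"
proof -
  assume z: "z \<noteq> 0" and eq: "z * a + 2 * y * b = 2 * u * c"
  have "z * a = 2 * u * c - 2 * y * b" using eq by (simp add: eq_diff_eq)
  then have "a = (2 * u * c - 2 * y * b) / z" using z by (metis nonzero_mult_div_cancel_left)
  then show "a = - (2 * y) / z * b + 2 * u / z * c" by (simp add: diff_divide_distrib)
next
  assume u: "u \<noteq> 0" and eq: "x * a + y * b = 2 * u * c"
  have "c = (x * a + y * b) / (2 * u)" unfolding eq using u by simp
  then show "c = x / (2 * u) * a + y / (2 * u) * b" by (simp add: add_divide_distrib)
qed

lemma chart_solve_pair:
  fixes x y z u v a b c d :: "'a::field_char_0"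
  defines "M \<equiv> 4 * (x * y) - z ^ 2"
  assumes M: "M \<noteq> 0" and eq: "2 * x * a + z * b = 2 * u * c" "z * a + 2 * y * b = 2 * v * d"
  shows "a = 4 * (u * y) / M * c + - (2 * (v * z)) / M * d"
    "b = - (2 * (u * z)) / M * c + 4 * (x * v) / M * d"
proof -
  have "M * a = 2 * y * (2 * u * c) - z * (2 * v * d)" "M * b = 2 * x * (2 * v * d) - z * (2 * u * c)"
    unfolding eq[symmetric] by (simp_all add: M_def algebra_simps power2_eq_square)
  then have "a = (2 * y * (2 * u * c) - z * (2 * v * d)) / M"
    "b = (2 * x * (2 * v * d) - z * (2 * u * c)) / M"
    using M by (metis nonzero_mult_div_cancel_left)+
  then show "a = 4 * (u * y) / M * c + - (2 * (v * z)) / M * d"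
    "b = - (2 * (u * z)) / M * c + 4 * (x * v) / M * d"
    by (simp_all add: diff_divide_distrib mult_ac)
qed

lemma residue_identities:
  fixes x y z u v D0 D1 D2 D3 E0 E1 E2 E3 :: "'a::field_char_0"
  assumes nz: "x \<noteq> 0" "y \<noteq> 0" "z \<noteq> 0" "u \<noteq> 0" "v \<noteq> 0"
    and sq: "u ^ 2 = x ^ 2 + y * z" "v ^ 2 = x * z + y ^ 2"
    and D: "2 * x * D0 + z * D1 = 2 * u * D2" "z * D0 + 2 * y * D1 = 2 * v * D3"
    and E: "2 * x * E0 + z * E1 = 2 * u * E2" "z * E0 + 2 * y * E1 = 2 * v * E3"
  shows "z ^ 2 / (4 * (u * v)) * (D0 * E1 - D1 * E0) = - z / (2 * u) * (D1 * E3 - D3 * E1)"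
    and "z ^ 2 / (4 * (u * v)) * (D0 * E1 - D1 * E0) = z / (2 * v) * (D0 * E2 - D2 * E0)"
    and "4 * (x * y) - z ^ 2 \<noteq> 0 \<Longrightarrow> z ^ 2 / (4 * (u * v)) * (D0 * E1 - D1 * E0)
           = z ^ 2 / (4 * (x * y) - z ^ 2) * (D2 * E3 - D3 * E2)"
    and "z ^ 2 / (4 * (u * v)) * (D0 * E1 - D1 * E0) = x ^ 2 / (2 * (u * z)) *
           ((z / x ^ 2 * (x * D1 - y * D0)) * (z / x ^ 2 * (x * E3 - v * E0))
             - (z / x ^ 2 * (x * D3 - v * D0)) * (z / x ^ 2 * (x * E1 - y * E0)))"
    and "z ^ 2 / (4 * (u * v)) * (D0 * E1 - D1 * E0) = - (y ^ 2) / (2 * (v * z)) *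
           ((z / y ^ 2 * (y * D0 - x * D1)) * (z / y ^ 2 * (y * E2 - u * E1))
             - (z / y ^ 2 * (y * D2 - u * D1)) * (z / y ^ 2 * (y * E0 - x * E1)))"
proof -
  define W where "W = D0 * E1 - D1 * E0"
  have "2 * v * (D1 * E3 - D3 * E1) = D1 * (2 * v * E3) - (2 * v * D3) * E1"
    by (simp add: algebra_simps)
  then have w13: "2 * v * (D1 * E3 - D3 * E1) = - z * W"
    unfolding D(2)[symmetric] E(2)[symmetric] by (simp add: W_def algebra_simps)
  have "2 * v * (D0 * E3 - D3 * E0) = D0 * (2 * v * E3) - (2 * v * D3) * E0"
    by (simp add: algebra_simps)
  then have w03: "2 * v * (D0 * E3 - D3 * E0) = 2 * y * W"
    unfolding D(2)[symmetric] E(2)[symmetric] by (simp add: W_def algebra_simps)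
  have "2 * u * (D0 * E2 - D2 * E0) = D0 * (2 * u * E2) - (2 * u * D2) * E0"
    by (simp add: algebra_simps)
  then have w02: "2 * u * (D0 * E2 - D2 * E0) = z * W"
    unfolding D(1)[symmetric] E(1)[symmetric] by (simp add: W_def algebra_simps)
  have "2 * u * (D1 * E2 - D2 * E1) = D1 * (2 * u * E2) - (2 * u * D2) * E1"
    by (simp add: algebra_simps)
  then have w12: "2 * u * (D1 * E2 - D2 * E1) = - 2 * x * W"
    unfolding D(1)[symmetric] E(1)[symmetric] by (simp add: W_def algebra_simps)
  have "4 * (u * v) * (D2 * E3 - D3 * E2) = (2 * u * D2) * (2 * v * E3) - (2 * v * D3) * (2 * u * E2)"
    by (simp add: algebra_simps)
  then have w23: "4 * (u * v) * (D2 * E3 - D3 * E2) = (4 * (x * y) - z ^ 2) * W"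
    unfolding D[symmetric] E[symmetric] by (simp add: W_def algebra_simps power2_eq_square)
  have solve: "t = r / k" if "k * t = r" "k \<noteq> 0" for k t r :: 'a
    using that by auto
  have factor: "(k * a) * (k * b) - (k * c) * (k * d) = k ^ 2 * (a * b - c * d)" for k a b c d :: 'a
    by (simp add: algebra_simps power2_eq_square)
  have "D1 * E3 - D3 * E1 = - z * W / (2 * v)" by (rule solve[OF w13]) (use nz in simp)
  then show "z ^ 2 / (4 * (u * v)) * (D0 * E1 - D1 * E0) = - z / (2 * u) * (D1 * E3 - D3 * E1)"
    unfolding W_def[symmetric] using nz by (simp add: power2_eq_square mult_ac)
  have "D0 * E2 - D2 * E0 = z * W / (2 * u)" by (rule solve[OF w02]) (use nz in simp)
  then show "z ^ 2 / (4 * (u * v)) * (D0 * E1 - D1 * E0) = z / (2 * v) * (D0 * E2 - D2 * E0)"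
    unfolding W_def[symmetric] using nz by (simp add: power2_eq_square mult_ac)
  have "D2 * E3 - D3 * E2 = (4 * (x * y) - z ^ 2) * W / (4 * (u * v))"
    by (rule solve[OF w23]) (use nz in simp)
  then show "z ^ 2 / (4 * (u * v)) * (D0 * E1 - D1 * E0)
           = z ^ 2 / (4 * (x * y) - z ^ 2) * (D2 * E3 - D3 * E2)" if "4 * (x * y) - z ^ 2 \<noteq> 0"
    unfolding W_def[symmetric] using nz that by simp
  define S where "S = x * (D1 * E3 - D3 * E1) - y * (D0 * E3 - D3 * E0) + v * W"
  have "2 * v * S = x * (2 * v * (D1 * E3 - D3 * E1)) - y * (2 * v * (D0 * E3 - D3 * E0)) + 2 * v ^ 2 * W"
    by (simp add: S_def algebra_simps power2_eq_square)
  also have "\<dots> = x * z * W" unfolding w13 w03 sq by (simp add: algebra_simps power2_eq_square)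
  finally have "2 * v * S = x * z * W" .
  then have S: "S = x * z * W / (2 * v)" by (rule solve) (use nz in simp)
  have "(x * D1 - y * D0) * (x * E3 - v * E0) - (x * D3 - v * D0) * (x * E1 - y * E0) = x * S"
    by (simp add: S_def W_def algebra_simps)
  then have "(z / x ^ 2 * (x * D1 - y * D0)) * (z / x ^ 2 * (x * E3 - v * E0))
             - (z / x ^ 2 * (x * D3 - v * D0)) * (z / x ^ 2 * (x * E1 - y * E0))
      = (z / x ^ 2) ^ 2 * (x * S)"
    unfolding factor by simp
  then show "z ^ 2 / (4 * (u * v)) * (D0 * E1 - D1 * E0) = x ^ 2 / (2 * (u * z)) *
           ((z / x ^ 2 * (x * D1 - y * D0)) * (z / x ^ 2 * (x * E3 - v * E0))
             - (z / x ^ 2 * (x * D3 - v * D0)) * (z / x ^ 2 * (x * E1 - y * E0)))"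
    unfolding W_def[symmetric] using nz by (simp add: S power2_eq_square)
  define R where "R = y * (D0 * E2 - D2 * E0) - x * (D1 * E2 - D2 * E1) - u * W"
  have "2 * u * R = y * (2 * u * (D0 * E2 - D2 * E0)) - x * (2 * u * (D1 * E2 - D2 * E1)) - 2 * u ^ 2 * W"
    by (simp add: R_def algebra_simps power2_eq_square)
  also have "\<dots> = - (y * z * W)" unfolding w02 w12 sq by (simp add: algebra_simps power2_eq_square)
  finally have "2 * u * R = - (y * z * W)" .
  then have R: "R = - (y * z * W) / (2 * u)" by (rule solve) (use nz in simp)
  have "(y * D0 - x * D1) * (y * E2 - u * E1) - (y * D2 - u * D1) * (y * E0 - x * E1) = y * R"
    by (simp add: R_def W_def algebra_simps)
  then have "(z / y ^ 2 * (y * D0 - x * D1)) * (z / y ^ 2 * (y * E2 - u * E1))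
             - (z / y ^ 2 * (y * D2 - u * D1)) * (z / y ^ 2 * (y * E0 - x * E1))
      = (z / y ^ 2) ^ 2 * (y * R)"
    unfolding factor by simp
  then show "z ^ 2 / (4 * (u * v)) * (D0 * E1 - D1 * E0) = - (y ^ 2) / (2 * (v * z)) *
           ((z / y ^ 2 * (y * D0 - x * D1)) * (z / y ^ 2 * (y * E2 - u * E1))
             - (z / y ^ 2 * (y * D2 - u * D1)) * (z / y ^ 2 * (y * E0 - x * E1)))"
    unfolding W_def[symmetric] using nz by (simp add: R power2_eq_square mult.commute[of u v])
qed

lemma all_coords:
  "P 0 \<Longrightarrow> P 1 \<Longrightarrow> P 2 \<Longrightarrow> P 3 \<Longrightarrow> P 4 \<Longrightarrow> j \<le> (4 :: nat) \<Longrightarrow> P j"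
proof -
  assume P: "P 0" "P 1" "P 2" "P 3" "P 4" and "j \<le> 4"
  then have "j \<in> {0, 1, 2, 3, 4}" unfolding atMost_4[symmetric] by simp
  then show "P j" using P by blast
qed

lemma le: "0 \<le> (4 :: nat)" "1 \<le> (4 :: nat)" "2 \<le> (4 :: nat)" "3 \<le> (4 :: nat)" "4 \<le> (4 :: nat)"
  by simp_all

text \<open>
  At every point of the surface, one of five charts applies: three with denominator z, and two with
  denominators x and y, which are needed for the points with z = 0. The names of the lemmas list the
  denominator and the two local coordinates. The condition to be checked at a point is abbreviated to
  \<open>anticanonical_at\<close>; it is the one for the residue form and the section z of O(1).
\<close>

context
  fixes p :: "nat \<Rightarrow> complex"
  assumes p: "p \<in> points 4 quadI"
begin

abbreviation (input) "anticanonical_at q \<equiv>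
  (\<exists>\<tau> h i. generates_canonical_stalk 4 quadI q \<tau> \<and>
     h \<in> coord_field \<and> form_eq 4 quadI residue_form (\<lambda>D E. h * \<tau> D E) \<and> i \<le> 4 \<and> q i \<noteq> 0 \<and>
     (\<exists>c\<in>local_units 4 q. h ^ 1 * frac (Var 4) (1 * Var i) - c \<in> null4))"

lemma chart_relations:
  assumes "i \<le> 4" "deriv4 D"
  defines "d \<equiv> \<lambda>j. dcoord D i j"
  shows "2 * gpt 0 * d 0 + gpt 4 * d 1 + gpt 1 * d 4 = 2 * gpt 2 * d 2"
    "gpt 4 * d 0 + 2 * gpt 1 * d 1 + gpt 0 * d 4 = 2 * gpt 3 * d 3"
    "d i = 0"
  unfolding d_def using dval_chart_relations[OF assms(2,1)] dval_chart_self[OF assms(2,1)] by simp_all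

lemma residue_identities_generic:
  assumes DE: "deriv4 D" "deriv4 E"
  defines "d \<equiv> \<lambda>j. dcoord D 4 j" and "e \<equiv> \<lambda>j. dcoord E 4 j"
  shows "fval (residue_form D E) = - gpt 4 / (2 * gpt 2) * (d 1 * e 3 - d 3 * e 1)"
    "fval (residue_form D E) = gpt 4 / (2 * gpt 3) * (d 0 * e 2 - d 2 * e 0)"
    "4 * (gpt 0 * gpt 1) - gpt 4 ^ 2 \<noteq> (0 :: rat big_field) \<Longrightarrow>
     fval (residue_form D E) = gpt 4 ^ 2 / (4 * (gpt 0 * gpt 1) - gpt 4 ^ 2)
        * (d 2 * e 3 - d 3 * e 2)"
    "fval (residue_form D E) = gpt 0 ^ 2 / (2 * (gpt 2 * gpt 4)) *
       (dcoord D 0 1 * dcoord E 0 3 - dcoord D 0 3 * dcoord E 0 1)"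
    "fval (residue_form D E) = - (gpt 1 ^ 2) / (2 * (gpt 3 * gpt 4)) *
       (dcoord D 1 0 * dcoord E 1 2 - dcoord D 1 2 * dcoord E 1 0)"
proof -
  have rel: "2 * gpt 0 * dcoord F 4 0 + gpt 4 * dcoord F 4 1
       = 2 * gpt 2 * dcoord F 4 2"
     "gpt 4 * dcoord F 4 0 + 2 * gpt 1 * dcoord F 4 1
       = 2 * gpt 3 * dcoord F 4 3" if "deriv4 F" for F
    using chart_relations[of 4, OF _ that] by (simp_all del: One_nat_def)
  note id = residue_identities[OF generic_point_nonzero(1,2,3,4,5) generic_point_relations
      rel(1)[OF DE(1)] rel(2)[OF DE(1)] rel(1)[OF DE(2)] rel(2)[OF DE(2)]]
  have ch: "i \<le> 4 \<Longrightarrow> j \<le> 4 \<Longrightarrow> dcoord D i j = gpt 4 / gpt i ^ 2 *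
      (gpt i * d j - gpt j * d i)"
    "i \<le> 4 \<Longrightarrow> j \<le> 4 \<Longrightarrow> dcoord E i j = gpt 4 / gpt i ^ 2 *
      (gpt i * e j - gpt j * e i)" for i j
    unfolding d_def e_def using dval_change_chart DE by blast+
  note res = residue_form_value(2)[OF DE]
  show "fval (residue_form D E) = - gpt 4 / (2 * gpt 2) * (d 1 * e 3 - d 3 * e 1)"
    unfolding res d_def e_def by (rule id(1))
  show "fval (residue_form D E) = gpt 4 / (2 * gpt 3) * (d 0 * e 2 - d 2 * e 0)"
    unfolding res d_def e_def by (rule id(2))
  show "fval (residue_form D E) = gpt 4 ^ 2 / (4 * (gpt 0 * gpt 1) - gpt 4 ^ 2)
        * (d 2 * e 3 - d 3 * e 2)"
    if "4 * (gpt 0 * gpt 1) - gpt 4 ^ 2 \<noteq> (0 :: rat big_field)"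
    unfolding res d_def e_def by (rule id(3)[OF that])
  show "fval (residue_form D E) = gpt 0 ^ 2 / (2 * (gpt 2 * gpt 4)) *
       (dcoord D 0 1 * dcoord E 0 3 - dcoord D 0 3 * dcoord E 0 1)"
    unfolding res ch(1)[OF le(1) le(2)] ch(1)[OF le(1) le(4)] ch(2)[OF le(1) le(2)] ch(2)[OF le(1) le(4)]
    unfolding d_def e_def by (rule id(4))
  show "fval (residue_form D E) = - (gpt 1 ^ 2) / (2 * (gpt 3 * gpt 4)) *
       (dcoord D 1 0 * dcoord E 1 2 - dcoord D 1 2 * dcoord E 1 0)"
    unfolding res ch(1)[OF le(2) le(1)] ch(1)[OF le(2) le(3)] ch(2)[OF le(2) le(1)] ch(2)[OF le(2) le(3)]
    unfolding d_def e_def by (rule id(5))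
qed

text \<open>
  In four of the charts, one differentiated equation expresses the coordinate \<open>c\<close> by \<open>a\<close> and \<open>b\<close>,
  and the other one expresses \<open>e\<close> by \<open>a\<close> and \<open>c\<close>.
\<close>

lemma chart_anticanonical:
  assumes idx: "i \<le> 4" "a \<le> 4" "b \<le> 4" "e \<le> 4" and cover: "{..4} = {i, a, b, c, e}"
    and nz: "p i \<noteq> 0" "p e \<noteq> 0" and AB: "A \<in> forms 4 1" "B \<in> forms 4 1"
    and F: "F \<in> forms 4 1" "eval_poly of_rat p F \<noteq> 0"
    and rel: "\<And>D. deriv4 D \<Longrightarrow> gpt i * dcoord D i c
        + 2 * gpt a * dcoord D i a = 2 * gpt b * dcoord D i b"
      "\<And>D. deriv4 D \<Longrightarrow> gval A * dcoord D i a
        + gval B * dcoord D i c = 2 * gpt e * dcoord D i e"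
    and val: "\<And>D E. deriv4 D \<Longrightarrow> deriv4 E \<Longrightarrow> fval (residue_form D E)
      = gval F * gpt i / (2 * gpt e * gpt 4)
        * (dcoord D i a * dcoord E i b
          - dcoord D i b * dcoord E i a)"
  shows "anticanonical_at p"
proof -
  let ?h = "frac (F * Var i) (2 * Var e * Var 4)"
  note two = forms_Var_mult[where k = "num.Bit0 num.One"]
  note g = generic_point_nonzero_le[OF idx(1)] generic_point_nonzero_le[OF idx(4)]
    generic_point_nonzero_le[OF le(5)]
  note G = two[OF idx(4)]
  have ei: "eval_poly of_rat p (Var i) \<noteq> 0" and eG: "eval_poly of_rat p (2 * Var e) \<noteq> 0"
    using nz by (simp_all add: cplx.eval_simps)
  note s = chart_span_self[OF p idx(1), of a b]
  note l1 = local_frac[OF p forms_uminus[OF two[OF idx(2)]] forms_Var[OF idx(1)] ei]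
    and l2 = local_frac[OF p two[OF idx(3)] forms_Var[OF idx(1)] ei]
    and l3 = local_frac[OF p AB(1) G eG] and l4 = local_frac[OF p AB(2) G eG]
  have sc: "chart_span p i a b (affine_coord i c)"
  proof (rule chart_span_pair[OF p s(1,2) l1(1) l2(1)])
    fix D assume D: "deriv4 D"
    show "dcoord D i c = fval (frac (- (2 * Var a)) (Var i)) * dcoord D i a
        + fval (frac (2 * Var b) (Var i)) * dcoord D i b"
      unfolding l1(2) l2(2) generic_value_simps by (rule chart_solve(1)[OF g(1) rel(1)[OF D]])
  qed
  have se: "chart_span p i a b (affine_coord i e)"
  proof (rule chart_span_pair[OF p s(1) sc l3(1) l4(1)])
    fix D assume D: "deriv4 D"
    show "dcoord D i e = fval (frac A (2 * Var e)) * dcoord D i a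
        + fval (frac B (2 * Var e)) * dcoord D i c"
      unfolding l3(2) l4(2) generic_value_simps by (rule chart_solve(2)[OF g(2) rel(2)[OF D]])
  qed
  have hG: "gval (2 * Var e * Var 4) \<noteq> (0 :: rat big_field)"
    using g by (simp add: generic_value_simps)
  have h: "?h \<in> coord_field" unfolding rat_fun_fracs
    by (rule fracsI[OF forms_mult[OF F(1) forms_Var[OF idx(1)]] forms_mult[OF G forms_Var[OF le(5)]]])
       (use hG in \<open>simp add: quadrics_ideal_kernel\<close>)
  show ?thesis
  proof (rule anticanonical_at_point[OF p idx(1-3) nz(1) _ h F(1) G F(2) eG])
    show "chart_span p i a b (affine_coord i j)" if "j \<le> 4" for j
    proof -
      have "j \<in> {i, a, b, c, e}" using that unfolding cover[symmetric] by simp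
      then show ?thesis using s sc se by blast
    qed
    show "fval ?h * (gpt 4 / gpt i) = gval F / gval (2 * Var e)"
      unfolding fval_Fract[OF hG] using g by (simp add: generic_value_simps)
    show "fval (residue_form D E) = fval ?h
        * (dcoord D i a * dcoord E i b - dcoord D i b * dcoord E i a)"
      if "deriv4 D" "deriv4 E" for D E
      unfolding val[OF that] fval_Fract[OF hG] generic_value_simps by (rule refl)
  qed
qed

lemma chart_z_yv:
  assumes "p 4 \<noteq> 0" "p 2 \<noteq> 0" shows "anticanonical_at p"
proof (rule chart_anticanonical[of 4 1 3 2 0 "Var 4" "2 * Var 0" "- Var 4"])
  fix D assume D: "deriv4 D"
  note rel = chart_relations[OF le(5) D]
  show "gpt 4 * dcoord D 4 0 + 2 * gpt 1 * dcoord D 4 1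
      = 2 * gpt 3 * dcoord D 4 3" using rel(2,3) by simp
  show "gval (Var 4) * dcoord D 4 1 + gval (2 * Var 0) * dcoord D 4 0
      = 2 * gpt 2 * dcoord D 4 2"
    using rel(1,3) by (simp add: generic_value_simps add.commute)
  fix E assume E: "deriv4 E"
  show "fval (residue_form D E) = gval (- Var 4) * gpt 4 / (2 * gpt 2 * gpt 4)
        * (dcoord D 4 1 * dcoord E 4 3 - dcoord D 4 3 * dcoord E 4 1)"
    unfolding residue_identities_generic(1)[OF D E]
    using generic_point_nonzero(3)[where 'a = rat] by (simp add: generic_value_simps)
qed (use assms atMost_4 in \<open>auto intro!: forms_Var forms_Var_mult forms_uminus simp: cplx.eval_simps simp del: One_nat_def\<close>)

lemma chart_z_xu:
  assumes "p 4 \<noteq> 0" "p 3 \<noteq> 0" shows "anticanonical_at p"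
proof (rule chart_anticanonical[of 4 0 2 3 1 "Var 4" "2 * Var 1" "Var 4"])
  fix D assume D: "deriv4 D"
  note rel = chart_relations[OF le(5) D]
  show "gpt 4 * dcoord D 4 1 + 2 * gpt 0 * dcoord D 4 0
      = 2 * gpt 2 * dcoord D 4 2" using rel(1,3) by (simp add: add.commute)
  show "gval (Var 4) * dcoord D 4 0 + gval (2 * Var 1) * dcoord D 4 1
      = 2 * gpt 3 * dcoord D 4 3"
    using rel(2,3) by (simp add: generic_value_simps)
  fix E assume E: "deriv4 E"
  show "fval (residue_form D E) = gval (Var 4) * gpt 4 / (2 * gpt 3 * gpt 4)
        * (dcoord D 4 0 * dcoord E 4 2 - dcoord D 4 2 * dcoord E 4 0)"
    unfolding residue_identities_generic(2)[OF D E]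
    using generic_point_nonzero(3)[where 'a = rat] by (simp add: generic_value_simps)
qed (use assms atMost_4 in \<open>auto intro!: forms_Var forms_Var_mult simp: cplx.eval_simps simp del: One_nat_def\<close>)

lemma chart_x_yv:
  assumes "p 0 \<noteq> 0" "p 2 \<noteq> 0" shows "anticanonical_at p"
proof (rule chart_anticanonical[of 0 1 3 2 4 "Var 4" "Var 1" "Var 0"])
  fix D assume D: "deriv4 D"
  note rel = chart_relations[OF le(1) D]
  show "gpt 0 * dcoord D 0 4 + 2 * gpt 1 * dcoord D 0 1
      = 2 * gpt 3 * dcoord D 0 3" using rel(2,3) by (simp add: add.commute)
  show "gval (Var 4) * dcoord D 0 1 + gval (Var 1) * dcoord D 0 4
      = 2 * gpt 2 * dcoord D 0 2"
    using rel(1,3) by (simp add: generic_value_simps)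
  fix E assume E: "deriv4 E"
  show "fval (residue_form D E) = gval (Var 0) * gpt 0 / (2 * gpt 2 * gpt 4)
        * (dcoord D 0 1 * dcoord E 0 3 - dcoord D 0 3 * dcoord E 0 1)"
    unfolding residue_identities_generic(4)[OF D E]
    by (simp add: generic_value_simps power2_eq_square mult.assoc)
qed (use assms atMost_4 in \<open>auto intro!: forms_Var simp: cplx.eval_simps simp del: One_nat_def\<close>)

lemma chart_y_xu:
  assumes "p 1 \<noteq> 0" "p 3 \<noteq> 0" shows "anticanonical_at p"
proof (rule chart_anticanonical[of 1 0 2 3 4 "Var 4" "Var 0" "- Var 1"])
  fix D assume D: "deriv4 D"
  note rel = chart_relations[OF le(2) D]
  show "gpt 1 * dcoord D 1 4 + 2 * gpt 0 * dcoord D 1 0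
      = 2 * gpt 2 * dcoord D 1 2" using rel(1,3) by (simp add: add.commute)
  show "gval (Var 4) * dcoord D 1 0 + gval (Var 0) * dcoord D 1 4
      = 2 * gpt 3 * dcoord D 1 3"
    using rel(2,3) by (simp add: generic_value_simps)
  fix E assume E: "deriv4 E"
  show "fval (residue_form D E) = gval (- Var 1) * gpt 1 / (2 * gpt 3 * gpt 4)
        * (dcoord D 1 0 * dcoord E 1 2 - dcoord D 1 2 * dcoord E 1 0)"
    unfolding residue_identities_generic(5)[OF D E]
    by (simp add: generic_value_simps power2_eq_square mult.assoc)
qed (use assms atMost_4 in \<open>auto intro!: forms_Var forms_uminus simp: cplx.eval_simps simp del: One_nat_def\<close>)

text \<open>Here u and v are the local coordinates, and the two equations are solved together for x and y.\<close>

lemma chart_z_uv: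
  assumes z: "p 4 \<noteq> 0" and M: "4 * (p 0 * p 1) - p 4 ^ 2 \<noteq> 0"
  shows "anticanonical_at p"
proof -
  let ?M = "4 * (Var 0 * Var 1) - Var 4 ^ 2 :: rat mpoly"
  note s = chart_span_self[OF p le(5), of 2 3]
  note G = forms_diff[OF forms_Var_mult2[OF le(1) le(2)] forms_Var_square[OF le(5)]]
  have eG: "eval_poly of_rat p ?M \<noteq> 0" using M by (simp add: cplx.eval_simps)
  note l1 = local_frac[OF p forms_Var_mult2[OF le(3) le(2)] G eG]
    and l2 = local_frac[OF p forms_uminus[OF forms_Var_mult2[OF le(4) le(5)]] G eG]
    and l3 = local_frac[OF p forms_uminus[OF forms_Var_mult2[OF le(3) le(5)]] G eG]
    and l4 = local_frac[OF p forms_Var_mult2[OF le(1) le(4)] G eG]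
    and m = local_frac[OF p forms_Var_square[OF le(5)] G eG]
  have gM: "4 * (gpt 0 * gpt 1) - gpt 4 ^ 2 \<noteq> (0 :: rat big_field)"
    using m(3) by (simp add: generic_value_simps)
  have s0: "chart_span p 4 2 3 (affine_coord 4 0)"
  proof (rule chart_span_pair[OF p s(1,2) l1(1) l2(1)])
    fix D assume D: "deriv4 D"
    show "dcoord D 4 0 = fval (frac (4 * (Var 2 * Var 1)) ?M) * dcoord D 4 2
        + fval (frac (- (2 * (Var 3 * Var 4))) ?M) * dcoord D 4 3"
      unfolding l1(2) l2(2) generic_value_simps
      by (rule chart_solve_pair(1)[OF gM, of _ "dcoord D 4 1"])
         (use chart_relations[OF le(5) D] in simp_all)
  qed
  have s1: "chart_span p 4 2 3 (affine_coord 4 1)"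
  proof (rule chart_span_pair[OF p s(1,2) l3(1) l4(1)])
    fix D assume D: "deriv4 D"
    show "dcoord D 4 1 = fval (frac (- (2 * (Var 2 * Var 4))) ?M) * dcoord D 4 2
        + fval (frac (4 * (Var 0 * Var 3)) ?M) * dcoord D 4 3"
      unfolding l3(2) l4(2) generic_value_simps
      by (rule chart_solve_pair(2)[OF gM, of "dcoord D 4 0"])
         (use chart_relations[OF le(5) D] in simp_all)
  qed
  have eF: "eval_poly of_rat p (Var 4 ^ 2) \<noteq> 0" using z by (simp add: cplx.eval_simps)
  show ?thesis
  proof (rule anticanonical_at_point[OF p le(5) le(3) le(4) z _ local_ring_rat_fun[OF p m(1)]
        forms_Var_square[OF le(5)] G eF eG])
    show "chart_span p 4 2 3 (affine_coord 4 j)" if "j \<le> 4" for j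
      by (rule all_coords[OF s0 s1 s that])
    show "fval (frac (Var 4 ^ 2) ?M) * (gpt 4 / gpt 4)
        = gval (Var 4 ^ 2) / gval ?M"
      unfolding m(2) using generic_point_nonzero(3)[where 'a = rat] by simp
    fix D E assume DE: "deriv4 D" "deriv4 E"
    show "fval (residue_form D E) = fval (frac (Var 4 ^ 2) ?M)
        * (dcoord D 4 2 * dcoord E 4 3 - dcoord D 4 3 * dcoord E 4 2)"
      unfolding residue_identities_generic(3)[OF DE gM] m(2) by (simp add: generic_value_simps)
  qed
qed

lemma anticanonical_at_all: "anticanonical_at p"
proof -
  have q: "p 0 ^ 2 + p 1 * p 4 = p 2 ^ 2" "p 0 * p 4 + p 1 ^ 2 = p 3 ^ 2" "\<exists>i\<le>4. p i \<noteq> 0"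
    using p by (simp_all add: points_quadrics)
  have nonzero: "\<not> (p 0 = 0 \<and> p 1 = 0 \<and> p 2 = 0 \<and> p 3 = 0 \<and> p 4 = 0)"
    using q(3) all_coords[of "\<lambda>i. p i = 0"] by blast
  show ?thesis
  proof (cases "p 4 = 0")
    case True
    then have z: "p 0 ^ 2 = p 2 ^ 2" "p 1 ^ 2 = p 3 ^ 2" using q by simp_all
    show ?thesis
    proof (cases "p 0 = 0")
      case x: True
      then have u: "p 2 = 0" using z(1) by simp
      have "p 3 \<noteq> 0"
      proof
        assume "p 3 = 0"
        then have "p 1 = 0" using z(2) by simp
        then show False using \<open>p 3 = 0\<close> u x True nonzero by blast
      qed
      moreover from this have "p 1 \<noteq> 0" using z(2) by auto
      ultimately show ?thesis by (intro chart_y_xu)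
    next
      case False
      then have "p 2 \<noteq> 0" using z(1) by auto
      with False show ?thesis by (rule chart_x_yv)
    qed
  next
    case z: False
    consider "p 2 \<noteq> 0" | "p 3 \<noteq> 0" | "p 2 = 0" "p 3 = 0" by blast
    then show ?thesis
    proof cases
      case 3
      have x: "p 0 ^ 2 = - (p 1 * p 4)" and y: "p 1 ^ 2 = - (p 0 * p 4)"
        using q(1,2) 3 by (simp_all add: eq_neg_iff_add_eq_0 add.commute)
      have "4 * (p 0 * p 1) - p 4 ^ 2 \<noteq> 0"
      proof
        assume M: "4 * (p 0 * p 1) - p 4 ^ 2 = 0"
        have "(p 0 * p 1) ^ 2 = p 0 * p 1 * p 4 ^ 2"
          unfolding power_mult_distrib x y by (simp add: power2_eq_square)
        then have "p 0 * p 1 = 0 \<or> p 0 * p 1 = p 4 ^ 2" by (simp add: power2_eq_square)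
        then show False using M z by auto
      qed
      then show ?thesis by (rule chart_z_uv[OF z])
    qed (use chart_z_yv[OF z] chart_z_xu[OF z] in blast)+
  qed
qed

end

theorem anticanonical_quadrics: "anticanonical_power_is_O1 4 quadI 1"
  unfolding anticanonical_power_is_O1_def
proof (rule exI[of _ residue_form], rule exI[of _ "Var 4"], rule exI[of _ 1], rule exI[of _ 0],
    intro conjI ballI)
  show "(Var 4 :: rat mpoly) \<in> forms 4 (Suc 0)" using forms_Var[of 4 4] by simp
  show "Var 4 \<notin> (quadI :: rat mpoly set)" by (rule Var_notin_ideal) simp
  show "1 \<notin> (quadI :: rat mpoly set)" by (simp add: quadrics_ideal_kernel generic_value_simps)
qed (rule forms_1, rule anticanonical_at_all)

section \<open>The identity map\<close>

lemma proj_eq_values: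
  assumes "\<And>i. i \<le> m \<Longrightarrow> r i \<in> regs" "\<And>i. i \<le> m \<Longrightarrow> s i \<in> regs"
    and "\<And>i j. i \<le> m \<Longrightarrow> j \<le> m \<Longrightarrow> fval (r i) * fval (s j) = fval (r j) * fval (s i)"
  shows "proj_eq 4 quadI m r s"
  unfolding proj_eq_def using assms by (simp add: null_fun_diff_iff regular_intros fval_simps)

lemma to_fract_Var_regular:
  assumes "i \<le> 4"
  shows "to_fract (Var i) \<in> regs" "fval (to_fract (Var i)) = gpt i"
  using regular_to_fract[OF polys_Var[OF assms]] by (simp_all add: generic_value_simps)

lemma identity_rational_map: "rational_map 4 quadI 4 quadI (affine_coord 4)"
  unfolding rational_map_def
proof (intro conjI ballI allI impI quadrics_variety)
  show "affine_coord 4 i \<in> coord_field" if "i \<le> 4" for i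
    by (rule affine_coord_rat_fun[OF that]) simp
  have "affine_coord 4 4 \<notin> null4"
    by (simp add: null_fun_iff fval_affine_coord generic_point_nonzero)
  then show "\<exists>i\<le>4. affine_coord 4 i \<notin> null4" by blast
  fix G :: "rat mpoly" assume "G \<in> quadI"
  then obtain a b where G: "G = a * quadric1 + b * quadric2" "G \<in> polys 4"
    using quadrics_idealD(1) unfolding quadrics_ideal_eq by blast
  have "eval_poly (\<lambda>a. embed (Const a)) (\<lambda>j. fval (affine_coord 4 j)) G = 0"
    using eval_chart[OF quadric_forms(1), of 4] eval_chart[OF quadric_forms(2), of 4]
    by (simp add: G(1) gen.eval_simps generic_value_quadrics)
  then show "subst_poly (affine_coord 4) G \<in> null4"
    using regular_eval_poly[OF G(2) affine_coord_regular[OF _ le(5)]] by (simp add: null_fun_iff)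
qed

lemma identity_isomorphism: "isomorphic_varieties 4 quadI 4 quadI"
  unfolding isomorphic_varieties_def
proof (intro exI conjI ballI)
  have eq: "proj_eq 4 quadI 4 (affine_coord 4) (\<lambda>j. to_fract (Var j))"
    by (rule proj_eq_values)
       (simp_all add: affine_coord_regular to_fract_Var_regular fval_affine_coord)
  have sub: "(\<lambda>j. subst_poly (affine_coord 4) (Var j)) = affine_coord 4"
    by (simp add: subst_poly_def fr.eval_Var)
  have "affine_coord 4 4 \<notin> null4"
    by (simp add: null_fun_iff fval_affine_coord generic_point_nonzero)
  then have nn: "\<exists>j\<le>4. subst_poly (affine_coord 4) (Var j) \<notin> null4"
    by (auto simp: subst_poly_def fr.eval_Var)
  have "is_composite 4 quadI 4 quadI 4 (affine_coord 4) (affine_coord 4)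
          (\<lambda>i. to_fract (Var i))"
    unfolding is_composite_def
  proof (rule exI[of _ Var], rule exI[of _ 1], intro conjI eq nn allI impI)
    show "Var j \<in> forms 4 1" if "j \<le> 4" for j using that by (rule forms_Var)
    show "proj_eq 4 quadI 4 (\<lambda>j. subst_poly (affine_coord 4) (Var j)) (\<lambda>i. to_fract (Var i))"
      unfolding sub by (rule eq)
  qed
  then show "mutually_inverse 4 quadI 4 quadI (affine_coord 4) (affine_coord 4)"
    unfolding mutually_inverse_def using identity_rational_map by simp
  have reg: "regular_at 4 quadI 4 (affine_coord 4) p" if "p \<in> points 4 quadI" for p
  proof -
    have "\<exists>k\<le>4. p k \<noteq> 0" using that by (simp add: points_quadrics)
    then obtain k where k: "k \<le> 4" "p k \<noteq> 0" by blast
    have "affine_coord k k \<in> local_units 4 p"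
    proof -
      have "eval_poly of_rat p (Var k) \<noteq> 0" using k by (simp add: cplx.eval_Var)
      with forms_Var[OF k(1)] show ?thesis unfolding local_units_def affine_coord_def by blast
    qed
    moreover have "affine_coord k i \<in> local_ring 4 p" if "i \<le> 4" for i
      by (rule affine_coord_local[of k i p]) (use k that in simp_all)
    moreover have "proj_eq 4 quadI 4 (affine_coord 4) (affine_coord k)"
      by (rule proj_eq_values) (simp_all add: affine_coord_regular k fval_affine_coord)
    ultimately show ?thesis unfolding regular_at_def using k(1) by blast
  qed
  show "regular_at 4 quadI 4 (affine_coord 4) p" if "p \<in> points 4 quadI" for p
    by (rule reg[OF that])
  show "regular_at 4 quadI 4 (affine_coord 4) p" if "p \<in> points 4 quadI" for p
    by (rule reg[OF that])
qed

theorem quadrics_del_Pezzo: "del_Pezzo_surface 4 quadI 4"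
  unfolding del_Pezzo_surface_def
proof (intro conjI quadrics_smooth)
  \<comment> \<open>The surface in its given embedding, with the first power of the anticanonical sheaf.\<close>
  have "has_dim_degree 4 quadI 2 (1\<^sup>2 * 4)" using quadrics_dim_degree by simp
  then show "\<exists>m J e. e > 0 \<and> smooth_variety m J 2 \<and> isomorphic_varieties 4 quadI m J \<and>
        anticanonical_power_is_O1 m J e \<and> has_dim_degree m J 2 (e\<^sup>2 * 4)"
    by (intro exI[of _ "4::nat"] exI[of _ quadI] exI[of _ "1::nat"] conjI quadrics_smooth
        identity_isomorphism anticanonical_quadrics zero_less_one)
qed

section \<open>The parametrization and its inverse\<close>

text \<open>The components of the parametrization and of its inverse, in affine coordinates.\<close>

definition param_lam :: "rat mpoly fract" where "param_lam = affine_coord 2 0"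

definition param_mu :: "rat mpoly fract" where "param_mu = affine_coord 2 1"

definition param_x :: "rat mpoly fract" where
  "param_x = (param_mu ^ 2 - param_lam ^ 4) / (4 * param_lam ^ 3 - 4 * param_lam * param_mu + 1)"

definition param :: "nat \<Rightarrow> rat mpoly fract" where
  "param = (\<lambda>i. [param_x, 2 * param_lam * param_x + param_lam ^ 2, param_x + param_lam,
     2 * param_lam * param_x + param_mu, 1] ! i)"

definition inv_lam :: "rat mpoly fract" where "inv_lam = affine_coord 4 2 - affine_coord 4 0"

definition inv_mu :: "rat mpoly fract" where
  "inv_mu = affine_coord 4 3 - 2 * inv_lam * affine_coord 4 0"

definition inv_param :: "nat \<Rightarrow> rat mpoly fract" where
  "inv_param = (\<lambda>i. [inv_lam, inv_mu, 1] ! i)"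

lemma param_nth:
  "param 0 = param_x" "param 1 = 2 * param_lam * param_x + param_lam ^ 2"
  "param 2 = param_x + param_lam" "param 3 = 2 * param_lam * param_x + param_mu" "param 4 = 1"
  "inv_param 0 = inv_lam" "inv_param 1 = inv_mu" "inv_param 2 = 1"
  by (simp_all add: param_def inv_param_def)

text \<open>Numerator and denominator of the coordinate x, homogenized in degrees 4 and 3.\<close>

definition num_form :: "rat mpoly" where "num_form = Var 1 ^ 2 * Var 2 ^ 2 - Var 0 ^ 4"

definition den_form :: "rat mpoly" where
  "den_form = 4 * Var 0 ^ 3 - 4 * Var 0 * Var 1 * Var 2 + Var 2 ^ 3"

lemma den_form_nonzero: "den_form \<noteq> 0"
proof
  assume "den_form = 0"
  then have "eval_poly of_rat (\<lambda>i. if i = 2 then 1 else 0 :: complex) den_form = 0" by simp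
  then show False by (simp add: den_form_def cplx.eval_simps)
qed

lemma num_den_forms: "num_form \<in> forms 2 4" "den_form \<in> forms 2 3"
proof -
  have V: "Var i ^ k \<in> forms 2 k" if "i \<le> 2" for i k
    using forms_power[OF forms_Var[OF that], of k] by simp
  show "num_form \<in> forms 2 4" unfolding num_form_def
    by (intro forms_diff forms_mult'[OF V V] V) simp_all
  have "4 * Var 0 * Var 1 * Var 2 \<in> forms 2 3"
    by (intro forms_mult'[of _ 2 2 _ 1] forms_mult'[of _ 2 1 _ 1] forms_mult'[of _ 2 0 _ 1]
        forms_numeral forms_Var) simp_all
  moreover have "4 * Var 0 ^ 3 \<in> forms 2 3" by (intro forms_mult'[of _ 2 0 _ 3] forms_numeral V) simp_all
  ultimately show "den_form \<in> forms 2 3" unfolding den_form_def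
    by (intro forms_add forms_diff V) simp_all
qed

lemma param_lam_mu:
  "param_lam = to_fract (Var 0) / to_fract (Var 2)" "param_mu = to_fract (Var 1) / to_fract (Var 2)"
  by (simp_all add: param_lam_def param_mu_def affine_coord_def to_fract_def)

lemma to_fract_numeral: "to_fract (numeral k) = numeral k"
proof -
  have "to_fract (of_nat n) = of_nat n" for n
    by (induction n) (simp_all add: to_fract_simps)
  from this[of "numeral k"] show ?thesis by simp
qed

lemma to_fract_power: "to_fract (p ^ k) = to_fract p ^ k"
  by (induction k) (simp_all add: to_fract_simps)

lemma to_fract_divide: "to_fract p / to_fract q = frac p q"
  by (simp add: to_fract_def)

lemma to_fract_eq_0_iff: "to_fract p = 0 \<longleftrightarrow> p = 0"
  using to_fract_eq_iff[of p 0] by (simp add: to_fract_simps)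

lemma param_den:
  "4 * param_lam ^ 3 - 4 * param_lam * param_mu + 1 = to_fract den_form / to_fract (Var 2) ^ 3"
  "4 * param_lam ^ 3 - 4 * param_lam * param_mu + 1 \<noteq> 0"
proof -
  have c: "to_fract (Var 2) \<noteq> 0" by (simp add: to_fract_eq_0_iff)
  show eq: "4 * param_lam ^ 3 - 4 * param_lam * param_mu + 1 = to_fract den_form / to_fract (Var 2) ^ 3"
    using c by (simp add: param_lam_mu den_form_def to_fract_simps to_fract_power to_fract_numeral
        field_simps power3_eq_cube)
  show "4 * param_lam ^ 3 - 4 * param_lam * param_mu + 1 \<noteq> 0"
    unfolding eq using c den_form_nonzero by (simp add: to_fract_eq_0_iff)
qed

lemma param_x_relation:
  "param_x * (4 * param_lam ^ 3 - 4 * param_lam * param_mu + 1) = param_mu ^ 2 - param_lam ^ 4"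
  unfolding param_x_def using param_den(2) by simp

lemma param_x_eq: "param_x = to_fract num_form / (to_fract (Var 2) * to_fract den_form)"
proof -
  have c: "to_fract (Var 2) \<noteq> 0" by (simp add: to_fract_eq_0_iff)
  have "param_mu ^ 2 - param_lam ^ 4 = to_fract num_form / to_fract (Var 2) ^ 4"
    using c by (simp add: param_lam_mu num_form_def to_fract_simps to_fract_power power_divide
        diff_divide_distrib power2_eq_square power4_eq_xxxx)
  then show ?thesis
    unfolding param_x_def param_den(1) using c den_form_nonzero
    by (simp add: power3_eq_cube power4_eq_xxxx to_fract_eq_0_iff)
qed

lemma param_rat_fun:
  assumes "i \<le> 4" shows "param i \<in> rat_fun 2 {0}"
proof -
  have lm: "param_lam \<in> fracs 2 (- {0})" "param_mu \<in> fracs 2 (- {0})"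
    unfolding param_lam_def param_mu_def affine_coord_def
    by (rule fracsI[OF forms_Var forms_Var]; simp)+
  have "param_x = frac num_form (Var 2 * den_form)"
    by (simp add: param_x_eq to_fract_simps flip: to_fract_divide)
  moreover have vd: "Var 2 * den_form \<in> - {0}" using den_form_nonzero by simp
  moreover have "Var 2 * den_form \<in> forms 2 4"
    by (rule forms_mult'[OF forms_Var num_den_forms(2)]) simp_all
  ultimately have x: "param_x \<in> fracs 2 (- {0})"
    using fracsI[OF num_den_forms(1), of "Var 2 * den_form" "- {0}"] vd by (simp only:)
  show ?thesis unfolding rat_fun_fracs
    by (rule all_coords[OF _ _ _ _ _ assms]; unfold param_nth; intro P.fracs_intros lm x)
qed

lemma param_quadrics: "subst_poly param quadric1 = 0" "subst_poly param quadric2 = 0"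
proof -
  show "subst_poly param quadric1 = 0"
    by (simp add: subst_poly_def quadric1_def fr.eval_simps param_nth power2_eq_square algebra_simps
        del: One_nat_def)
  have "subst_poly param quadric2 = param_x * (4 * param_lam ^ 3 - 4 * param_lam * param_mu + 1)
      - (param_mu ^ 2 - param_lam ^ 4)"
    by (simp add: subst_poly_def quadric2_def fr.eval_simps param_nth power2_eq_square power3_eq_cube
        power4_eq_xxxx algebra_simps del: One_nat_def)
  then show "subst_poly param quadric2 = 0" unfolding param_x_relation by simp
qed

lemma param_rational_map: "rational_map 2 {0} 4 quadI param"
  unfolding rational_map_def
proof (intro conjI projective_space_variety quadrics_variety allI impI ballI)
  show "param i \<in> rat_fun 2 {0}" if "i \<le> 4" for i by (rule param_rat_fun[OF that])
  have "param 4 \<notin> null_fun 2 {0}" by (simp add: null_fun_space param_nth)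
  then show "\<exists>i\<le>4. param i \<notin> null_fun 2 {0}" by blast
  fix G :: "rat mpoly" assume "G \<in> quadI"
  then obtain a b where G: "G = a * quadric1 + b * quadric2" unfolding quadrics_ideal_eq by blast
  have "subst_poly param G = subst_poly param a * subst_poly param quadric1
      + subst_poly param b * subst_poly param quadric2"
    by (simp add: G subst_poly_def fr.eval_simps)
  then show "subst_poly param G \<in> null_fun 2 {0}" by (simp add: param_quadrics null_fun_space)
qed

lemma inv_lam_mu_rat_fun: "inv_lam \<in> coord_field" "inv_mu \<in> coord_field"
  unfolding inv_mu_def inv_lam_def
  by (intro coord_field_intros affine_coord_rat_fun; simp)+

lemma fval_inv:
  "fval inv_lam = (gpt 2 - gpt 0) / gpt 4"
  "fval inv_mu = (gpt 3 * gpt 4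
     - 2 * (gpt 2 - gpt 0) * gpt 0) / gpt 4 ^ 2"
proof -
  have reg: "affine_coord 4 i \<in> regs" if "i \<le> 4" for i
    by (rule affine_coord_regular[OF that]) simp
  show l: "fval inv_lam = (gpt 2 - gpt 0) / gpt 4"
    by (simp add: inv_lam_def fval_simps reg fval_affine_coord diff_divide_distrib)
  show "fval inv_mu = (gpt 3 * gpt 4
     - 2 * (gpt 2 - gpt 0) * gpt 0) / gpt 4 ^ 2"
    using generic_point_nonzero(3)[where 'a = rat] rat_fun_regular[OF inv_lam_mu_rat_fun(1)]
    by (simp add: inv_mu_def fval_simps regular_intros reg l fval_affine_coord diff_divide_distrib
        left_diff_distrib power2_eq_square)
qed

lemma all_coords2: "P 0 \<Longrightarrow> P 1 \<Longrightarrow> P 2 \<Longrightarrow> i \<le> (2 :: nat) \<Longrightarrow> P i"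
proof -
  assume P: "P 0" "P 1" "P 2" and "i \<le> 2"
  then have "i = 0 \<or> i = 1 \<or> i = 2" by linarith
  then show "P i" using P by blast
qed

lemma inv_param_rat_fun: "i \<le> 2 \<Longrightarrow> inv_param i \<in> coord_field"
  by (rule all_coords2[where i = i]; (simp only: param_nth)?)
     (simp_all only: inv_lam_mu_rat_fun coord_field_intros)

lemma inv_param_rational_map: "rational_map 4 quadI 2 {0} inv_param"
  unfolding rational_map_def
proof (intro conjI projective_space_variety quadrics_variety allI impI ballI)
  show "inv_param i \<in> coord_field" if "i \<le> 2" for i by (rule inv_param_rat_fun[OF that])
  have "inv_param 2 \<notin> null4" by (simp add: null_fun_iff fval_simps param_nth)
  then show "\<exists>i\<le>2. inv_param i \<notin> null4" by blast
  show "subst_poly inv_param G \<in> null4" if "G \<in> {0}" for G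
    using that by (simp add: subst_poly_def null_fun_iff regular_intros fval_simps)
qed

text \<open>The inverse map is given by quadratic forms, the parametrization by forms of degree 5.\<close>

definition inv_form :: "nat \<Rightarrow> rat mpoly" where
  "inv_form = (\<lambda>i. [(Var 2 - Var 0) * Var 4, Var 3 * Var 4 - 2 * (Var 2 - Var 0) * Var 0, Var 4 ^ 2] ! i)"

definition param_form :: "nat \<Rightarrow> rat mpoly" where
  "param_form = (\<lambda>i. [num_form * Var 2, 2 * Var 0 * num_form + Var 0 ^ 2 * den_form,
     num_form * Var 2 + Var 0 * Var 2 * den_form, 2 * Var 0 * num_form + Var 1 * Var 2 * den_form,
     Var 2 ^ 2 * den_form] ! i)"

lemma form_nth:
  "inv_form 0 = (Var 2 - Var 0) * Var 4" "inv_form 1 = Var 3 * Var 4 - 2 * (Var 2 - Var 0) * Var 0"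
  "inv_form 2 = Var 4 ^ 2"
  "param_form 0 = num_form * Var 2" "param_form 1 = 2 * Var 0 * num_form + Var 0 ^ 2 * den_form"
  "param_form 2 = num_form * Var 2 + Var 0 * Var 2 * den_form"
  "param_form 3 = 2 * Var 0 * num_form + Var 1 * Var 2 * den_form"
  "param_form 4 = Var 2 ^ 2 * den_form"
  by (simp_all add: inv_form_def param_form_def)

lemma inv_form_forms: "j \<le> 2 \<Longrightarrow> inv_form j \<in> forms 4 2"
proof (rule all_coords2[where i = j])
  have d: "Var 2 - Var 0 \<in> forms 4 1" by (intro forms_diff forms_Var) simp_all
  show "inv_form 0 \<in> forms 4 2" unfolding form_nth
    by (rule forms_mult'[OF d forms_Var]) simp_all
  have "2 * (Var 2 - Var 0) \<in> forms 4 1" by (rule forms_mult'[OF forms_numeral d]) simp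
  then have "2 * (Var 2 - Var 0) * Var 0 \<in> forms 4 2" by (rule forms_mult'[OF _ forms_Var]) simp_all
  then show "inv_form 1 \<in> forms 4 2" unfolding form_nth by (intro forms_diff forms_Var2) simp_all
  show "inv_form 2 \<in> forms 4 2" unfolding form_nth by (rule forms_Var_square) simp
qed

lemma param_form_forms: "j \<le> 4 \<Longrightarrow> param_form j \<in> forms 2 5"
proof (rule all_coords[where j = j])
  note N = num_den_forms(1) and D = num_den_forms(2)
  have x: "num_form * Var 2 \<in> forms 2 5" by (rule forms_mult'[OF N forms_Var]) simp_all
  have "2 * Var 0 \<in> forms 2 1" by (rule forms_mult'[OF forms_numeral forms_Var]) simp_all
  then have l: "2 * Var 0 * num_form \<in> forms 2 5" by (rule forms_mult'[OF _ N]) simp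
  have q: "Var i * Var j * den_form \<in> forms 2 5" if "i \<le> 2" "j \<le> 2" for i j
    by (rule forms_mult'[OF forms_Var2[OF that] D]) simp
  show "param_form 0 \<in> forms 2 5" "param_form 1 \<in> forms 2 5" "param_form 2 \<in> forms 2 5"
    "param_form 3 \<in> forms 2 5" "param_form 4 \<in> forms 2 5"
    unfolding form_nth power2_eq_square by (intro forms_add x l q; simp)+
qed

lemma param_inv_composite: "is_composite 2 {0} 4 quadI 2 param inv_param (\<lambda>i. to_fract (Var i))"
  unfolding is_composite_def
proof (rule exI[of _ inv_form], rule exI[of _ 2], intro conjI allI impI)
  show "inv_form j \<in> forms 4 2" if "j \<le> 2" for j by (rule inv_form_forms[OF that])
  have v: "fval (inv_param j) = gval (inv_form j) / gpt 4 ^ 2" if "j \<le> 2" for j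
    by (rule all_coords2[OF _ _ _ that]; unfold param_nth form_nth)
       (simp_all add: fval_inv fval_simps generic_value_simps generic_point_nonzero power2_eq_square)
  show "proj_eq 4 quadI 2 inv_param (\<lambda>j. to_fract (inv_form j))"
  proof (rule proj_eq_values)
    show "inv_param i \<in> regs" if "i \<le> 2" for i
      by (rule rat_fun_regular[OF inv_param_rat_fun[OF that]])
    show "to_fract (inv_form i) \<in> regs" if "i \<le> 2" for i
      by (rule regular_to_fract(1)[OF forms_polys[OF inv_form_forms[OF that]]])
    show "fval (inv_param i) * fval (to_fract (inv_form j)) = fval (inv_param j) * fval (to_fract (inv_form i))"
      if "i \<le> 2" "j \<le> 2" for i j
      unfolding v[OF that(1)] v[OF that(2)]
        regular_to_fract(2)[OF forms_polys[OF inv_form_forms[OF that(1)]]]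
        regular_to_fract(2)[OF forms_polys[OF inv_form_forms[OF that(2)]]] by simp
  qed
  have s: "subst_poly param (inv_form 0) = param_lam" "subst_poly param (inv_form 1) = param_mu"
    "subst_poly param (inv_form 2) = 1"
    by (simp_all add: subst_poly_def form_nth fr.eval_simps param_nth del: One_nat_def)
  then show "\<exists>j\<le>2. subst_poly param (inv_form j) \<notin> null_fun 2 {0}"
    by (intro exI[of _ 2]) (simp add: null_fun_space)
  have c: "to_fract (Var 2) \<noteq> 0" by (simp add: to_fract_eq_0_iff)
  have t: "subst_poly param (inv_form j) = to_fract (Var j) / to_fract (Var 2)" if "j \<le> 2" for j
    by (rule all_coords2[OF _ _ _ that]; unfold s param_lam_mu) (use c in simp_all)
  show "proj_eq 2 {0} 2 (\<lambda>j. subst_poly param (inv_form j)) (\<lambda>i. to_fract (Var i))"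
    unfolding proj_eq_def null_fun_space by (auto simp: t)
qed

text \<open>
  The image under the inverse map of the point (0 : 0 : 0 : 0 : 1) lies off the curve on which the
  denominator of the parametrization vanishes.
\<close>

lemma inv_den_nonzero:
  "4 * fval inv_lam ^ 3 - 4 * fval inv_lam * fval inv_mu + 1 \<noteq> 0"
proof -
  let ?G = "4 * (Var 2 - Var 0) ^ 3
      - 4 * (Var 2 - Var 0) * (Var 3 * Var 4 - 2 * (Var 2 - Var 0) * Var 0) + Var 4 ^ 3 :: rat mpoly"
  define p :: "nat \<Rightarrow> complex" where "p = (\<lambda>i. if i = 4 then 1 else 0)"
  have p: "p \<in> points 4 quadI"
    unfolding points_quadrics by (auto simp: p_def)
  have n: "numeral k \<in> polys 4" for k using forms_polys[OF forms_numeral] .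
  have "?G \<in> polys 4" by (intro polys_intros polys_Var n; simp)
  moreover have "eval_poly of_rat p ?G \<noteq> 0" by (simp add: cplx.eval_simps p_def)
  ultimately have G: "gval ?G \<noteq> 0" by (rule point_not_ideal[OF p])
  have "gval ?G = gpt 4 ^ 3 * (4 * fval inv_lam ^ 3 - 4 * fval inv_lam * fval inv_mu + 1)"
    using generic_point_nonzero(3)[where 'a = rat]
    by (simp add: fval_inv generic_value_simps field_simps power2_eq_square power3_eq_cube)
  then show ?thesis using G by auto
qed

lemma inv_x_relation:
  "gpt 0 / gpt 4 * (4 * fval inv_lam ^ 3 - 4 * fval inv_lam * fval inv_mu + 1)
     = fval inv_mu ^ 2 - fval inv_lam ^ 4"
proof -
  define x y u v :: "rat big_field" where "x = gpt 0 / gpt 4"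
    and "y = gpt 1 / gpt 4" and "u = gpt 2 / gpt 4"
    and "v = gpt 3 / gpt 4"
  note xyuv = x_def y_def u_def v_def
  note nz = generic_point_nonzero(3)[where 'a = rat]
  have sq: "u ^ 2 = x ^ 2 + y" "v ^ 2 = x + y ^ 2"
    unfolding xyuv power_divide generic_point_relations
    using nz by (simp_all add: add_divide_distrib power2_eq_square[of "gpt 4"])
  define l where "l = u - x"
  have l: "fval inv_lam = l" unfolding fval_inv l_def xyuv by (simp add: diff_divide_distrib)
  have m: "fval inv_mu = v - 2 * l * x"
    unfolding fval_inv l_def xyuv using nz by (simp add: field_simps power2_eq_square)
  have y: "y = 2 * l * x + l ^ 2" using sq(1) by (simp add: l_def algebra_simps power2_eq_square)
  have "x * (4 * l ^ 3 - 4 * l * (v - 2 * l * x) + 1) - ((v - 2 * l * x) ^ 2 - l ^ 4)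
      = x + (2 * l * x + l ^ 2) ^ 2 - v ^ 2"
    by (simp add: algebra_simps power2_eq_square power3_eq_cube power4_eq_xxxx)
  also have "\<dots> = 0" using sq(2) y by simp
  finally show ?thesis unfolding l m x_def[symmetric] by simp
qed

lemma inv_param_composite:
  "is_composite 4 quadI 2 {0} 4 inv_param param (\<lambda>i. to_fract (Var i))"
  unfolding is_composite_def
proof (rule exI[of _ param_form], rule exI[of _ 5], intro conjI allI impI)
  show "param_form j \<in> forms 2 5" if "j \<le> 4" for j by (rule param_form_forms[OF that])
  have c: "to_fract (Var 2) \<noteq> 0" and d: "to_fract den_form \<noteq> 0"
    by (simp_all add: to_fract_eq_0_iff den_form_nonzero)
  have "param j = to_fract (param_form j) / to_fract (param_form 4)" if "j \<le> 4" for j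
    by (rule all_coords[OF _ _ _ _ _ that]; unfold param_nth form_nth param_x_eq param_lam_mu)
       (use c d in \<open>simp_all add: to_fract_simps to_fract_power to_fract_numeral field_simps power2_eq_square\<close>)
  then show "proj_eq 2 {0} 4 param (\<lambda>j. to_fract (param_form j))"
    unfolding proj_eq_def null_fun_space by auto
  let ?l = "fval inv_lam" and ?m = "fval inv_mu" and ?z = "gpt 4 :: rat big_field"
  let ?den = "4 * fval inv_lam ^ 3 - 4 * fval inv_lam * fval inv_mu + 1"
  have reg: "inv_param i \<in> regs" if "i \<le> 2" for i
    by (rule rat_fun_regular[OF inv_param_rat_fun[OF that]])
  let ?e = "eval_poly (\<lambda>a. embed (Const a)) (\<lambda>i. fval (inv_param i))"
  have ev: "subst_poly inv_param (param_form j) \<in> regs"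
    "fval (subst_poly inv_param (param_form j)) = ?e (param_form j)" if "j \<le> 4" for j
  proof -
    note q = forms_polys[OF param_form_forms[OF that]]
    show "subst_poly inv_param (param_form j) \<in> regs"
      by (rule regular_eval_poly(1)[OF q]) (rule reg)
    show "fval (subst_poly inv_param (param_form j)) = ?e (param_form j)"
      by (rule regular_eval_poly(2)[OF q]) (rule reg)
  qed
  have e: "?e (Var 0) = ?l" "?e (Var 1) = ?m" "?e (Var 2) = 1"
    by (simp_all add: gen.eval_Var param_nth fval_simps del: One_nat_def)
  have eD: "?e den_form = ?den"
    by (simp add: den_form_def gen.eval_add gen.eval_diff gen.eval_mult gen.eval_power gen.eval_numeral e
        del: One_nat_def)
  have eN: "?e num_form = gpt 0 / ?z * ?den"
    unfolding inv_x_relation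
    by (simp add: num_form_def gen.eval_diff gen.eval_mult gen.eval_power e del: One_nat_def)
  note nz = generic_point_nonzero(3)[where 'a = rat]
  define x where "x = gpt 0 / ?z"
  have yuv: "gpt 1 / ?z = 2 * ?l * x + ?l ^ 2" "gpt 2 / ?z = x + ?l"
    "gpt 3 / ?z = 2 * ?l * x + ?m"
  proof -
    show u: "gpt 2 / ?z = x + ?l" by (simp add: fval_inv x_def diff_divide_distrib)
    show "gpt 3 / ?z = 2 * ?l * x + ?m"
      unfolding fval_inv x_def using nz by (simp add: field_simps power2_eq_square)
    have "(gpt 2 / ?z) ^ 2 = x ^ 2 + gpt 1 / ?z"
      unfolding x_def power_divide generic_point_relations
      using nz by (simp add: add_divide_distrib power2_eq_square[of ?z])
    then show "gpt 1 / ?z = 2 * ?l * x + ?l ^ 2"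
      unfolding u by (simp add: algebra_simps power2_eq_square)
  qed
  have val: "?e (param_form j) = gpt j / ?z * ?den" if "j \<le> 4" for j
  proof (rule all_coords[OF _ _ _ _ _ that])
    note ee = gen.eval_add gen.eval_mult gen.eval_power gen.eval_numeral e eD eN x_def[symmetric]
    show "?e (param_form 0) = gpt 0 / ?z * ?den" unfolding form_nth ee by simp
    show "?e (param_form 1) = gpt 1 / ?z * ?den" unfolding form_nth ee yuv by (simp add: algebra_simps)
    show "?e (param_form 2) = gpt 2 / ?z * ?den" unfolding form_nth ee yuv by (simp add: algebra_simps)
    show "?e (param_form 3) = gpt 3 / ?z * ?den" unfolding form_nth ee yuv by (simp add: algebra_simps)
    show "?e (param_form 4) = gpt 4 / ?z * ?den" unfolding form_nth ee using nz by simp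
  qed
  have "fval (subst_poly inv_param (param_form 4)) \<noteq> 0"
    unfolding ev(2)[OF le(5)] val[OF le(5)] using nz inv_den_nonzero by simp
  then have "subst_poly inv_param (param_form 4) \<notin> null4"
    by (simp add: null_fun_iff)
  then show "\<exists>j\<le>4. subst_poly inv_param (param_form j) \<notin> null4" by blast
  show "proj_eq 4 quadI 4 (\<lambda>j. subst_poly inv_param (param_form j)) (\<lambda>i. to_fract (Var i))"
    by (rule proj_eq_values) (simp_all add: ev val to_fract_Var_regular)
qed

theorem param_mutually_inverse: "mutually_inverse 2 {0} 4 quadI param inv_param"
  unfolding mutually_inverse_def
  by (intro conjI param_rational_map inv_param_rational_map param_inv_composite inv_param_composite)

(* The letter X is a variable of the theorem below. *)
no_notation var (\<open>X\<index>\<close>)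

theorem mainTheorem1:
  fixes X :: "rat mpoly set" and Q1 Q2 :: "rat mpoly"
    and lam mu x y u v x' u' v' lam' mu' :: "rat mpoly fract"
    and phi psi :: "nat \<Rightarrow> rat mpoly fract"
  \<comment> \<open>variables of affine 4-space: x, y, u, v = X_0, X_1, X_2, X_3; at infinity: z = X_4\<close>
  assumes X: "X = projective_closure 3 (genideal (poly_ring 3)
      {Var 0 ^ 2 + Var 1 - Var 2 ^ 2, Var 0 + Var 1 ^ 2 - Var 3 ^ 2})"
    and Q1: "Q1 = Var 0 ^ 2 + Var 1 * Var 4 - Var 2 ^ 2"
    and Q2: "Q2 = Var 0 * Var 4 + Var 1 ^ 2 - Var 3 ^ 2"
  \<comment> \<open>affine coordinates on the projective plane and the components of the map phi\<close>
    and "lam = affine_coord 2 0" and "mu = affine_coord 2 1"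
    and "x = (mu ^ 2 - lam ^ 4) / (4 * lam ^ 3 - 4 * lam * mu + 1)"
    and "y = 2 * lam * x + lam ^ 2"
    and "u = x + lam"
    and "v = 2 * lam * x + mu"
    and "phi = (\<lambda>i. [x, y, u, v, 1] ! i)"
  \<comment> \<open>affine coordinates on X and the components of the inverse map psi\<close>
    and "x' = affine_coord 4 0" "u' = affine_coord 4 2" and "v' = affine_coord 4 3"
    and "lam' = u' - x'"
    and "mu' = v' - 2 * lam' * x'"
    and "psi = (\<lambda>i. [lam', mu', 1] ! i)"
  shows "(Q1 \<in> forms 4 2 \<and> Q2 \<in> forms 4 2 \<and> X = genideal (poly_ring 4) {Q1, Q2} \<and>
          smooth_variety 4 X 2) \<and>
         del_Pezzo_surface 4 X 4 \<and>
         rational_map 2 {0} 4 X phi \<and>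
         birational_map 2 {0} 4 X phi \<and>
         mutually_inverse 2 {0} 4 X phi psi"
proof -
  have X: "X = quadI" unfolding X by (rule projective_closure_quadrics)
  have Q: "Q1 = quadric1" "Q2 = quadric2" unfolding Q1 Q2 quadric1_def quadric2_def by simp_all
  have phi: "phi = param"
    unfolding assms(4-10) param_def param_x_def param_lam_def param_mu_def by (rule refl)
  have psi: "psi = inv_param"
    unfolding assms(11-16) inv_param_def inv_mu_def inv_lam_def by (rule refl)
  have "birational_map 2 {0} 4 quadI param"
    unfolding birational_map_def using param_mutually_inverse by blast
  then show ?thesis
    unfolding X Q phi psi quadI_def[symmetric]
    by (intro conjI quadric_forms refl quadrics_smooth quadrics_del_Pezzo param_rational_map
        param_mutually_inverse)
qed

end
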